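(* Let $\mathcal M'$ be a subcrystal of one of the monomial crystals below, let $V$ be the complex vector space with basis $(v_m)_{m\in\mathcal M'}$, put $v_0=0$, and consider the formulas $$x_{i,r}^+\cdot v_m=q^{r(p_i(m)-1)}v_{\tilde e_i\cdot m},\qquad x_{i,r}^-\cdot v_m=q^{r(q_i(m)+1)}v_{\tilde f_i\cdot m},$$ $$\phi^\pm_{i,\pm s}\cdot v_m=\pm(q-q^{-1})\big(\varphi_i(m)q^{\pm s(q_i(m)+1)}-\varepsilon_i(m)q^{\pm s(p_i(m)-1)}\big)v_m,\qquad k_h\cdot v_m=q^{\mathrm{wt}(m)(h)}v_m$$ for $r\in\mathbb Z$, $s>0$ (a term in which $p_i(m)$, resp. $q_i(m)$, is not defined, i.e. $\varepsilon_i(m)=0$, resp. $\varphi_i(m)=0$, is zero). (i) Let $n\ge1$, $1\le\ell\le n$, $k\in\mathbb Z$ and $\mathcal M'=\mathcal M_0(Y_{\ell,k})$. Then these formulas, for $i\in I_0$ and $h\in\mathfrak h_0$, endow $V$ with a structure of $\mathcal U_q(\widehat{sl}_{n+1})'$-module isomorphic to the fundamental module $V_0(Y_{\ell,k})$. (ii) Let $n=2r+1$ be odd ($r\ge1$), $\ell\in\{1,r+1,n\}$ and $\mathcal M'=\mathcal M(e^{\varpi_\ell}Y_{\ell,0}Y_{0,d_\ell}^{-1})$. Then these formulas, for $i\in I$ and $h\in\mathfrak h$, endow $V$ with a structure of $\mathcal U_q(sl_{n+1}^{tor})$-module isomorphic to the extremal fundamental loop weight module $V(e^{\varpi_\ell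}Y_{\ell,0}Y_{0,d_\ell}^{-1})$.
   Context: Root data. $I=\{0,\dots,n\}$ identified with $\mathbb Z/(n+1)\mathbb Z$, $I_0=\{1,\dots,n\}$; for $n\ge2$, $C=(C_{i,j})_{i,j\in I}$ is the Cartan matrix of type $A_n^{(1)}$ ($C_{i,i}=2$, $C_{i,i\pm1}=-1$, other entries $0$), and $(C_{i,j})_{i,j\in I_0}$ is the Cartan matrix of type $A_n$ ($n\ge 1$). $\mathfrak h=\bigoplus_{i\in I}\mathbb Q h_i\oplus\mathbb Q d$, $\mathfrak h_0=\bigoplus_{i\in I_0}\mathbb Qh_i$; $\alpha_i(h_j)=C_{j,i}$, $\alpha_i(d)=\delta_{0,i}$, $\Lambda_i(h_j)=\delta_{i,j}$, $\Lambda_i(d)=0$; $P=\{\lambda\in\mathfrak h^*:\lambda(h_i)\in\mathbb Z\ \forall i\}$, $\varpi_\ell=\Lambda_\ell-\Lambda_0$, $d_\ell=\min(\ell,n+1-\ell)$. Fix $q=e^t\in\mathbb C^*$ not a root of unity, $q^x=e^{tx}$ for $x\in\mathbb Q$, $[l]_q=\frac{q^l-q^{-l}}{q-q^{-1}}$. Monomial crystal $\mathcal M$ ($n$ odd, $n\ge3$). Consider monomials $m=e^{\omega(m)}\prod_{i\in I,l\in\mathbb Z}Y_{i,l}^{u_{i,l}(m)}$ with $u_{i,l}(m)\in\mathbb Z$ (finitely many non-zero), $\omega(m)\in P$, $\sum_l u_{i,l}(m)=\omega(m)(h_i)$. Put $A_{i,l}=e^{\alpha_i}Y_{i,l-1}Y_{i,l+1}Y_{i-1,l}^{-1}Y_{i+1,l}^{-1}$.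 Fix $s:I\to\{0,1\}$ with $s_i+s_j=1$ whenever $C_{i,j}=-1$ (chosen so that the monomials considered lie in $\mathcal M$); $\mathcal M$ is the group of monomials with $u_{i,l}(m)=0$ whenever $l\equiv s_i+1\bmod 2$. Set $\mathrm{wt}(m)=\omega(m)$, $\varphi_{i,L}(m)=\sum_{l\le L}u_{i,l}(m)$, $\varphi_i(m)=\max_L\varphi_{i,L}(m)$, $\varepsilon_{i,L}(m)=-\sum_{l\ge L}u_{i,l}(m)$, $\varepsilon_i(m)=\max_L\varepsilon_{i,L}(m)$, $p_i(m)=\max\{L:\varepsilon_{i,L}(m)=\varepsilon_i(m)\}$, $q_i(m)=\min\{L:\varphi_{i,L}(m)=\varphi_i(m)\}$; $\tilde e_i\cdot m=0$ if $\varepsilon_i(m)=0$, else $\tilde e_i\cdot m=mA_{i,p_i(m)-1}$; $\tilde f_i\cdot m=0$ if $\varphi_i(m)=0$, else $\tilde f_i\cdot m=mA_{i,q_i(m)+1}^{-1}$. $\mathcal M(m)$ is the connected subcrystal generated by $m$. Finite-type version $\mathcal M_0$ (any $n\ge1$). Defined in the same way with $I$ replaced by $I_0$: monomials $\prod_{i\in I_0,l}Y_{i,l}^{u_{i,l}}$ with the same parity condition, $A_{i,l}=Y_{i,l-1}Y_{i,l+1}\prod_{j\in I_0,\,C_{i,j}=-1}Y_{j,l}^{-1}$, $\mathrm{wt}(m)=\sum_{i\in I_0}\big(\sum_lu_{i,l}(m)\big)\Lambda_i$, and the same formulas for $\varepsilon_i,\varphi_i,p_i,q_i,\tilde e_i,\tilde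 f_i$ ($i\in I_0$). $\mathcal M_0(m)$ is the connected subcrystal generated by $m$. Algebras. $\mathcal U_q(sl_{n+1}^{tor})$ is the $\mathbb C$-algebra with generators $x_{i,r}^\pm$ ($i\in I,r\in\mathbb Z$), $k_h$ ($h\in\mathfrak h$), $h_{i,m}$ ($i\in I,m\in\mathbb Z\setminus\{0\}$) and relations: $k_hk_{h'}=k_{h+h'}$, $k_0=1$, $[k_h,h_{j,m}]=0$, $[h_{i,m},h_{j,m'}]=0$; $k_hx_{j,r}^\pm k_{-h}=q^{\pm\alpha_j(h)}x_{j,r}^\pm$; $[h_{i,m},x_{j,r}^\pm]=\pm\frac1m[mC_{i,j}]_qx_{j,m+r}^\pm$; $[x_{i,r}^+,x_{j,r'}^-]=\delta_{ij}\frac{\phi^+_{i,r+r'}-\phi^-_{i,r+r'}}{q-q^{-1}}$; $x_{i,r+1}^\pm x_{j,r'}^\pm-q^{\pm C_{ij}}x_{j,r'}^\pm x_{i,r+1}^\pm=q^{\pm C_{ij}}x_{i,r}^\pm x_{j,r'+1}^\pm-x_{j,r'+1}^\pm x_{i,r}^\pm$; for $j$ with $C_{i,j}=-1$ the expression $x_{i,r_1}^\pm x_{i,r_2}^\pm x_{j,r'}^\pm-(q+q^{-1})x_{i,r_1}^\pm x_{j,r'}^\pm x_{i,r_2}^\pm+x_{j,r'}^\pm x_{i,r_1}^\pm x_{i,r_2}^\pm$ plus the same expression with $r_1,r_2$ exchanged is $0$; $[x_{i,r_1}^\pm,x_{j,r_2}^\pm]=0$ if $C_{i,j}=0$. Here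 $\phi_i^\pm(z)=\sum_{m\ge0}\phi^\pm_{i,\pm m}z^{\pm m}=k_{h_i}^{\pm1}\exp\big(\pm(q-q^{-1})\sum_{m'\ge1}h_{i,\pm m'}z^{\pm m'}\big)$, $\phi^+_{i,m}=0$ for $m<0$, $\phi^-_{i,m}=0$ for $m>0$. $\mathcal U_q(\widehat{sl}_{n+1})'$ (Drinfeld realization) is the algebra with the same generators and relations with $I,\mathfrak h$ replaced by $I_0,\mathfrak h_0$. (The $\phi^\pm_{i,\pm s}$, $s>0$, and $k_h$ determine the $h_{i,m}$.) Modules. $V_0(Y_{\ell,k})$ is the fundamental $\mathcal U_q(\widehat{sl}_{n+1})'$-module: the simple finite-dimensional $\ell$-highest weight module with Drinfeld polynomials $P_\ell(u)=1-uq^k$, $P_i=1$ for $i\ne\ell$ (i.e. $\phi_i^\pm(z)$ acts on the highest weight vector by $q^{\deg P_i}P_i(zq^{-1})/P_i(zq)$). For $\ell\in\{1,r+1,n\}$, $V(e^{\varpi_\ell}Y_{\ell,0}Y_{0,d_\ell}^{-1})$ is the $\mathcal U_q(sl_{n+1}^{tor})$-module with basis $(v_m)$ indexed by the monomials $m$ of $\mathcal M(e^{\varpi_\ell}Y_{\ell,0}Y_{0,d_\ell}^{-1})$ determined by: $k_hv_m=q^{\mathrm{wt}(m)(h)}v_m$; $\phi_i^\pm(z)$ acts on $v_m$ by the expansion in $z^{\pm1}$ of $\prod_l\big(q\frac{1-zq^{l-1}}{1-zq^{l+1}}\big)^{u_{i,l}(m)}$; $x_{i,0}^+v_m=v_{\tilde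 e_i\cdot m}$, $x_{i,0}^-v_m=v_{\tilde f_i\cdot m}$. (These data determine the action of all $x_{i,r}^\pm$ through the relation for $[h_{i,m},x_{i,0}^\pm]$; such a module exists for these $\ell$.) *)

theory Defs
  imports
    "HOL-Algebra.Module"
    "HOL-Algebra.QuotRing"
    "HOL-Library.Poly_Mapping"
    "HOL-Library.Product_Plus"
    "HOL-Computational_Algebra.Formal_Power_Series"
    "HOL-Computational_Algebra.Polynomial_FPS"
begin

section \<open>Root data\<close>

text \<open>
  The space \<open>\<hh>\<close> is the free rational vector space on the symbols \<open>h\<^sub>i\<close> (written \<open>Hc i\<close>) and
  \<open>d\<close> (written \<open>Dc\<close>). A linear form on it is stored by its coordinates in the dual basis
  \<open>\<Lambda>\<^sub>i\<close>, \<open>\<delta>\<close> (where \<open>\<delta> d = 1\<close>, \<open>\<delta> h\<^sub>i = 0\<close>), labelled by the same symbols, that is, by its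
  values on the basis of \<open>\<hh>\<close>.
\<close>

datatype hbasis = Hc nat | Dc

type_synonym cartan_elt = "hbasis \<Rightarrow>\<^sub>0 rat"
type_synonym weight = "hbasis \<Rightarrow>\<^sub>0 rat"

definition pairing :: "weight \<Rightarrow> cartan_elt \<Rightarrow> rat" where
  "pairing \<omega> h = (\<Sum>b\<in>Poly_Mapping.keys h. Poly_Mapping.lookup \<omega> b * Poly_Mapping.lookup h b)"

definition hvec :: "nat \<Rightarrow> cartan_elt" where
  "hvec i = Poly_Mapping.single (Hc i) 1"

definition fund_weight :: "nat \<Rightarrow> weight" where
  "fund_weight i = Poly_Mapping.single (Hc i) 1"

record cartan_datum =
  idx :: "nat set"
  cmat :: "nat \<Rightarrow> nat \<Rightarrow> int"
  cart :: "cartan_elt set"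

definition fin_datum :: "nat \<Rightarrow> cartan_datum" where
  "fin_datum n = \<lparr> idx = {1..n},
     cmat = (\<lambda>i j. if i = j then 2 else if i = Suc j \<or> j = Suc i then -1 else 0),
     cart = {h. Poly_Mapping.keys h \<subseteq> Hc ` {1..n}} \<rparr>"

text \<open>The nodes \<open>0, \<dots>, n\<close> are taken modulo \<open>n + 1\<close>; the matrix is of type \<open>A\<^sub>n\<^sup>(\<^sup>1\<^sup>)\<close> for \<open>n \<ge> 2\<close>.\<close>

definition aff_datum :: "nat \<Rightarrow> cartan_datum" where
  "aff_datum n = \<lparr> idx = {0..n},
     cmat = (\<lambda>i j. if i = j then 2
                   else if i = Suc j mod Suc n \<or> j = Suc i mod Suc n then -1 else 0),
     cart = {h. Poly_Mapping.keys h \<subseteq> insert Dc (Hc ` {0..n})} \<rparr>"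

text \<open>For \<open>fin_datum n\<close> the node \<open>0\<close> is absent, so the \<open>Dc\<close> component vanishes.\<close>

definition simple_root :: "cartan_datum \<Rightarrow> nat \<Rightarrow> weight" where
  "simple_root R i =
     (\<Sum>j\<in>idx R. Poly_Mapping.single (Hc j) (of_int (cmat R j i)))
     + Poly_Mapping.single Dc (if i = 0 then 1 else 0)"

section \<open>Monomial crystals\<close>

text \<open>
  A Laurent monomial \<open>\<Prod> Y\<^bsub>i,l\<^esub>\<^bsup>u\<^sub>i\<^sub>,\<^sub>l\<^esup>\<close> is its finitely supported exponent function, so the
  product of monomials is written additively. An affine monomial \<open>e\<^sup>\<omega> \<Prod> Y\<^bsub>i,l\<^esub>\<^bsup>u\<^sub>i\<^sub>,\<^sub>l\<^esup>\<close> is the pair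
  \<open>(\<omega>, u)\<close>, with componentwise addition.
\<close>

type_synonym ymon = "(nat \<times> int) \<Rightarrow>\<^sub>0 int"
type_synonym affmon = "weight \<times> ymon"

abbreviation expon :: "ymon \<Rightarrow> nat \<Rightarrow> int \<Rightarrow> int" where
  "expon m i l \<equiv> Poly_Mapping.lookup m (i, l)"

definition Yv :: "nat \<Rightarrow> int \<Rightarrow> ymon" where
  "Yv i l = Poly_Mapping.single (i, l) 1"

definition total_expon :: "ymon \<Rightarrow> nat \<Rightarrow> int" where
  "total_expon m i = (\<Sum>l\<in>{l. expon m i l \<noteq> 0}. expon m i l)"

definition vphi_upto :: "nat \<Rightarrow> int \<Rightarrow> ymon \<Rightarrow> int" where
  "vphi_upto i L m = (\<Sum>l\<in>{l. l \<le> L \<and> expon m i l \<noteq> 0}. expon m i l)"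

definition veps_from :: "nat \<Rightarrow> int \<Rightarrow> ymon \<Rightarrow> int" where
  "veps_from i L m = - (\<Sum>l\<in>{l. L \<le> l \<and> expon m i l \<noteq> 0}. expon m i l)"

definition vphi :: "nat \<Rightarrow> ymon \<Rightarrow> int" where
  "vphi i m = Max (range (\<lambda>L. vphi_upto i L m))"

definition veps :: "nat \<Rightarrow> ymon \<Rightarrow> int" where
  "veps i m = Max (range (\<lambda>L. veps_from i L m))"

text \<open>Meaningful only if \<open>veps i m > 0\<close>, resp. \<open>vphi i m > 0\<close>.\<close>

definition p_pos :: "nat \<Rightarrow> ymon \<Rightarrow> int" where
  "p_pos i m = (GREATEST L. veps_from i L m = veps i m)"

definition q_pos :: "nat \<Rightarrow> ymon \<Rightarrow> int" where
  "q_pos i m = (LEAST L. vphi_upto i L m = vphi i m)"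

text \<open>The value \<open>None\<close> of the operators \<open>etil\<close>, \<open>ftil\<close> stands for the ghost element \<open>0\<close>.\<close>

record 'm mcrystal =
  els :: "'m set"
  ind :: "nat set"
  expo :: "'m \<Rightarrow> ymon"
  wt :: "'m \<Rightarrow> weight"
  etil :: "nat \<Rightarrow> 'm \<Rightarrow> 'm option"
  ftil :: "nat \<Rightarrow> 'm \<Rightarrow> 'm option"

definition parity_function :: "cartan_datum \<Rightarrow> (nat \<Rightarrow> int) \<Rightarrow> bool" where
  "parity_function R s \<longleftrightarrow>
     (\<forall>i\<in>idx R. s i \<in> {0, 1}) \<and>
     (\<forall>i\<in>idx R. \<forall>j\<in>idx R. cmat R i j = -1 \<longrightarrow> s i + s j = 1)"

definition ymons :: "nat set \<Rightarrow> (nat \<Rightarrow> int) \<Rightarrow> ymon set" where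
  "ymons J s =
     {m. (\<forall>i l. expon m i l \<noteq> 0 \<longrightarrow> i \<in> J) \<and>
         (\<forall>i\<in>J. \<forall>l. l mod 2 = (s i + 1) mod 2 \<longrightarrow> expon m i l = 0)}"

definition fin_A :: "nat \<Rightarrow> nat \<Rightarrow> int \<Rightarrow> ymon" where
  "fin_A n i l = Yv i (l - 1) + Yv i (l + 1)
     - (\<Sum>j\<in>{j\<in>{1..n}. cmat (fin_datum n) i j = -1}. Yv j l)"

definition fin_crystal :: "nat \<Rightarrow> (nat \<Rightarrow> int) \<Rightarrow> ymon mcrystal" where
  "fin_crystal n s = \<lparr>
     els = ymons {1..n} s,
     ind = {1..n},
     expo = (\<lambda>m. m),
     wt = (\<lambda>m. \<Sum>i\<in>{1..n}. Poly_Mapping.single (Hc i) (of_int (total_expon m i))),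
     etil = (\<lambda>i m. if veps i m = 0 then None else Some (m + fin_A n i (p_pos i m - 1))),
     ftil = (\<lambda>i m. if vphi i m = 0 then None else Some (m - fin_A n i (q_pos i m + 1))) \<rparr>"

definition weight_lattice :: "nat \<Rightarrow> weight set" where
  "weight_lattice n = {\<omega>. Poly_Mapping.keys \<omega> \<subseteq> insert Dc (Hc ` {0..n}) \<and>
                          (\<forall>i\<in>{0..n}. pairing \<omega> (hvec i) \<in> \<int>)}"

definition aff_A :: "nat \<Rightarrow> nat \<Rightarrow> int \<Rightarrow> affmon" where
  "aff_A n i l = (simple_root (aff_datum n) i,
     Yv i (l - 1) + Yv i (l + 1) - Yv ((i + n) mod Suc n) l - Yv ((i + 1) mod Suc n) l)"

definition aff_crystal :: "nat \<Rightarrow> (nat \<Rightarrow> int) \<Rightarrow> affmon mcrystal" where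
  "aff_crystal n s = \<lparr>
     els = {(\<omega>, m). \<omega> \<in> weight_lattice n \<and> m \<in> ymons {0..n} s \<and>
                    (\<forall>i\<in>{0..n}. of_int (total_expon m i) = pairing \<omega> (hvec i))},
     ind = {0..n},
     expo = snd,
     wt = fst,
     etil = (\<lambda>i m. if veps i (snd m) = 0 then None
                   else Some (m + aff_A n i (p_pos i (snd m) - 1))),
     ftil = (\<lambda>i m. if vphi i (snd m) = 0 then None
                   else Some (m - aff_A n i (q_pos i (snd m) + 1))) \<rparr>"

text \<open>Smallest subset of the crystal containing \<open>m\<close> and stable under all operators.\<close>

definition subcrystal :: "'m mcrystal \<Rightarrow> 'm \<Rightarrow> 'm set" where
  "subcrystal X m = \<Inter> {S. S \<subseteq> els X \<and> m \<in> S \<and>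
     (\<forall>x\<in>S. \<forall>i\<in>ind X. \<forall>y. etil X i x = Some y \<or> ftil X i x = Some y \<longrightarrow> y \<in> S)}"

section \<open>Algebras given by generators and relations\<close>

datatype sgn = Pos | Neg

fun sg :: "sgn \<Rightarrow> int" where
  "sg Pos = 1" | "sg Neg = -1"

datatype qgen = X sgn nat int | K cartan_elt | H nat int

text \<open>Words form a monoid under concatenation, written additively as required by \<open>poly_mapping\<close>.\<close>

datatype 'g gword = GWord (letters: "'g list")

instantiation gword :: (type) monoid_add
begin
definition zero_gword :: "'a gword" where "0 = GWord []"
definition plus_gword :: "'a gword \<Rightarrow> 'a gword \<Rightarrow> 'a gword" where
  "v + w = GWord (letters v @ letters w)"
instance by standard (auto simp: zero_gword_def plus_gword_def)
end

text \<open>Free complex algebra on all symbols; the carrier below restricts to the generators in use.\<close>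

type_synonym freealg = "qgen gword \<Rightarrow>\<^sub>0 complex"

definition gens :: "cartan_datum \<Rightarrow> qgen set" where
  "gens R = {X e i r | e i r. i \<in> idx R} \<union> {K h | h. h \<in> cart R}
            \<union> {H i m | i m. i \<in> idx R \<and> m \<noteq> 0}"

definition free_algebra :: "cartan_datum \<Rightarrow> freealg ring" where
  "free_algebra R = \<lparr> carrier = {a. \<forall>w\<in>Poly_Mapping.keys a. set (letters w) \<subseteq> gens R},
     monoid.mult = (*), one = 1, zero = 0, add = (+) \<rparr>"

definition gn :: "qgen \<Rightarrow> freealg" where
  "gn g = Poly_Mapping.single (GWord [g]) 1"

definition cst :: "complex \<Rightarrow> freealg" where
  "cst c = Poly_Mapping.single 0 c"

text \<open>\<open>q = e\<^sup>t\<close> and \<open>q\<^sup>x = e\<^bsup>tx\<^esup>\<close> for rational \<open>x\<close>.\<close>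

definition qpow :: "complex \<Rightarrow> rat \<Rightarrow> complex" where
  "qpow t x = exp (t * of_rat x)"

abbreviation qpi :: "complex \<Rightarrow> int \<Rightarrow> complex" where
  "qpi t l \<equiv> qpow t (of_int l)"

definition qdiff :: "complex \<Rightarrow> complex" where
  "qdiff t = qpi t 1 - qpi t (-1)"

definition qint :: "complex \<Rightarrow> int \<Rightarrow> complex" where
  "qint t l = (qpi t l - qpi t (-l)) / qdiff t"

text \<open>Exponential of a power series without constant term over a complex algebra.\<close>

definition fps_expn :: "freealg fps \<Rightarrow> freealg fps" where
  "fps_expn S = Abs_fps (\<lambda>m. \<Sum>j\<le>m. cst (1 / fact j) * fps_nth (S ^ j) m)"

text \<open>
  The series below are in the variable \<open>z\<close> for \<open>Pos\<close> and \<open>z\<^sup>-\<^sup>1\<close> for \<open>Neg\<close>; \<open>phi_elt t e i m\<close>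
  is the coefficient \<open>\<phi>\<^sup>\<plusminus>\<^bsub>i,m\<^esub>\<close> of \<open>z\<^sup>m\<close>.
\<close>

definition hseries :: "sgn \<Rightarrow> nat \<Rightarrow> freealg fps" where
  "hseries e i = Abs_fps (\<lambda>m. if m = 0 then 0 else gn (H i (sg e * int m)))"

definition phi_elt :: "complex \<Rightarrow> sgn \<Rightarrow> nat \<Rightarrow> int \<Rightarrow> freealg" where
  "phi_elt t e i m =
     (if sg e * m < 0 then 0
      else gn (K (Poly_Mapping.single (Hc i) (of_int (sg e)))) *
           fps_nth (fps_expn (fps_const (cst (of_int (sg e) * qdiff t)) * hseries e i))
             (nat (sg e * m)))"

definition serre :: "complex \<Rightarrow> sgn \<Rightarrow> nat \<Rightarrow> nat \<Rightarrow> int \<Rightarrow> int \<Rightarrow> int \<Rightarrow> freealg" where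
  "serre t e i j r1 r2 r' =
     gn (X e i r1) * gn (X e i r2) * gn (X e j r')
     - cst (qpi t 1 + qpi t (-1)) * gn (X e i r1) * gn (X e j r') * gn (X e i r2)
     + gn (X e j r') * gn (X e i r1) * gn (X e i r2)"

inductive_set relators :: "cartan_datum \<Rightarrow> complex \<Rightarrow> freealg set"
  for R :: cartan_datum and t :: complex where
  k_mult: "\<lbrakk>h \<in> cart R; h' \<in> cart R\<rbrakk> \<Longrightarrow>
     gn (K h) * gn (K h') - gn (K (h + h')) \<in> relators R t"
| k_zero: "gn (K 0) - 1 \<in> relators R t"
| k_h_comm: "\<lbrakk>h \<in> cart R; j \<in> idx R; m \<noteq> 0\<rbrakk> \<Longrightarrow>
     gn (K h) * gn (H j m) - gn (H j m) * gn (K h) \<in> relators R t"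
| h_comm: "\<lbrakk>i \<in> idx R; j \<in> idx R; m \<noteq> 0; m' \<noteq> 0\<rbrakk> \<Longrightarrow>
     gn (H i m) * gn (H j m') - gn (H j m') * gn (H i m) \<in> relators R t"
| k_x: "\<lbrakk>h \<in> cart R; j \<in> idx R\<rbrakk> \<Longrightarrow>
     gn (K h) * gn (X e j r) * gn (K (- h))
     - cst (qpow t (of_int (sg e) * pairing (simple_root R j) h)) * gn (X e j r) \<in> relators R t"
| h_x: "\<lbrakk>i \<in> idx R; j \<in> idx R; m \<noteq> 0\<rbrakk> \<Longrightarrow>
     gn (H i m) * gn (X e j r) - gn (X e j r) * gn (H i m)
     - cst (of_int (sg e) * (1 / of_int m) * qint t (m * cmat R i j)) * gn (X e j (m + r))
     \<in> relators R t"
| x_plus_minus: "\<lbrakk>i \<in> idx R; j \<in> idx R\<rbrakk> \<Longrightarrow>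
     gn (X Pos i r) * gn (X Neg j r') - gn (X Neg j r') * gn (X Pos i r)
     - (if i = j
        then cst (1 / qdiff t) * (phi_elt t Pos i (r + r') - phi_elt t Neg i (r + r'))
        else 0) \<in> relators R t"
| x_quadratic: "\<lbrakk>i \<in> idx R; j \<in> idx R\<rbrakk> \<Longrightarrow>
     (gn (X e i (r + 1)) * gn (X e j r')
      - cst (qpi t (sg e * cmat R i j)) * gn (X e j r') * gn (X e i (r + 1)))
     - (cst (qpi t (sg e * cmat R i j)) * gn (X e i r) * gn (X e j (r' + 1))
        - gn (X e j (r' + 1)) * gn (X e i r)) \<in> relators R t"
| x_serre: "\<lbrakk>i \<in> idx R; j \<in> idx R; cmat R i j = -1\<rbrakk> \<Longrightarrow>
     serre t e i j r1 r2 r' + serre t e i j r2 r1 r' \<in> relators R t"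
| x_comm: "\<lbrakk>i \<in> idx R; j \<in> idx R; cmat R i j = 0\<rbrakk> \<Longrightarrow>
     gn (X e i r1) * gn (X e j r2) - gn (X e j r2) * gn (X e i r1) \<in> relators R t"

text \<open>
  \<open>quantum_alg (fin_datum n) t\<close> is the Drinfeld realization of the quantum affine algebra of
  \<open>sl\<^sub>n\<^sub>+\<^sub>1\<close> (without derivation), and \<open>quantum_alg (aff_datum n) t\<close> is the quantum toroidal
  algebra of \<open>sl\<^sub>n\<^sub>+\<^sub>1\<close>.
\<close>

definition rel_ideal :: "cartan_datum \<Rightarrow> complex \<Rightarrow> freealg set" where
  "rel_ideal R t = genideal (free_algebra R) (relators R t)"

definition quantum_alg :: "cartan_datum \<Rightarrow> complex \<Rightarrow> freealg set ring" where
  "quantum_alg R t = free_algebra R Quot rel_ideal R t"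

definition cls :: "cartan_datum \<Rightarrow> complex \<Rightarrow> freealg \<Rightarrow> freealg set" where
  "cls R t a = rel_ideal R t +>\<^bsub>free_algebra R\<^esub> a"

definition ux :: "cartan_datum \<Rightarrow> complex \<Rightarrow> sgn \<Rightarrow> nat \<Rightarrow> int \<Rightarrow> freealg set" where
  "ux R t e i r = cls R t (gn (X e i r))"

definition uk :: "cartan_datum \<Rightarrow> complex \<Rightarrow> cartan_elt \<Rightarrow> freealg set" where
  "uk R t h = cls R t (gn (K h))"

definition uphi :: "cartan_datum \<Rightarrow> complex \<Rightarrow> sgn \<Rightarrow> nat \<Rightarrow> int \<Rightarrow> freealg set" where
  "uphi R t e i m = cls R t (phi_elt t e i m)"

definition usc :: "cartan_datum \<Rightarrow> complex \<Rightarrow> complex \<Rightarrow> freealg set" where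
  "usc R t c = cls R t (cst c)"

section \<open>Modules\<close>

text \<open>
  The library's \<open>module\<close> requires a commutative ring; this is the same notion without
  commutativity. The complex vector space structure of a module over \<open>quantum_alg R t\<close> is
  given by the action of the scalars \<open>usc R t c\<close>.
\<close>

locale left_module = R?: ring R + M?: abelian_group M
  for R (structure) and M :: "('a, 'b, 'c) module_scheme" (structure) +
  assumes lm_closed:
      "\<lbrakk>a \<in> carrier R; x \<in> carrier M\<rbrakk> \<Longrightarrow> a \<odot>\<^bsub>M\<^esub> x \<in> carrier M"
    and lm_l_distr:
      "\<lbrakk>a \<in> carrier R; b \<in> carrier R; x \<in> carrier M\<rbrakk> \<Longrightarrow>
       (a \<oplus>\<^bsub>R\<^esub> b) \<odot>\<^bsub>M\<^esub> x = a \<odot>\<^bsub>M\<^esub> x \<oplus>\<^bsub>M\<^esub> b \<odot>\<^bsub>M\<^esub> x"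
    and lm_r_distr:
      "\<lbrakk>a \<in> carrier R; x \<in> carrier M; y \<in> carrier M\<rbrakk> \<Longrightarrow>
       a \<odot>\<^bsub>M\<^esub> (x \<oplus>\<^bsub>M\<^esub> y) = a \<odot>\<^bsub>M\<^esub> x \<oplus>\<^bsub>M\<^esub> a \<odot>\<^bsub>M\<^esub> y"
    and lm_assoc:
      "\<lbrakk>a \<in> carrier R; b \<in> carrier R; x \<in> carrier M\<rbrakk> \<Longrightarrow>
       (a \<otimes>\<^bsub>R\<^esub> b) \<odot>\<^bsub>M\<^esub> x = a \<odot>\<^bsub>M\<^esub> (b \<odot>\<^bsub>M\<^esub> x)"
    and lm_one:
      "x \<in> carrier M \<Longrightarrow> \<one>\<^bsub>R\<^esub> \<odot>\<^bsub>M\<^esub> x = x"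

definition module_iso ::
  "('a, 'r) ring_scheme \<Rightarrow> ('a, 'v, 'c) module_scheme \<Rightarrow> ('a, 'w, 'd) module_scheme \<Rightarrow> bool" where
  "module_iso R V W \<longleftrightarrow> (\<exists>f. bij_betw f (carrier V) (carrier W) \<and>
     (\<forall>x\<in>carrier V. \<forall>y\<in>carrier V. f (x \<oplus>\<^bsub>V\<^esub> y) = f x \<oplus>\<^bsub>W\<^esub> f y) \<and>
     (\<forall>a\<in>carrier R. \<forall>x\<in>carrier V. f (a \<odot>\<^bsub>V\<^esub> x) = a \<odot>\<^bsub>W\<^esub> f x))"

definition simple_module :: "('a, 'r) ring_scheme \<Rightarrow> ('a, 'w, 'd) module_scheme \<Rightarrow> bool" where
  "simple_module R W \<longleftrightarrow> carrier W \<noteq> {\<zero>\<^bsub>W\<^esub>} \<and>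
     (\<forall>N. submodule N R W \<longrightarrow> N = {\<zero>\<^bsub>W\<^esub>} \<or> N = carrier W)"

definition lin_comb ::
  "cartan_datum \<Rightarrow> complex \<Rightarrow> (freealg set, 'w) module \<Rightarrow> ('b \<Rightarrow> 'w) \<Rightarrow> ('b \<Rightarrow>\<^sub>0 complex) \<Rightarrow> 'w" where
  "lin_comb R t W b c =
     finsum W (\<lambda>x. usc R t (Poly_Mapping.lookup c x) \<odot>\<^bsub>W\<^esub> b x) (Poly_Mapping.keys c)"

definition fin_dimensional :: "cartan_datum \<Rightarrow> complex \<Rightarrow> (freealg set, 'w) module \<Rightarrow> bool" where
  "fin_dimensional R t W \<longleftrightarrow> (\<exists>B. finite B \<and> B \<subseteq> carrier W \<and>
     (\<forall>w\<in>carrier W. \<exists>c. Poly_Mapping.keys c \<subseteq> B \<and> w = lin_comb R t W (\<lambda>x. x) c))"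

definition is_basis ::
  "cartan_datum \<Rightarrow> complex \<Rightarrow> (freealg set, 'w) module \<Rightarrow> 'b set \<Rightarrow> ('b \<Rightarrow> 'w) \<Rightarrow> bool" where
  "is_basis R t W S b \<longleftrightarrow> b ` S \<subseteq> carrier W \<and>
     (\<forall>w\<in>carrier W. \<exists>!c. Poly_Mapping.keys c \<subseteq> S \<and> w = lin_comb R t W b c)"

text \<open>
  Expansion of the rational function \<open>N(z)/D(z)\<close>, for \<open>N\<close> and \<open>D\<close> of the same degree and with
  non-zero constant terms, as a power series in \<open>z\<close> (\<open>Pos\<close>) or in \<open>z\<^sup>-\<^sup>1\<close> (\<open>Neg\<close>). In the second
  case numerator and denominator are multiplied by \<open>z\<^bsup>-degree D\<^esup>\<close>.
\<close>

fun expansion :: "sgn \<Rightarrow> complex poly \<Rightarrow> complex poly \<Rightarrow> complex fps" where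
  "expansion Pos N D = fps_of_poly N / fps_of_poly D"
| "expansion Neg N D = fps_of_poly (reflect_poly N) / fps_of_poly (reflect_poly D)"

subsection \<open>Fundamental modules\<close>

definition drinfeld_series :: "complex \<Rightarrow> sgn \<Rightarrow> complex poly \<Rightarrow> complex fps" where
  "drinfeld_series t e P = fps_const (qpi t (int (degree P))) *
     expansion e (pcompose P [:0, qpi t (-1):]) (pcompose P [:0, qpi t 1:])"

definition lhw_vector ::
  "nat \<Rightarrow> complex \<Rightarrow> (nat \<Rightarrow> complex poly) \<Rightarrow> (freealg set, 'w) module \<Rightarrow> 'w \<Rightarrow> bool" where
  "lhw_vector n t P W v \<longleftrightarrow> (let R = fin_datum n in
     v \<in> carrier W \<and> v \<noteq> \<zero>\<^bsub>W\<^esub> \<and>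
     (\<forall>i\<in>idx R. \<forall>r. ux R t Pos i r \<odot>\<^bsub>W\<^esub> v = \<zero>\<^bsub>W\<^esub>) \<and>
     (\<forall>i\<in>idx R. \<forall>e. \<forall>m::nat. uphi R t e i (sg e * int m) \<odot>\<^bsub>W\<^esub> v
        = usc R t (fps_nth (drinfeld_series t e (P i)) m) \<odot>\<^bsub>W\<^esub> v) \<and>
     (\<forall>h\<in>cart R. uk R t h \<odot>\<^bsub>W\<^esub> v
        = usc R t (qpow t (pairing (\<Sum>i\<in>idx R. Poly_Mapping.single (Hc i) (of_nat (degree (P i)))) h))
          \<odot>\<^bsub>W\<^esub> v) \<and>
     (\<forall>N. submodule N (quantum_alg R t) W \<and> v \<in> N \<longrightarrow> N = carrier W))"

definition is_fundamental_module ::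
  "nat \<Rightarrow> complex \<Rightarrow> nat \<Rightarrow> int \<Rightarrow> (freealg set, 'w) module \<Rightarrow> bool" where
  "is_fundamental_module n t l k W \<longleftrightarrow>
     left_module (quantum_alg (fin_datum n) t) W \<and>
     simple_module (quantum_alg (fin_datum n) t) W \<and>
     fin_dimensional (fin_datum n) t W \<and>
     (\<exists>v. lhw_vector n t (\<lambda>i. if i = l then [:1, - qpi t k:] else 1) W v)"

subsection \<open>Extremal fundamental loop weight modules\<close>

text \<open>Eigenvalue of \<open>\<phi>\<^sub>i\<^sup>\<plusminus>(z)\<close> attached to a monomial.\<close>

definition lweight_series :: "complex \<Rightarrow> sgn \<Rightarrow> nat \<Rightarrow> ymon \<Rightarrow> complex fps" where
  "lweight_series t e i m = (\<Prod>l\<in>{l. expon m i l \<noteq> 0}.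
     (fps_const (qpi t 1) * expansion e [:1, - qpi t (l - 1):] [:1, - qpi t (l + 1):])
       powi expon m i l)"

definition is_loop_weight_module ::
  "nat \<Rightarrow> complex \<Rightarrow> affmon mcrystal \<Rightarrow> affmon set \<Rightarrow> (freealg set, 'w) module \<Rightarrow> bool" where
  "is_loop_weight_module n t C S W \<longleftrightarrow> (let R = aff_datum n in
     left_module (quantum_alg R t) W \<and>
     (\<exists>b. is_basis R t W S b \<and>
       (\<forall>m\<in>S.
         (\<forall>h\<in>cart R. uk R t h \<odot>\<^bsub>W\<^esub> b m = usc R t (qpow t (pairing (wt C m) h)) \<odot>\<^bsub>W\<^esub> b m) \<and>
         (\<forall>i\<in>idx R.
           (\<forall>e. \<forall>k::nat. uphi R t e i (sg e * int k) \<odot>\<^bsub>W\<^esub> b m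
              = usc R t (fps_nth (lweight_series t e i (expo C m)) k) \<odot>\<^bsub>W\<^esub> b m) \<and>
           ux R t Pos i 0 \<odot>\<^bsub>W\<^esub> b m
             = (case etil C i m of None \<Rightarrow> \<zero>\<^bsub>W\<^esub> | Some m' \<Rightarrow> b m') \<and>
           ux R t Neg i 0 \<odot>\<^bsub>W\<^esub> b m
             = (case ftil C i m of None \<Rightarrow> \<zero>\<^bsub>W\<^esub> | Some m' \<Rightarrow> b m')))))"

subsection \<open>The action by explicit formulas\<close>

text \<open>The complex vector space with basis \<open>(v\<^sub>m)\<close>, \<open>m \<in> S\<close>, and the convention \<open>v\<^sub>0 = 0\<close>.\<close>

definition crystal_space :: "'m set \<Rightarrow> ('m \<Rightarrow>\<^sub>0 complex) set" where
  "crystal_space S = {x. Poly_Mapping.keys x \<subseteq> S}"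

definition vscale :: "complex \<Rightarrow> ('m \<Rightarrow>\<^sub>0 complex) \<Rightarrow> ('m \<Rightarrow>\<^sub>0 complex)" where
  "vscale c x = Poly_Mapping.map ((*) c) x"

fun bvec :: "'m option \<Rightarrow> ('m \<Rightarrow>\<^sub>0 complex)" where
  "bvec None = 0"
| "bvec (Some m) = Poly_Mapping.single m 1"

text \<open>The fields \<open>mult\<close> and \<open>one\<close> of the library's module record play no role.\<close>

definition crystal_module ::
  "'m set \<Rightarrow> ('a \<Rightarrow> ('m \<Rightarrow>\<^sub>0 complex) \<Rightarrow> ('m \<Rightarrow>\<^sub>0 complex)) \<Rightarrow> ('a, 'm \<Rightarrow>\<^sub>0 complex) module" where
  "crystal_module S act = \<lparr> carrier = crystal_space S, monoid.mult = undefined, one = undefined,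
     zero = 0, add = (+), module.smult = act \<rparr>"

text \<open>
  \<open>act\<close> restricts on scalars to the given complex structure and is given on \<open>x\<^sup>\<plusminus>\<^bsub>i,r\<^esub>\<close>,
  \<open>\<phi>\<^sup>\<plusminus>\<^bsub>i,\<plusminus>s\<^esub>\<close> (\<open>s > 0\<close>) and \<open>k\<^sub>h\<close> by the explicit formulas. A term with undefined \<open>p_pos\<close> or
  \<open>q_pos\<close> has coefficient \<open>veps\<close> or \<open>vphi\<close> equal to \<open>0\<close>, or \<open>bvec None\<close> as a factor.
\<close>

definition acts_by_formulas ::
  "cartan_datum \<Rightarrow> complex \<Rightarrow> 'm mcrystal \<Rightarrow> 'm set
     \<Rightarrow> (freealg set \<Rightarrow> ('m \<Rightarrow>\<^sub>0 complex) \<Rightarrow> ('m \<Rightarrow>\<^sub>0 complex)) \<Rightarrow> bool" where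
  "acts_by_formulas R t C S act \<longleftrightarrow>
     (\<forall>c. \<forall>x\<in>crystal_space S. act (usc R t c) x = vscale c x) \<and>
     (\<forall>m\<in>S. \<forall>i\<in>idx R. \<forall>r::int.
        act (ux R t Pos i r) (bvec (Some m))
          = vscale (qpi t (r * (p_pos i (expo C m) - 1))) (bvec (etil C i m)) \<and>
        act (ux R t Neg i r) (bvec (Some m))
          = vscale (qpi t (r * (q_pos i (expo C m) + 1))) (bvec (ftil C i m))) \<and>
     (\<forall>m\<in>S. \<forall>i\<in>idx R. \<forall>e. \<forall>s::int. s > 0 \<longrightarrow>
        act (uphi R t e i (sg e * s)) (bvec (Some m))
          = vscale (of_int (sg e) * qdiff t *
              (of_int (vphi i (expo C m)) * qpi t (sg e * s * (q_pos i (expo C m) + 1))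
               - of_int (veps i (expo C m)) * qpi t (sg e * s * (p_pos i (expo C m) - 1))))
              (bvec (Some m))) \<and>
     (\<forall>m\<in>S. \<forall>h\<in>cart R.
        act (uk R t h) (bvec (Some m)) = vscale (qpow t (pairing (wt C m) h)) (bvec (Some m)))"

text \<open>\<open>e\<^bsup>\<varpi>\<^sub>l\<^esup> Y\<^bsub>l,0\<^esub> Y\<^bsub>0,d\<^sub>l\<^esub>\<^sup>-\<^sup>1\<close>\<close>

definition loop_monomial :: "nat \<Rightarrow> nat \<Rightarrow> affmon" where
  "loop_monomial n l =
     (fund_weight l - fund_weight 0, Yv l 0 - Yv 0 (int (min l (n + 1 - l))))"

end

theory Submission
  imports Defs
begin

text \<open>
  All monomials in the crystals concerned are thin: for each node \<open>i\<close> the part in the variables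
  \<open>Y\<^bsub>i,l\<^esub>\<close> is \<open>1\<close>, a single \<open>Y\<^bsub>i,l\<^esub>\<close> or a single \<open>Y\<^bsub>i,l\<^esub>\<^sup>-\<^sup>1\<close>. Hence \<open>veps\<close> and \<open>vphi\<close> take the values
  \<open>0\<close> and \<open>1\<close>, never both \<open>1\<close>, and no operator can be applied twice in a row at the same node.

  Thinness is what makes the defining relations hold. Each of them concerns at most two nodes. Nodes
  that are not adjacent do not interact. A move at one of two adjacent nodes either makes the other
  one, if it was unoccupied, ready for the same kind of move one level further, or cancels the
  variable present there (\<open>move_neighbour\<close>). So the commutators of \<open>x\<^sup>+\<^sub>i\<close> and \<open>x\<^sup>-\<^sub>j\<close> and all terms of
  the Serre relations vanish, and the quadratic relations compare powers of \<open>q\<close>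
  at two consecutive levels. The Cartan part is diagonal. The eigenvalue of
  \<open>h\<^bsub>i,m\<^esub>\<close> is read off from the logarithm of the rational function by which \<open>\<phi>\<^sup>\<plusminus>\<^sub>i(z)\<close> is to act, and
  being additive in the monomial it changes under \<open>A\<^bsub>j,l\<^esub>\<close> as the relation of \<open>h\<^bsub>i,m\<^esub>\<close> with
  \<open>x\<^sup>\<plusminus>\<^bsub>j,r\<^esub>\<close> requires (\<open>h_value_move\<close>). Conversely \<open>\<phi>\<^sup>\<plusminus>\<^sub>i(z)\<close> then acts by the exponential of this
  logarithm (\<open>cexpn_log_ratio\<close>), which for a thin monomial is a constant plus one geometric series.

  Thinness is proved by describing the monomials. In type \<open>A\<^sub>n\<close>, and for the middle node of the
  cyclic diagram, they record the local extrema of a height function on the nodes with steps \<open>\<plusminus>1\<close>,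
  and a move exchanges a local minimum and a local maximum (\<open>stable_thin_height_family\<close>). For the
  first and the last node of the cyclic diagram they record the position of a particle that moves
  around the cycle (\<open>stable_thin_particle_family\<close>).

  For the isomorphism with a fundamental module, the crystal module is simple: the \<open>h\<^bsub>i,1\<^esub>\<close> separate
  the basis vectors and every move can be undone (\<open>simple_V\<close>). Two simple modules generated by
  highest weight vectors with the same eigenvalues are isomorphic, since the annihilators of the two
  vectors agree (\<open>same_highest_weight.isomorphic\<close>). For the loop weight modules the bases are already
  indexed by the same monomials, and it suffices that \<open>x\<^sup>\<plusminus>\<^bsub>i,r\<^esub>\<close> is recovered from \<open>x\<^sup>\<plusminus>\<^bsub>i,0\<^esub>\<close> by
  commuting with \<open>h\<^bsub>i,r\<^esub>\<close> (\<open>same_loop_weights.isomorphic\<close>).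
\<close>

section \<open>Linear algebra on formal linear combinations\<close>

abbreviation "lookup \<equiv> Poly_Mapping.lookup"
abbreviation "keys \<equiv> Poly_Mapping.keys"
abbreviation "single \<equiv> Poly_Mapping.single"

lemma lookup_vscale [simp]: "lookup (vscale c x) m = c * lookup x m"
  unfolding vscale_def by (simp add: Poly_Mapping.map.rep_eq when_def)

lemma vscale_add_right: "vscale c (x + y) = vscale c x + vscale c y"
  and vscale_add_left: "vscale (c + d) x = vscale c x + vscale d x"
  and vscale_diff_left: "vscale (c - d) x = vscale c x - vscale d x"
  and vscale_minus_right: "vscale c (- x) = - vscale c x"
  and vscale_minus_left: "vscale (- c) x = - vscale c x"
  and vscale_vscale [simp]: "vscale c (vscale d x) = vscale (c * d) x"
  and vscale_zero [simp]: "vscale c 0 = 0"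
  and zero_vscale [simp]: "vscale 0 x = 0"
  and one_vscale [simp]: "vscale 1 x = x"
  by (rule poly_mapping_eqI; simp add: lookup_add lookup_minus algebra_simps)+

lemma vscale_sum: "vscale c (sum f A) = (\<Sum>a\<in>A. vscale c (f a))"
  by (induction A rule: infinite_finite_induct) (simp_all add: vscale_add_right)

lemma vscale_single [simp]: "vscale c (single m d) = single m (c * d)"
  by (rule poly_mapping_eqI) (simp add: lookup_single when_def)

lemma vscale_eq_cst_mult: "vscale c a = cst c * a"
  unfolding vscale_def cst_def by (rule mult_map_scale_conv_mult)

definition linear_map :: "(('a \<Rightarrow>\<^sub>0 complex) \<Rightarrow> ('b \<Rightarrow>\<^sub>0 complex)) \<Rightarrow> bool" where
  "linear_map T \<longleftrightarrow> (\<forall>x y. T (x + y) = T x + T y) \<and> (\<forall>c x. T (vscale c x) = vscale c (T x))"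

lemma linear_mapD:
  assumes "linear_map T"
  shows "T (x + y) = T x + T y" "T (vscale c x) = vscale c (T x)"
  using assms by (auto simp: linear_map_def)

lemma linear_map_zero: "linear_map T \<Longrightarrow> T 0 = 0"
  by (metis linear_mapD(2) zero_vscale)

lemma linear_map_sum: "linear_map T \<Longrightarrow> T (sum f A) = (\<Sum>a\<in>A. T (f a))"
  by (induction A rule: infinite_finite_induct) (simp_all add: linear_map_zero linear_mapD)

lemma linear_map_compose: "linear_map S \<Longrightarrow> linear_map T \<Longrightarrow> linear_map (\<lambda>x. S (T x))"
  by (simp add: linear_map_def)

lemma linear_map_id: "linear_map (\<lambda>x. x)"
  by (simp add: linear_map_def)

lemma sum_vscale_single:
  "x = (\<Sum>m\<in>keys x. vscale (lookup x m) (single m 1))"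
proof (rule poly_mapping_eqI)
  fix k
  show "lookup x k = lookup
    (\<Sum>m\<in>keys x. vscale (lookup x m) (single m 1)) k"
    by (cases "k \<in> keys x")
       (auto simp: lookup_sum lookup_single when_def if_distrib sum.delta not_in_keys_iff_lookup_eq_zero
             cong: if_cong)
qed

lemma formal_sum_induct [consumes 1, case_names zero add]:
  assumes "keys y \<subseteq> S" and "P 0"
    and "\<And>m c x. m \<in> S \<Longrightarrow> keys x \<subseteq> S \<Longrightarrow> P x \<Longrightarrow> P (single m c + x)"
  shows "P (y :: 'a \<Rightarrow>\<^sub>0 complex)"
proof -
  let ?y = "\<lambda>A. \<Sum>m\<in>A. single m (lookup y m)"
  have "keys (?y A) \<subseteq> S \<and> P (?y A)" if "finite A" "A \<subseteq> keys y" for A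
    using that
  proof (induction A)
    case (insert m A)
    then have "m \<in> S" using assms(1) by auto
    moreover have "keys (single m (lookup y m) + ?y A) \<subseteq> S"
      using keys_add[of "single m (lookup y m)" "?y A"] insert \<open>m \<in> S\<close>
      by (auto split: if_splits)
    ultimately show ?case using insert assms(3) by simp
  qed (simp add: assms(2))
  from this[OF finite_keys order_refl] show ?thesis
    using sum_vscale_single[of y] by simp
qed

lemma linear_maps_agree:
  assumes "linear_map S" "linear_map T"
    and "\<And>m. m \<in> keys x \<Longrightarrow> S (single m 1) = T (single m 1)"
  shows "S x = T x"
proof -
  have "S x = (\<Sum>m\<in>keys x. vscale (lookup x m) (S (single m 1)))"
    by (subst sum_vscale_single[of x]) (simp only: linear_map_sum[OF assms(1)] linear_mapD[OF assms(1)])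
  also have "\<dots> = (\<Sum>m\<in>keys x. vscale (lookup x m) (T (single m 1)))"
    by (simp add: assms(3))
  also have "\<dots> = T x"
    by (subst (3) sum_vscale_single[of x]) (simp only: linear_map_sum[OF assms(2)] linear_mapD[OF assms(2)])
  finally show ?thesis .
qed

definition lin_ext :: "('a \<Rightarrow> ('b \<Rightarrow>\<^sub>0 complex)) \<Rightarrow> ('a \<Rightarrow>\<^sub>0 complex) \<Rightarrow> ('b \<Rightarrow>\<^sub>0 complex)" where
  "lin_ext F x = (\<Sum>m\<in>keys x. vscale (lookup x m) (F m))"

lemma lin_ext_superset:
  assumes "finite A" "keys x \<subseteq> A"
  shows "lin_ext F x = (\<Sum>m\<in>A. vscale (lookup x m) (F m))"
  unfolding lin_ext_def using assms
  by (intro sum.mono_neutral_left) (auto simp: not_in_keys_iff_lookup_eq_zero)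

lemma lin_ext_single [simp]: "lin_ext F (single m c) = vscale c (F m)"
  by (subst lin_ext_superset[of "{m}"]) auto

lemma linear_lin_ext: "linear_map (lin_ext F)"
  unfolding linear_map_def
proof safe
  fix x y :: "'a \<Rightarrow>\<^sub>0 complex"
  let ?A = "keys x \<union> keys y"
  have "lin_ext F (x + y) = (\<Sum>m\<in>?A. vscale (lookup (x + y) m) (F m))"
    by (rule lin_ext_superset) (use keys_add[of x y] in auto)
  also have "\<dots> = lin_ext F x + lin_ext F y"
    by (simp add: lookup_add vscale_add_left sum.distrib lin_ext_superset[of ?A x] lin_ext_superset[of ?A y])
  finally show "lin_ext F (x + y) = lin_ext F x + lin_ext F y" .
next
  fix c and x :: "'a \<Rightarrow>\<^sub>0 complex"
  have "lin_ext F (vscale c x) = (\<Sum>m\<in>keys x. vscale (lookup (vscale c x) m) (F m))"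
    by (rule lin_ext_superset) (auto simp: in_keys_iff)
  then show "lin_ext F (vscale c x) = vscale c (lin_ext F x)"
    by (simp add: lin_ext_def vscale_sum)
qed

lemma linear_map_lin_ext_param:
  assumes "\<And>m. linear_map (\<lambda>x. F x m)"
  shows "linear_map (\<lambda>x. lin_ext (F x) a)"
  using assms unfolding linear_map_def lin_ext_def
  by (auto simp: vscale_add_right sum.distrib vscale_sum mult.commute)

section \<open>The free algebra and its representations\<close>

lemma cst_add: "cst (a + b) = cst a + cst b" and cst_diff: "cst (a - b) = cst a - cst b"
  and cst_0 [simp]: "cst 0 = 0" and cst_1 [simp]: "cst 1 = 1" and cst_minus: "cst (- a) = - cst a"
  and cst_mult: "cst (a * b) = cst a * cst b"
  by (simp_all add: cst_def single_add single_diff single_uminus mult_single)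

lemma cst_sum: "cst (sum f A) = (\<Sum>a\<in>A. cst (f a))"
  by (induction A rule: infinite_finite_induct) (simp_all add: cst_add)

lemma gword_mult: "single (GWord (g # w)) c = gn g * single (GWord w) c"
  by (simp add: gn_def mult_single plus_gword_def)

lemma linear_mult_right: "linear_map (\<lambda>b::freealg. a * b)"
  and linear_mult_left: "linear_map (\<lambda>a::freealg. a * b)"
proof -
  have *: "vscale c (x * y) = x * vscale c (y :: freealg)" for c x y
    using subset_UNIV[of "keys x"]
  proof (induction x rule: formal_sum_induct)
    case (add m d x)
    have "vscale c (single m d * y) = single m d * vscale c y"
      by (simp add: vscale_eq_cst_mult cst_def mult_single mult.assoc[symmetric] mult.commute)
    then show ?case
      by (simp only: distrib_right vscale_add_right add(3))
  qed simp
  show "linear_map (\<lambda>b::freealg. a * b)"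
    by (simp add: linear_map_def distrib_left *)
  show "linear_map (\<lambda>a::freealg. a * b)"
    by (simp add: linear_map_def distrib_right vscale_eq_cst_mult mult.assoc)
qed

text \<open>The scalars are central, because multiplication in the free algebra is bilinear.\<close>

lemma cst_commute: "a * cst c = cst c * a"
  using linear_mapD(2)[OF linear_mult_right, of a c 1] by (simp add: vscale_eq_cst_mult)

lemma cst_left_commute: "a * (cst c * b) = cst c * (a * b)"
  by (metis cst_commute mult.assoc)

abbreviation falg :: "cartan_datum \<Rightarrow> freealg set" where
  "falg R \<equiv> carrier (free_algebra R)"

lemma falg_iff: "a \<in> falg R \<longleftrightarrow> (\<forall>w\<in>keys a. set (letters w) \<subseteq> gens R)"
  by (simp add: free_algebra_def)

lemma falg_add: "a \<in> falg R \<Longrightarrow> b \<in> falg R \<Longrightarrow> a + b \<in> falg R"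
  using keys_add[of a b] by (auto simp: falg_iff)

lemma falg_mult: "a \<in> falg R \<Longrightarrow> b \<in> falg R \<Longrightarrow> a * b \<in> falg R"
  using keys_mult[of a b] by (fastforce simp: falg_iff plus_gword_def)

lemma falg_cst [simp]: "cst c \<in> falg R"
  by (cases "c = 0") (auto simp: falg_iff cst_def zero_gword_def)

lemma falg_0 [simp]: "0 \<in> falg R" and falg_1 [simp]: "1 \<in> falg R"
  using falg_cst[of 0] falg_cst[of 1] by simp_all

lemma falg_uminus: "a \<in> falg R \<Longrightarrow> - a \<in> falg R"
  by (auto simp: falg_iff in_keys_iff)

lemma falg_diff: "a \<in> falg R \<Longrightarrow> b \<in> falg R \<Longrightarrow> a - b \<in> falg R"
  using falg_add[OF _ falg_uminus, of a R b] by simp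

lemma falg_sum: "(\<And>x. x \<in> A \<Longrightarrow> f x \<in> falg R) \<Longrightarrow> sum f A \<in> falg R"
  by (induction A rule: infinite_finite_induct) (simp_all add: falg_add)

lemma falg_gn_iff: "gn g \<in> falg R \<longleftrightarrow> g \<in> gens R"
  by (simp add: falg_iff gn_def)

lemma falg_gn [intro]:
  "i \<in> idx R \<Longrightarrow> gn (X e i r) \<in> falg R"
  "h \<in> cart R \<Longrightarrow> gn (K h) \<in> falg R"
  "i \<in> idx R \<Longrightarrow> m \<noteq> 0 \<Longrightarrow> gn (H i m) \<in> falg R"
  by (auto simp: falg_gn_iff gens_def)

lemmas falg_intros = falg_add falg_mult falg_diff falg_uminus falg_sum falg_gn falg_cst falg_0 falg_1

text \<open>
  Membership in a subset that contains the scalars, is closed under addition and under left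
  multiplication by generators: the form in which statements about all elements of the algebra are
  reduced to generators.
\<close>

lemma falg_induct [consumes 1, case_names cst add gen]:
  assumes "a \<in> falg R"
    and cst: "\<And>c. P (cst c)"
    and add: "\<And>a b. a \<in> falg R \<Longrightarrow> b \<in> falg R \<Longrightarrow> P a \<Longrightarrow> P b \<Longrightarrow> P (a + b)"
    and gen: "\<And>g a. g \<in> gens R \<Longrightarrow> a \<in> falg R \<Longrightarrow> P a \<Longrightarrow> P (gn g * a)"
  shows "P a"
proof -
  have word: "P (single (GWord w) c) \<and> single (GWord w) c \<in> falg R"
    if "set w \<subseteq> gens R" for w c
    using that
  proof (induction w)
    case Nil
    show ?case using cst[of c] falg_cst[of c R] by (simp add: cst_def zero_gword_def)
  next
    case (Cons g w)
    then show ?case by (auto simp: gword_mult falg_gn_iff intro: gen falg_mult)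
  qed
  have "keys a \<subseteq> {w. set (letters w) \<subseteq> gens R}"
    using assms(1) by (auto simp: falg_iff)
  then have "P a \<and> a \<in> falg R"
  proof (induction a rule: formal_sum_induct)
    case zero
    show ?case using cst[of 0] by simp
  next
    case (add m c x)
    then show ?case using word[of "letters m" c] assms(3) by (auto intro: falg_add)
  qed
  then show ?thesis ..
qed

lemma free_algebra_simps:
  "monoid.mult (free_algebra R) = (*)" "one (free_algebra R) = 1"
  "zero (free_algebra R) = 0" "add (free_algebra R) = (+)"
  by (simp_all add: free_algebra_def)

lemma ring_free_algebra: "ring (free_algebra R)"
proof (rule ringI)
  show "abelian_group (free_algebra R)"
  proof (rule abelian_groupI)
    fix x assume "x \<in> falg R"
    then show "\<exists>y\<in>falg R. y \<oplus>\<^bsub>free_algebra R\<^esub> x = \<zero>\<^bsub>free_algebra R\<^esub>"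
      by (intro bexI[of _ "- x"]) (simp_all add: free_algebra_simps falg_uminus)
  qed (simp_all only: free_algebra_simps falg_add falg_0 add_ac add_0_left add_0_right)
  show "Group.monoid (free_algebra R)"
    by (rule monoidI) (simp_all only: free_algebra_simps falg_mult falg_1 mult.assoc mult_1_left mult_1_right)
qed (simp_all only: free_algebra_simps distrib_left distrib_right)

text \<open>
  Here \<open>F g\<close> prescribes the generator \<open>g\<close> on the basis. The free algebra imposes no condition on \<open>F\<close>, so
  every such choice is a representation; the relators are considered separately.
\<close>

definition word_act :: "(qgen \<Rightarrow> 'm \<Rightarrow> ('m \<Rightarrow>\<^sub>0 complex)) \<Rightarrow> qgen gword \<Rightarrow> ('m \<Rightarrow>\<^sub>0 complex) \<Rightarrow> ('m \<Rightarrow>\<^sub>0 complex)" where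
  "word_act F w x = foldr (\<lambda>g. lin_ext (F g)) (letters w) x"

definition alg_act :: "(qgen \<Rightarrow> 'm \<Rightarrow> ('m \<Rightarrow>\<^sub>0 complex)) \<Rightarrow> freealg \<Rightarrow> ('m \<Rightarrow>\<^sub>0 complex) \<Rightarrow> ('m \<Rightarrow>\<^sub>0 complex)" where
  "alg_act F a x = lin_ext (\<lambda>w. word_act F w x) a"

lemma linear_word_act: "linear_map (word_act F w)"
proof -
  have "linear_map (\<lambda>x. foldr (\<lambda>g. lin_ext (F g)) gs x)" for gs
    by (induction gs) (simp_all add: linear_map_id linear_map_compose[OF linear_lin_ext])
  then show ?thesis by (simp add: word_act_def[abs_def])
qed

lemma linear_alg_act: "linear_map (alg_act F a)"
  unfolding alg_act_def by (rule linear_map_lin_ext_param) (rule linear_word_act)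

lemma linear_alg_act_alg: "linear_map (\<lambda>a. alg_act F a x)"
  unfolding alg_act_def by (rule linear_lin_ext)

lemma alg_act_mult: "alg_act F (a * b) x = alg_act F a (alg_act F b x)"
proof (rule linear_maps_agree[where x = a])
  show "linear_map (\<lambda>a. alg_act F (a * b) x)"
    by (rule linear_map_compose[OF linear_alg_act_alg linear_mult_left])
  show "linear_map (\<lambda>a. alg_act F a (alg_act F b x))"
    by (rule linear_alg_act_alg)
next
  fix v
  let ?v = "single v 1 :: freealg"
  show "alg_act F (?v * b) x = alg_act F ?v (alg_act F b x)"
  proof (rule linear_maps_agree[where x = b])
    show "linear_map (\<lambda>b. alg_act F (?v * b) x)"
      by (rule linear_map_compose[OF linear_alg_act_alg linear_mult_right])
    show "linear_map (\<lambda>b. alg_act F ?v (alg_act F b x))"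
      by (rule linear_map_compose[OF linear_alg_act linear_alg_act_alg])
  qed (simp add: mult_single alg_act_def word_act_def plus_gword_def)
qed

lemma alg_act_gn: "alg_act F (gn g) x = lin_ext (F g) x"
  by (simp add: alg_act_def gn_def word_act_def)

lemma alg_act_cst: "alg_act F (cst c) x = vscale c x"
  by (simp add: alg_act_def cst_def word_act_def zero_gword_def)

lemma alg_act_add: "alg_act F (a + b) x = alg_act F a x + alg_act F b x"
  and alg_act_zero [simp]: "alg_act F 0 x = 0"
  and alg_act_one [simp]: "alg_act F 1 x = x"
  using linear_mapD(1)[OF linear_alg_act_alg] linear_map_zero[OF linear_alg_act_alg[of F x]]
    alg_act_cst[of F 1 x] by auto

lemma alg_act_diff: "alg_act F (a - b) x = alg_act F a x - alg_act F b x"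
  by (metis (no_types) alg_act_add add_diff_cancel_right' diff_add_cancel)

lemma alg_act_uminus: "alg_act F (- a) x = - alg_act F a x"
  using alg_act_diff[of F 0 a x] by simp

lemma alg_act_zero_right [simp]: "alg_act F a 0 = 0"
  by (rule linear_map_zero[OF linear_alg_act])

section \<open>Modules over an algebra presented by generators and relations\<close>

text \<open>
  The coefficients of \<open>\<phi>\<^sup>\<plusminus>\<^sub>i(z)\<close> are polynomials in \<open>k\<^bsub>\<plusminus>h\<^sub>i\<^esub>\<close> and the \<open>h\<^bsub>i,m\<^esub>\<close>, so a property that is
  inherited by sums and products only has to be checked on the latter.
\<close>

lemma fps_expn_nth_closed:
  assumes cst: "\<And>c. P (cst c)" and add: "\<And>a b. P a \<Longrightarrow> P b \<Longrightarrow> P (a + b)"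
    and mult: "\<And>a b. P a \<Longrightarrow> P b \<Longrightarrow> P (a * b)" and S: "\<And>m. P (fps_nth S m)"
  shows "P (fps_nth (fps_expn S) m)"
proof -
  have sum: "P (sum f A)" if "\<And>x. x \<in> A \<Longrightarrow> P (f x)" for f :: "nat \<Rightarrow> freealg" and A
    using that cst[of 0] by (induction A rule: infinite_finite_induct) (simp_all add: add)
  have "P (fps_nth (S ^ j) m)" for j m
  proof (induction j arbitrary: m)
    case 0
    show ?case using cst[of 0] cst[of 1] by simp
  next
    case (Suc j)
    then show ?case by (auto simp: fps_mult_nth intro!: sum mult S)
  qed
  then show ?thesis by (auto simp: fps_expn_def intro!: sum mult cst)
qed

lemma phi_elt_closed:
  assumes cst: "\<And>c. P (cst c)" and add: "\<And>a b. P a \<Longrightarrow> P b \<Longrightarrow> P (a + b)"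
    and mult: "\<And>a b. P a \<Longrightarrow> P b \<Longrightarrow> P (a * b)"
    and K: "P (gn (K (single (Hc i) (of_int (sg e)))))"
    and H: "\<And>m. m \<noteq> 0 \<Longrightarrow> P (gn (H i m))"
  shows "P (phi_elt t e i m)"
proof -
  have "sg e * int m \<noteq> 0" if "m \<noteq> 0" for m using that by (cases e) auto
  then have "P (fps_nth (fps_const (cst c) * hseries e i) m)" for c m
    using cst[of 0] cst[of c] by (auto simp: hseries_def intro!: mult H)
  then show ?thesis
    using cst[of 0] by (auto simp: phi_elt_def intro!: mult K fps_expn_nth_closed[of P] cst add)
qed

locale simply_laced =
  fixes R :: cartan_datum
  assumes finite_idx: "finite (idx R)"
    and cart_zero: "0 \<in> cart R"
    and cart_add: "h \<in> cart R \<Longrightarrow> h' \<in> cart R \<Longrightarrow> h + h' \<in> cart R"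
    and cart_uminus: "h \<in> cart R \<Longrightarrow> - h \<in> cart R"
    and cart_coroot: "i \<in> idx R \<Longrightarrow> single (Hc i) c \<in> cart R"
    and cmat_diag: "i \<in> idx R \<Longrightarrow> cmat R i i = 2"
    and cmat_off_diag: "i \<in> idx R \<Longrightarrow> j \<in> idx R \<Longrightarrow> i \<noteq> j \<Longrightarrow> cmat R i j = 0 \<or> cmat R i j = -1"
    and cmat_sym: "i \<in> idx R \<Longrightarrow> j \<in> idx R \<Longrightarrow> cmat R i j = cmat R j i"
begin

lemma falg_fps_expn:
  assumes "\<And>m. fps_nth S m \<in> falg R"
  shows "fps_nth (fps_expn S) m \<in> falg R"
  by (rule fps_expn_nth_closed) (use assms in \<open>auto intro: falg_intros\<close>)

lemma falg_hseries:
  assumes "i \<in> idx R"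
  shows "fps_nth (fps_const (cst c) * hseries e i) m \<in> falg R"
  using assms by (cases e) (auto simp: hseries_def intro!: falg_mult falg_gn)

lemma falg_phi_elt: "i \<in> idx R \<Longrightarrow> phi_elt t e i m \<in> falg R"
  by (rule phi_elt_closed) (auto intro: falg_intros cart_coroot)

lemma falg_serre: "i \<in> idx R \<Longrightarrow> j \<in> idx R \<Longrightarrow> serre t e i j r1 r2 r' \<in> falg R"
  by (auto simp: serre_def intro!: falg_intros)

lemma relators_falg: "relators R t \<subseteq> falg R"
proof
  fix a assume "a \<in> relators R t"
  then show "a \<in> falg R"
    by cases (auto intro!: falg_intros falg_serre falg_phi_elt cart_add cart_uminus cart_zero
        simp: falg_phi_elt)
qed

lemma ideal_rel_ideal: "ideal (rel_ideal R t) (free_algebra R)"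
  unfolding rel_ideal_def by (rule ring.genideal_ideal[OF ring_free_algebra relators_falg])

lemma relators_rel_ideal: "a \<in> relators R t \<Longrightarrow> a \<in> rel_ideal R t"
  unfolding rel_ideal_def using ring.genideal_self[OF ring_free_algebra relators_falg] by auto

lemma ring_quantum_alg: "ring (quantum_alg R t)"
  unfolding quantum_alg_def by (rule ideal.quotient_is_ring[OF ideal_rel_ideal])

lemma cls_ring_hom: "cls R t \<in> ring_hom (free_algebra R) (quantum_alg R t)"
  unfolding cls_def[abs_def] quantum_alg_def by (rule ideal.rcos_ring_hom[OF ideal_rel_ideal])

lemma cls_closed: "a \<in> falg R \<Longrightarrow> cls R t a \<in> carrier (quantum_alg R t)"
  and cls_add: "a \<in> falg R \<Longrightarrow> b \<in> falg R \<Longrightarrow> cls R t (a + b) = cls R t a \<oplus>\<^bsub>quantum_alg R t\<^esub> cls R t b"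
  and cls_mult: "a \<in> falg R \<Longrightarrow> b \<in> falg R \<Longrightarrow> cls R t (a * b) = cls R t a \<otimes>\<^bsub>quantum_alg R t\<^esub> cls R t b"
  and cls_one: "cls R t 1 = \<one>\<^bsub>quantum_alg R t\<^esub>"
  using ring_hom_closed[OF cls_ring_hom] ring_hom_add[OF cls_ring_hom] ring_hom_mult[OF cls_ring_hom]
    ring_hom_one[OF cls_ring_hom] by (simp_all only: free_algebra_simps)

lemma quantum_alg_carrier: "carrier (quantum_alg R t) = cls R t ` falg R"
  by (auto simp: quantum_alg_def FactRing_def A_RCOSETS_def RCOSETS_def cls_def a_r_coset_def)

lemma cls_eqD:
  assumes "a \<in> falg R" "b \<in> falg R" "cls R t a = cls R t b"
  shows "a - b \<in> rel_ideal R t"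
proof -
  interpret ideal "rel_ideal R t" "free_algebra R" by (rule ideal_rel_ideal)
  have "a \<in> cls R t b"
    using a_rcos_self[OF assms(1)] assms(3) by (simp add: cls_def)
  then obtain h where "h \<in> rel_ideal R t" "a = h + b"
    by (auto simp: cls_def a_r_coset_def' free_algebra_simps)
  then show ?thesis by simp
qed

lemma cls_eq_zero: "a \<in> rel_ideal R t \<Longrightarrow> cls R t a = \<zero>\<^bsub>quantum_alg R t\<^esub>"
proof -
  interpret ideal "rel_ideal R t" "free_algebra R" by (rule ideal_rel_ideal)
  show "a \<in> rel_ideal R t \<Longrightarrow> cls R t a = \<zero>\<^bsub>quantum_alg R t\<^esub>"
    by (simp add: cls_def quantum_alg_def FactRing_def a_coset_join2 a_Hcarr
        abelian_subgroup.a_rcos_const abelian_subgroupI3 is_additive_subgroup is_abelian_group)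
qed

end

text \<open>
  Working with representatives in the free algebra avoids all coset calculations: a module over the
  presented algebra is a module over the free algebra on which the relators vanish.
\<close>

locale quantum_module = simply_laced R + left_module "quantum_alg R t" W
  for R t and W :: "(freealg set, 'w) module"
begin

definition opr :: "freealg \<Rightarrow> 'w \<Rightarrow> 'w" where
  "opr a x = cls R t a \<odot>\<^bsub>W\<^esub> x"

lemma opr_closed: "a \<in> falg R \<Longrightarrow> x \<in> carrier W \<Longrightarrow> opr a x \<in> carrier W"
  by (simp add: opr_def lm_closed cls_closed)

lemma opr_add:
  "a \<in> falg R \<Longrightarrow> b \<in> falg R \<Longrightarrow> x \<in> carrier W \<Longrightarrow> opr (a + b) x = opr a x \<oplus>\<^bsub>W\<^esub> opr b x"
  by (simp add: opr_def cls_add lm_l_distr cls_closed)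

lemma opr_mult:
  "a \<in> falg R \<Longrightarrow> b \<in> falg R \<Longrightarrow> x \<in> carrier W \<Longrightarrow> opr (a * b) x = opr a (opr b x)"
  by (simp add: opr_def cls_mult lm_assoc cls_closed)

lemma opr_one: "x \<in> carrier W \<Longrightarrow> opr 1 x = x"
  by (simp add: opr_def cls_one lm_one)

lemma opr_add_right:
  "a \<in> falg R \<Longrightarrow> x \<in> carrier W \<Longrightarrow> y \<in> carrier W \<Longrightarrow> opr a (x \<oplus>\<^bsub>W\<^esub> y) = opr a x \<oplus>\<^bsub>W\<^esub> opr a y"
  by (simp add: opr_def lm_r_distr cls_closed)

lemma opr_zero_right:
  assumes "a \<in> falg R" shows "opr a \<zero>\<^bsub>W\<^esub> = \<zero>\<^bsub>W\<^esub>"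
  using opr_add_right[OF assms, of "\<zero>\<^bsub>W\<^esub>" "\<zero>\<^bsub>W\<^esub>"] opr_closed[OF assms M.zero_closed]
  by (metis M.add.l_cancel_one M.add.l_one M.zero_closed)

lemma opr_zero: assumes "x \<in> carrier W" shows "opr 0 x = \<zero>\<^bsub>W\<^esub>"
  using opr_add[OF falg_0 falg_0 assms] opr_closed[OF falg_0 assms]
  by (metis M.add.l_cancel_one add_0)

lemma opr_diff_eq_zero_iff:
  assumes "a \<in> falg R" "b \<in> falg R" "x \<in> carrier W"
  shows "opr (a - b) x = \<zero>\<^bsub>W\<^esub> \<longleftrightarrow> opr a x = opr b x"
proof -
  have "opr a x = opr (a - b) x \<oplus>\<^bsub>W\<^esub> opr b x"
    using opr_add[of "a - b" b x] assms by (simp add: falg_diff)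
  then show ?thesis
    using assms by (metis M.add.r_cancel_one falg_diff opr_closed M.l_zero M.add.r_cancel_one')
qed

lemma opr_relator: "a \<in> relators R t \<Longrightarrow> x \<in> carrier W \<Longrightarrow> opr a x = \<zero>\<^bsub>W\<^esub>"
proof -
  assume "a \<in> relators R t" "x \<in> carrier W"
  then have "opr a x = opr 0 x"
    using cls_eq_zero[OF relators_rel_ideal] cls_eq_zero[of 0]
      additive_subgroup.zero_closed[OF ideal.axioms(1)[OF ideal_rel_ideal], unfolded free_algebra_simps]
    by (simp add: opr_def)
  with opr_zero show ?thesis by (simp add: \<open>x \<in> carrier W\<close>)
qed

lemma opr_uminus:
  assumes "a \<in> falg R" "x \<in> carrier W" shows "opr (- a) x = \<ominus>\<^bsub>W\<^esub> opr a x"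
  using opr_add[of "- a" a x] assms opr_zero[of x]
  by (metis M.minus_equality ab_left_minus falg_uminus opr_closed)

lemma submodule_iff:
  "submodule N (quantum_alg R t) W \<longleftrightarrow>
     N \<subseteq> carrier W \<and> \<zero>\<^bsub>W\<^esub> \<in> N \<and> (\<forall>x\<in>N. \<forall>y\<in>N. x \<oplus>\<^bsub>W\<^esub> y \<in> N) \<and> (\<forall>a\<in>falg R. \<forall>x\<in>N. opr a x \<in> N)"
  (is "?L \<longleftrightarrow> ?P")
proof
  assume ?L
  then interpret submodule N "quantum_alg R t" W .
  show ?P using subset one_closed m_closed smult_closed cls_closed
    by (auto simp: opr_def)
next
  assume P: ?P
  show ?L
  proof (intro submodule.intro subgroup.intro submodule_axioms.intro)
    fix x assume x: "x \<in> N"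
    then have "inv\<^bsub>add_monoid W\<^esub> x = opr (- 1) x"
      using P opr_uminus[of 1 x] opr_one[of x] by (auto simp: a_inv_def)
    then show "inv\<^bsub>add_monoid W\<^esub> x \<in> N" using P x falg_uminus[OF falg_1, of R] by auto
  next
    fix a x assume "a \<in> carrier (quantum_alg R t)" "x \<in> N"
    then show "a \<odot>\<^bsub>W\<^esub> x \<in> N" using P by (auto simp: quantum_alg_carrier opr_def)
  qed (use P in auto)
qed

end

subsection \<open>Modules from operators on a basis\<close>

lemma crystal_space_add: "x \<in> crystal_space S \<Longrightarrow> y \<in> crystal_space S \<Longrightarrow> x + y \<in> crystal_space S"
  using keys_add[of x y] by (auto simp: crystal_space_def)

lemma crystal_space_vscale: "x \<in> crystal_space S \<Longrightarrow> vscale c x \<in> crystal_space S"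
  by (auto simp: crystal_space_def in_keys_iff)

lemma crystal_space_zero [simp]: "0 \<in> crystal_space S"
  by (simp add: crystal_space_def)

lemma crystal_space_uminus: "x \<in> crystal_space S \<Longrightarrow> - x \<in> crystal_space S"
  by (auto simp: crystal_space_def in_keys_iff)

lemma crystal_space_single: "m \<in> S \<Longrightarrow> single m c \<in> crystal_space S"
  by (simp add: crystal_space_def)

lemma crystal_space_sum: "(\<And>a. a \<in> A \<Longrightarrow> f a \<in> crystal_space S) \<Longrightarrow> sum f A \<in> crystal_space S"
  by (induction A rule: infinite_finite_induct) (simp_all add: crystal_space_add)

lemma crystal_module_simps [simp]:
  "carrier (crystal_module S act) = crystal_space S" "zero (crystal_module S act) = 0"
  "add (crystal_module S act) = (+)" "module.smult (crystal_module S act) = act"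
  by (simp_all add: crystal_module_def)

lemma abelian_group_crystal_module: "abelian_group (crystal_module S act)"
proof (rule abelian_groupI)
  fix x assume "x \<in> carrier (crystal_module S act)"
  then show "\<exists>y\<in>carrier (crystal_module S act). y \<oplus>\<^bsub>crystal_module S act\<^esub> x = \<zero>\<^bsub>crystal_module S act\<^esub>"
    by (intro bexI[of _ "- x"]) (simp_all add: crystal_space_uminus)
qed (simp_all add: crystal_space_add add_ac)

text \<open>A class acts through an arbitrary representative.\<close>

definition quotient_act ::
  "cartan_datum \<Rightarrow> complex \<Rightarrow> (qgen \<Rightarrow> 'm \<Rightarrow> ('m \<Rightarrow>\<^sub>0 complex)) \<Rightarrow> freealg set \<Rightarrow> ('m \<Rightarrow>\<^sub>0 complex) \<Rightarrow> ('m \<Rightarrow>\<^sub>0 complex)" where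
  "quotient_act R t F A x = alg_act F (SOME a. a \<in> falg R \<and> cls R t a = A) x"

locale presented_action = simply_laced R for R +
  fixes t :: complex and S :: "'m set" and F :: "qgen \<Rightarrow> 'm \<Rightarrow> ('m \<Rightarrow>\<^sub>0 complex)"
  assumes gen_closed: "g \<in> gens R \<Longrightarrow> m \<in> S \<Longrightarrow> F g m \<in> crystal_space S"
    and relator_zero: "a \<in> relators R t \<Longrightarrow> m \<in> S \<Longrightarrow> alg_act F a (single m 1) = 0"
begin

lemma alg_act_closed:
  assumes "a \<in> falg R" "x \<in> crystal_space S"
  shows "alg_act F a x \<in> crystal_space S"
  using assms(1)
proof (induction a rule: falg_induct)
  case (gen g a)
  have "lin_ext (F g) y \<in> crystal_space S" if "y \<in> crystal_space S" for y
    unfolding lin_ext_def using that gen_closed[OF gen(1)]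
    by (intro crystal_space_sum crystal_space_vscale) (auto simp: crystal_space_def)
  then show ?case using gen by (simp add: alg_act_mult alg_act_gn)
qed (simp_all add: alg_act_cst alg_act_add assms(2) crystal_space_vscale crystal_space_add)

text \<open>
  The elements that annihilate the whole space form a two-sided ideal, since the space is stable. It
  contains the relators, hence the ideal generated by them.
\<close>

lemma rel_ideal_zero:
  assumes "a \<in> rel_ideal R t" "x \<in> crystal_space S"
  shows "alg_act F a x = 0"
proof -
  let ?A = "{a \<in> falg R. \<forall>x\<in>crystal_space S. alg_act F a x = 0}"
  have "ideal ?A (free_algebra R)"
  proof (rule idealI[OF ring_free_algebra])
    show "subgroup ?A (add_monoid (free_algebra R))"
    proof (rule subgroup.intro)
      fix a assume a: "a \<in> ?A"
      interpret F: ring "free_algebra R" by (rule ring_free_algebra)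
      have "inv\<^bsub>add_monoid (free_algebra R)\<^esub> a = - a"
        using a F.minus_equality[of "- a" a]
        by (simp add: a_inv_def free_algebra_simps falg_uminus)
      then show "inv\<^bsub>add_monoid (free_algebra R)\<^esub> a \<in> ?A"
        using a alg_act_diff[of F 0 a] by (auto intro: falg_uminus)
    qed (auto simp: free_algebra_simps falg_add alg_act_add)
  qed (auto simp: free_algebra_simps falg_mult alg_act_mult alg_act_closed)
  moreover have "relators R t \<subseteq> ?A"
  proof (intro subsetI CollectI conjI ballI)
    fix a assume a: "a \<in> relators R t"
    then show "a \<in> falg R" using relators_falg by auto
    fix x :: "'m \<Rightarrow>\<^sub>0 complex" assume x: "x \<in> crystal_space S"
    have "alg_act F a x = (\<lambda>_. 0) x"
      by (rule linear_maps_agree[OF linear_alg_act])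
        (use relator_zero[OF a] x in \<open>auto simp: linear_map_def crystal_space_def\<close>)
    then show "alg_act F a x = 0" .
  qed
  ultimately have "rel_ideal R t \<subseteq> ?A"
    unfolding rel_ideal_def by (rule ring.genideal_minimal[OF ring_free_algebra])
  with assms show ?thesis by auto
qed

lemma quotient_act_cls:
  assumes "a \<in> falg R" "x \<in> crystal_space S"
  shows "quotient_act R t F (cls R t a) x = alg_act F a x"
proof -
  let ?b = "SOME b. b \<in> falg R \<and> cls R t b = cls R t a"
  have b: "?b \<in> falg R \<and> cls R t ?b = cls R t a"
    by (rule someI[of _ a]) (use assms in auto)
  then have "alg_act F (?b - a) x = 0"
    by (intro rel_ideal_zero cls_eqD assms) auto
  then show ?thesis by (simp add: quotient_act_def alg_act_diff)
qed

lemma left_module_quotient_act: "left_module (quantum_alg R t) (crystal_module S (quotient_act R t F))"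
proof (intro left_module.intro left_module_axioms.intro ring_quantum_alg abelian_group_crystal_module)
qed (auto simp: quantum_alg_carrier quotient_act_cls alg_act_closed crystal_space_add falg_mult falg_add
    cls_add[symmetric] cls_mult[symmetric] cls_one[symmetric] alg_act_add alg_act_mult
    linear_mapD[OF linear_alg_act])

sublocale quantum_module R t "crystal_module S (quotient_act R t F)"
  by (intro quantum_module.intro simply_laced_axioms left_module_quotient_act)

lemma opr_eq: "a \<in> falg R \<Longrightarrow> x \<in> crystal_space S \<Longrightarrow> opr a x = alg_act F a x"
  by (simp add: opr_def quotient_act_cls)

end

section \<open>Powers of a generic parameter\<close>

lemma qpow_add: "qpow t (a + b) = qpow t a * qpow t b"
  by (simp add: qpow_def of_rat_add distrib_left exp_add)

lemma qpow_0 [simp]: "qpow t 0 = 1" and qpow_nonzero [simp]: "qpow t a \<noteq> 0"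
  by (simp_all add: qpow_def)

lemma qpow_minus: "qpow t (- a) = inverse (qpow t a)"
  by (simp add: qpow_def of_rat_minus exp_minus)

lemma qpow_diff: "qpow t (a - b) = qpow t a / qpow t b"
  using qpow_add[of t a "- b"] by (simp add: qpow_minus divide_inverse)

lemma qpi_mult: "qpi t a * qpi t b = qpi t (a + b)"
  by (simp add: qpow_add)

lemma qpi_power: "qpi t a ^ n = qpi t (int n * a)"
  by (simp add: qpow_def of_rat_mult flip: exp_of_nat_mult) (simp add: mult_ac)

locale generic_parameter =
  fixes t :: complex
  assumes not_root_of_unity: "\<And>j::nat. j > 0 \<Longrightarrow> exp t ^ j \<noteq> 1"
begin

lemma qpi_nat_eq_1: "qpi t (int j) = 1 \<longleftrightarrow> j = 0"
  using not_root_of_unity[of j] qpi_power[of t 1 j] by (auto simp: qpow_def)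

lemma qpi_eq_1: "qpi t a = 1 \<longleftrightarrow> a = 0"
proof (cases "a \<ge> 0")
  case True
  then show ?thesis using qpi_nat_eq_1[of "nat a"] by auto
next
  case False
  then show ?thesis using qpi_nat_eq_1[of "nat (- a)"] qpow_minus[of t "of_int a"] by auto
qed

lemma qpi_inj: "qpi t a = qpi t b \<longleftrightarrow> a = b"
  using qpi_eq_1[of "a - b"] by (simp add: of_int_diff qpow_diff)

lemma qdiff_nonzero: "qdiff t \<noteq> 0"
  using qpi_inj[of 1 "-1"] by (simp add: qdiff_def)

lemma qint_eq_0_iff: "qint t m = 0 \<longleftrightarrow> m = 0"
  using qpi_inj[of m "- m"] qdiff_nonzero by (auto simp: qint_def)

end

section \<open>Eigenvalues of the Cartan series\<close>

text \<open>The image of \<open>fps_expn\<close> under evaluation of a series of commuting elements at an eigenvector.\<close>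

definition cexpn :: "complex fps \<Rightarrow> complex fps" where
  "cexpn D = fps_compose (fps_exp 1) D"

lemma cexpn_nth: "fps_nth (cexpn D) m = (\<Sum>j\<le>m. 1 / fact j * fps_nth (D ^ j) m)"
  by (simp add: cexpn_def fps_compose_nth atLeast0AtMost)

text \<open>The logarithm of \<open>\<phi>\<^sup>\<plusminus>\<^sub>i\<close>, up to its constant term, when \<open>h\<^bsub>i,\<plusminus>m\<^esub>\<close> has eigenvalue \<open>\<eta> m\<close>.\<close>

definition log_series :: "complex \<Rightarrow> sgn \<Rightarrow> (nat \<Rightarrow> complex) \<Rightarrow> complex fps" where
  "log_series t e \<eta> = Abs_fps (\<lambda>m. if m = 0 then 0 else of_int (sg e) * qdiff t * \<eta> m)"

text \<open>
  The typical left ideal is the annihilator of a vector in a representation. That \<open>a - cst c\<close> lies in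
  it says that this vector is an eigenvector of \<open>a\<close> with eigenvalue \<open>c\<close>.
\<close>

locale free_left_ideal = simply_laced R for R +
  fixes L :: "freealg set"
  assumes L_zero: "0 \<in> L"
    and L_add: "a \<in> L \<Longrightarrow> b \<in> L \<Longrightarrow> a + b \<in> L"
    and L_mult: "a \<in> falg R \<Longrightarrow> b \<in> L \<Longrightarrow> a * b \<in> L"
begin

definition cong_L :: "freealg \<Rightarrow> freealg \<Rightarrow> bool" (infix "\<approx>" 50) where
  "a \<approx> b \<longleftrightarrow> a - b \<in> L"

lemma L_uminus: "a \<in> L \<Longrightarrow> - a \<in> L"
  using L_mult[OF falg_uminus[OF falg_1], of a] by simp

lemma L_diff: "a \<in> L \<Longrightarrow> b \<in> L \<Longrightarrow> a - b \<in> L"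
  using L_add[OF _ L_uminus, of a b] by simp

lemma cong_refl [simp]: "a \<approx> a"
  by (simp add: cong_L_def L_zero)

lemma cong_sym: "a \<approx> b \<Longrightarrow> b \<approx> a"
  using L_uminus[of "a - b"] by (simp add: cong_L_def)

lemma cong_trans [trans]: "a \<approx> b \<Longrightarrow> b \<approx> c \<Longrightarrow> a \<approx> c"
  using L_add[of "a - b" "b - c"] by (simp add: cong_L_def)

lemma cong_add: "a \<approx> b \<Longrightarrow> c \<approx> d \<Longrightarrow> a + c \<approx> b + d"
  using L_add[of "a - b" "c - d"] by (simp add: cong_L_def algebra_simps)

lemma cong_diff: "a \<approx> b \<Longrightarrow> c \<approx> d \<Longrightarrow> a - c \<approx> b - d"
  using L_diff[of "a - b" "c - d"] by (simp add: cong_L_def algebra_simps)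

lemma cong_sum: "(\<And>x. x \<in> A \<Longrightarrow> f x \<approx> g x) \<Longrightarrow> sum f A \<approx> sum g A"
  by (induction A rule: infinite_finite_induct) (simp_all add: cong_add)

lemma cong_mult: "a \<in> falg R \<Longrightarrow> b \<approx> c \<Longrightarrow> a * b \<approx> a * c"
  using L_mult[of a "b - c"] by (simp add: cong_L_def right_diff_distrib)

lemma cong_cst_mult: "b \<approx> c \<Longrightarrow> cst d * b \<approx> cst d * c"
  by (rule cong_mult) simp

lemma cong_mult_eigenvalue:
  assumes "a \<in> falg R" "a \<approx> cst \<alpha>" "b \<approx> cst \<beta>"
  shows "a * b \<approx> cst (\<alpha> * \<beta>)"
proof -
  have "a * b \<approx> a * cst \<beta>" by (intro cong_mult assms)
  also have "a * cst \<beta> = cst \<beta> * a" by (rule cst_commute)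
  also have "\<dots> \<approx> cst \<beta> * cst \<alpha>" by (intro cong_cst_mult assms)
  finally show ?thesis by (simp add: cst_mult[symmetric] mult.commute)
qed

lemma power_eigenvalue_below:
  assumes S: "\<And>m. fps_nth S m \<in> falg R" and eig: "\<And>k. k < M \<Longrightarrow> fps_nth S k \<approx> cst (fps_nth D k)"
    and "m < M"
  shows "fps_nth (S ^ j) m \<approx> cst (fps_nth (D ^ j) m)"
  using \<open>m < M\<close>
proof (induction j arbitrary: m)
  case (Suc j)
  show ?case unfolding power_Suc fps_mult_nth cst_sum
    by (intro cong_sum cong_mult_eigenvalue S eig Suc.IH) (use Suc.prems in auto)
qed simp

text \<open>
  For \<open>j \<ge> 2\<close> the coefficient of degree \<open>M\<close> of the \<open>j\<close>-th power of a series without constant term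
  involves only coefficients of degree less than \<open>M\<close>.
\<close>

lemma power_eigenvalue_top:
  assumes S: "\<And>m. fps_nth S m \<in> falg R" and eig: "\<And>k. k < M \<Longrightarrow> fps_nth S k \<approx> cst (fps_nth D k)"
    and "fps_nth S 0 = 0" "fps_nth D 0 = 0" "j \<ge> 2"
  shows "fps_nth (S ^ j) M \<approx> cst (fps_nth (D ^ j) M)"
proof -
  obtain i where j: "j = Suc (Suc i)" using \<open>j \<ge> 2\<close> by (metis Suc_le_D numeral_2_eq_2 Suc_le_mono)
  have [simp]: "fps_nth (S ^ Suc i) 0 = 0" "fps_nth (D ^ Suc i) 0 = 0"
    using assms by simp_all
  have "fps_nth S k * fps_nth (S ^ Suc i) (M - k) \<approx> cst (fps_nth D k * fps_nth (D ^ Suc i) (M - k))"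
    if "k \<le> M" for k
  proof (cases "k = 0 \<or> k = M")
    case True
    then show ?thesis using assms(3,4) by (auto simp del: power_Suc)
  next
    case False
    then show ?thesis
      by (intro cong_mult_eigenvalue S eig power_eigenvalue_below[where M = M]) (use that in auto)
  qed
  then show ?thesis unfolding j power_Suc[of _ "Suc i"] fps_mult_nth cst_sum
    by (intro cong_sum) auto
qed

lemma expn_eigenvalue:
  assumes S: "\<And>m. fps_nth S m \<in> falg R" and "\<And>k. fps_nth S k \<approx> cst (fps_nth D k)"
  shows "fps_nth (fps_expn S) m \<approx> cst (fps_nth (cexpn D) m)"
proof -
  have "fps_nth (S ^ j) m \<approx> cst (fps_nth (D ^ j) m)" for j
    by (rule power_eigenvalue_below[OF S, of "Suc m"]) (use assms in auto)
  then show ?thesis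
    unfolding fps_expn_def cexpn_nth fps_nth_Abs_fps cst_sum cst_mult
    by (intro cong_sum cong_cst_mult)
qed

text \<open>
  The coefficient of degree \<open>M\<close> of the exponential is the coefficient of the series plus terms in
  lower coefficients, so the eigenvalues of the series can be recovered one degree after the other,
  although it is not known beforehand that the vector is an eigenvector.
\<close>

lemma eigenvalue_of_expn_eigenvalue:
  assumes S: "\<And>m. fps_nth S m \<in> falg R" and exp: "\<And>m. fps_nth (fps_expn S) m \<approx> cst (fps_nth (cexpn D) m)"
    and 0: "fps_nth S 0 = 0" "fps_nth D 0 = 0"
  shows "fps_nth S m \<approx> cst (fps_nth D m)"
proof (induction m rule: less_induct)
  case (less M)
  show ?case
  proof (cases "M = 0")
    case True
    then show ?thesis using 0 by simp
  next
    case False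
    let ?J = "{..M} - {1}"
    have split: "(\<Sum>j\<le>M. f j) = f 1 + sum f ?J" for f :: "nat \<Rightarrow> 'b::comm_monoid_add"
      using False by (subst sum.remove[of _ 1]) auto
    have "cst (1 / fact j) * fps_nth (S ^ j) M \<approx> cst (1 / fact j * fps_nth (D ^ j) M)"
      if "j \<in> ?J" for j
    proof (cases "j = 0")
      case True
      then show ?thesis using False by simp
    next
      case False
      then show ?thesis unfolding cst_mult using that
        by (intro cong_mult power_eigenvalue_top S less 0) auto
    qed
    then have rest: "(\<Sum>j\<in>?J. cst (1 / fact j) * fps_nth (S ^ j) M)
        \<approx> cst (\<Sum>j\<in>?J. 1 / fact j * fps_nth (D ^ j) M)"
      unfolding cst_sum by (rule cong_sum)
    from cong_diff[OF exp[of M] rest] show ?thesis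
      by (simp add: fps_expn_def cexpn_nth split cst_add)
  qed
qed

lemma phi_elt_nonneg:
  "phi_elt t e i (sg e * int m) = gn (K (single (Hc i) (of_int (sg e)))) *
     fps_nth (fps_expn (fps_const (cst (of_int (sg e) * qdiff t)) * hseries e i)) m"
  by (cases e) (simp_all add: phi_elt_def)

lemma hseries_eigenvalue:
  assumes "\<forall>m::nat>0. gn (H i (sg e * int m)) \<approx> cst (\<eta> m)"
  shows "fps_nth (fps_const (cst (of_int (sg e) * qdiff t)) * hseries e i) m
    \<approx> cst (fps_nth (log_series t e \<eta>) m)"
  using assms cong_cst_mult[of "gn (H i (sg e * int m))" "cst (\<eta> m)" "of_int (sg e) * qdiff t"]
  by (cases "m = 0") (auto simp: hseries_def log_series_def cst_mult)

lemma phi_eigenvalue: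
  assumes i: "i \<in> idx R"
    and K: "gn (K (single (Hc i) (of_int (sg e)))) \<approx> cst c"
    and H: "\<forall>m::nat>0. gn (H i (sg e * int m)) \<approx> cst (\<eta> m)"
  shows "phi_elt t e i (sg e * int m) \<approx> cst (c * fps_nth (cexpn (log_series t e \<eta>)) m)"
  unfolding phi_elt_nonneg
  by (intro cong_mult_eigenvalue K expn_eigenvalue falg_hseries[OF i] hseries_eigenvalue[OF H]
      falg_gn cart_coroot i)

end

text \<open>Annihilators in modules over the presented algebra contain in addition the right multiples of the relators.\<close>

locale quantum_left_ideal = free_left_ideal R L for R t L +
  assumes L_relator: "a \<in> relators R t \<Longrightarrow> b \<in> falg R \<Longrightarrow> a * b \<in> L"
begin

lemma relator_cong: "a - a' \<in> relators R t \<Longrightarrow> b \<in> falg R \<Longrightarrow> a * b \<approx> a' * b"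
  using L_relator[of "a - a'" b] by (simp add: cong_L_def left_diff_distrib)

lemma K_inverse: "h \<in> cart R \<Longrightarrow> b \<in> falg R \<Longrightarrow> gn (K (- h)) * (gn (K h) * b) \<approx> b"
proof -
  assume h: "h \<in> cart R" "b \<in> falg R"
  then have "gn (K (- h)) * gn (K h) * b \<approx> gn (K (- h + h)) * b"
    by (intro relator_cong relators.k_mult cart_uminus)
  also have "gn (K (- h + h)) * b \<approx> 1 * b"
    using relator_cong[OF relators.k_zero, of b] h by simp
  finally show ?thesis by (simp add: mult.assoc)
qed

lemma H_eigenvalue_of_phi:
  assumes i: "i \<in> idx R" and q: "qdiff t \<noteq> 0" and c: "c \<noteq> 0"
    and K: "gn (K (single (Hc i) (of_int (sg e)))) \<approx> cst c"
    and phi: "\<And>m::nat. phi_elt t e i (sg e * int m) \<approx> cst (c * fps_nth (cexpn (log_series t e \<eta>)) m)"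
    and m: "m > 0"
  shows "gn (H i (sg e * int m)) \<approx> cst (\<eta> m)"
proof -
  let ?k = "gn (K (single (Hc i) (of_int (sg e))))"
  let ?k' = "gn (K (- single (Hc i) (of_int (sg e))))"
  let ?\<kappa> = "of_int (sg e) * qdiff t"
  let ?S = "fps_const (cst ?\<kappa>) * hseries e i"
  let ?D = "log_series t e \<eta>"
  have S: "fps_nth ?S m \<in> falg R" for m by (rule falg_hseries[OF i])
  have k: "?k \<in> falg R" "?k' \<in> falg R" by (auto intro!: falg_gn cart_coroot cart_uminus i)
  have \<kappa>: "?\<kappa> \<noteq> 0" using q by (cases e) auto
  have "1 \<approx> ?k' * (?k * 1)"
    by (intro cong_sym[OF K_inverse] cart_coroot i falg_1)
  also have "?k' * (?k * 1) \<approx> ?k' * cst c"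
    using cong_mult[OF k(2) K] by simp
  also have "?k' * cst c = cst c * ?k'" by (rule cst_commute)
  finally have "cst (1 / c) * 1 \<approx> cst (1 / c) * (cst c * ?k')" by (rule cong_cst_mult)
  then have k': "?k' \<approx> cst (1 / c)"
    using c by (auto simp: mult.assoc[symmetric] cst_mult[symmetric] intro: cong_sym)
  have "fps_nth (fps_expn ?S) m \<approx> cst (fps_nth (cexpn ?D) m)" for m
  proof -
    have "fps_nth (fps_expn ?S) m \<approx> ?k' * (?k * fps_nth (fps_expn ?S) m)"
      by (intro cong_sym[OF K_inverse] cart_coroot i falg_fps_expn S)
    also have "\<dots> \<approx> cst (1 / c * (c * fps_nth (cexpn ?D) m))"
      by (rule cong_mult_eigenvalue[OF k(2) k' phi[unfolded phi_elt_nonneg]])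
    finally show ?thesis using c by simp
  qed
  then have "fps_nth ?S m \<approx> cst (fps_nth ?D m)"
    by (rule eigenvalue_of_expn_eigenvalue[OF S]) (simp_all add: hseries_def log_series_def)
  then have "cst (1 / ?\<kappa>) * fps_nth ?S m \<approx> cst (1 / ?\<kappa>) * cst (fps_nth ?D m)"
    by (rule cong_cst_mult)
  then show ?thesis
    using \<kappa> m by (simp add: hseries_def log_series_def mult.assoc[symmetric] cst_mult[symmetric])
qed

text \<open>The relation for \<open>k\<^sub>h x k\<^bsub>-h\<^esub>\<close>, multiplied by \<open>k\<^sub>h\<close> from the right.\<close>

lemma K_X_cong:
  assumes "h \<in> cart R" "j \<in> idx R" "b \<in> falg R"
  shows "gn (K h) * (gn (X e j r) * b) \<approx>
    cst (qpow t (of_int (sg e) * pairing (simple_root R j) h)) * (gn (X e j r) * (gn (K h) * b))"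
proof -
  have 1: "gn (K h) * (gn (X e j r) * (gn (K (- h)) * (gn (K h) * b))) \<approx> gn (K h) * (gn (X e j r) * b)"
    by (intro cong_mult falg_gn K_inverse assms)
  have 2: "gn (K h) * gn (X e j r) * gn (K (- h)) * (gn (K h) * b) \<approx>
      cst (qpow t (of_int (sg e) * pairing (simple_root R j) h)) * gn (X e j r) * (gn (K h) * b)"
    by (intro relator_cong relators.k_x assms falg_mult falg_gn)
  show ?thesis
    by (rule cong_trans[OF cong_sym[OF 1] 2[unfolded mult.assoc]])
qed

end

lemma (in quantum_module) annihilator_left_ideal:
  assumes "x \<in> carrier W"
  shows "quantum_left_ideal R t {a \<in> falg R. opr a x = \<zero>\<^bsub>W\<^esub>}"
proof (intro quantum_left_ideal.intro quantum_left_ideal_axioms.intro free_left_ideal.intro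
    free_left_ideal_axioms.intro simply_laced_axioms CollectI conjI)
  fix a b assume "a \<in> relators R t" "b \<in> falg R"
  then show "a * b \<in> falg R" "opr (a * b) x = \<zero>\<^bsub>W\<^esub>"
    using relators_falg assms by (auto simp: falg_mult opr_mult opr_relator opr_closed subset_iff)
qed (simp_all add: assms opr_zero opr_add opr_mult falg_add falg_mult opr_zero_right)

section \<open>Highest weight vectors and uniqueness of simple modules\<close>

text \<open>
  The number of factors is recorded because it is the degree in the weight grading. The empty product
  is left out of the span: the span then meets the highest weight space only in \<open>0\<close>.
\<close>

inductive_set lowering :: "cartan_datum \<Rightarrow> (nat \<times> freealg) set" for R where
  one: "(0, 1) \<in> lowering R"
| step: "(k, b) \<in> lowering R \<Longrightarrow> i \<in> idx R \<Longrightarrow> (Suc k, gn (X Neg i r) * b) \<in> lowering R"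

inductive_set lowering_span :: "cartan_datum \<Rightarrow> freealg set" for R where
  zero: "0 \<in> lowering_span R"
| add: "s \<in> lowering_span R \<Longrightarrow> (Suc k, b) \<in> lowering R \<Longrightarrow> cst d * b + s \<in> lowering_span R"

lemma lowering_falg: "(k, b) \<in> lowering R \<Longrightarrow> b \<in> falg R"
  by (induction k b rule: lowering.induct) (auto intro: falg_intros)

lemma lowering_in_span: "(Suc k, b) \<in> lowering R \<Longrightarrow> b \<in> lowering_span R"
  using lowering_span.add[OF lowering_span.zero, of k b R 1] by simp

lemma lowering_span_add:
  "s \<in> lowering_span R \<Longrightarrow> s' \<in> lowering_span R \<Longrightarrow> s + s' \<in> lowering_span R"
  by (induction s rule: lowering_span.induct) (auto simp: add.assoc intro: lowering_span.add)

lemma lowering_span_cst_mult: "s \<in> lowering_span R \<Longrightarrow> cst c * s \<in> lowering_span R"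
proof (induction s rule: lowering_span.induct)
  case (add s k b d)
  then show ?case using lowering_span.add[of "cst c * s" R k b "c * d"]
    by (simp add: distrib_left cst_mult mult.assoc)
qed (simp add: lowering_span.zero)

text \<open>
  The annihilator of a highest weight vector. The element \<open>\<rho>\<close>, on which every simple root takes the
  value \<open>1\<close>, grades the module by the number of lowering operators.
\<close>

locale highest_weight_ideal = quantum_left_ideal R t L + generic_parameter t for R t L +
  fixes \<rho> :: cartan_elt and \<kappa> :: complex
  assumes X_pos: "i \<in> idx R \<Longrightarrow> gn (X Pos i r) \<in> L"
    and H_eigen: "i \<in> idx R \<Longrightarrow> m \<noteq> 0 \<Longrightarrow> \<exists>c. gn (H i m) - cst c \<in> L"
    and K_eigen: "h \<in> cart R \<Longrightarrow> \<exists>c. gn (K h) - cst c \<in> L"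
    and rho: "\<rho> \<in> cart R" "j \<in> idx R \<Longrightarrow> pairing (simple_root R j) \<rho> = 1"
    and K_rho: "gn (K \<rho>) - cst \<kappa> \<in> L" "\<kappa> \<noteq> 0"
begin

text \<open>
  The elements that are congruent to a scalar plus lowering terms. That these are all elements of
  the algebra is the part of the triangular decomposition that is needed.
\<close>

definition lowered :: "freealg set" where
  "lowered = {a. \<exists>c. \<exists>s\<in>lowering_span R. a \<approx> cst c + s}"

lemma lowered_cst: "cst c \<in> lowered"
  using lowering_span.zero by (auto simp: lowered_def intro!: exI[of _ c] bexI[of _ 0])

lemma lowered_span: "s \<in> lowering_span R \<Longrightarrow> s \<in> lowered"
  by (auto simp: lowered_def intro!: exI[of _ 0] bexI[of _ s])

lemma lowered_cong: "a \<approx> b \<Longrightarrow> b \<in> lowered \<Longrightarrow> a \<in> lowered"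
  unfolding lowered_def using cong_trans by blast

lemma lowered_L: "a \<in> L \<Longrightarrow> a \<in> lowered"
  by (rule lowered_cong[OF _ lowered_cst[of 0]]) (simp add: cong_L_def)

lemma lowered_add: "a \<in> lowered \<Longrightarrow> b \<in> lowered \<Longrightarrow> a + b \<in> lowered"
proof -
  assume "a \<in> lowered" "b \<in> lowered"
  then obtain c s c' s' where *: "s \<in> lowering_span R" "s' \<in> lowering_span R"
    "a \<approx> cst c + s" "b \<approx> cst c' + s'"
    by (auto simp: lowered_def)
  from cong_add[OF *(3,4)] have "a + b \<approx> cst (c + c') + (s + s')"
    by (simp add: cst_add add_ac)
  then show ?thesis using lowering_span_add[OF *(1,2)] unfolding lowered_def by blast
qed

lemma lowered_cst_mult: "a \<in> lowered \<Longrightarrow> cst c * a \<in> lowered"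
proof -
  assume "a \<in> lowered"
  then obtain d s where *: "s \<in> lowering_span R" "a \<approx> cst d + s"
    by (auto simp: lowered_def)
  from cong_cst_mult[OF *(2), of c] have "cst c * a \<approx> cst (c * d) + cst c * s"
    by (simp add: cst_mult distrib_left)
  then show ?thesis using lowering_span_cst_mult[OF *(1)] unfolding lowered_def by blast
qed

lemma lowered_diff: "a \<in> lowered \<Longrightarrow> b \<in> lowered \<Longrightarrow> a - b \<in> lowered"
  using lowered_add[OF _ lowered_cst_mult, of a b "-1"] by (simp add: cst_minus)

lemma lowered_lowering: "(k, b) \<in> lowering R \<Longrightarrow> b \<in> lowered"
proof (cases k)
  case 0
  assume "(k, b) \<in> lowering R"
  then have "b = 1" using 0 by cases auto
  then show ?thesis using lowered_cst[of 1] by simp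
qed (auto intro: lowered_span lowering_in_span)

text \<open>
  By linearity it suffices to treat products of lowering operators. For each generator this is an
  induction on the number of factors: the generator is commuted past the first factor.
\<close>

lemma lowered_mult:
  assumes a: "a \<in> falg R" and low: "\<And>k b. (k, b) \<in> lowering R \<Longrightarrow> a * b \<in> lowered"
    and "b \<in> lowered"
  shows "a * b \<in> lowered"
proof -
  obtain c s where s: "s \<in> lowering_span R" "b \<approx> cst c + s"
    using \<open>b \<in> lowered\<close> by (auto simp: lowered_def)
  have "a * s \<in> lowered" using s(1)
  proof (induction s rule: lowering_span.induct)
    case (add s k b d)
    then show ?case
      by (simp add: distrib_left cst_left_commute lowered_add lowered_cst_mult low)
  qed (use lowered_cst[of 0] in simp)
  moreover have "a * cst c \<in> lowered"
    using low[OF lowering.one] by (simp add: cst_commute lowered_cst_mult)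
  ultimately have "a * (cst c + s) \<in> lowered" by (simp add: distrib_left lowered_add)
  then show ?thesis by (rule lowered_cong[OF cong_mult[OF a s(2)]])
qed

lemma lowered_X_neg: "i \<in> idx R \<Longrightarrow> a \<in> lowered \<Longrightarrow> gn (X Neg i r) * a \<in> lowered"
  by (rule lowered_mult) (auto intro: falg_gn lowered_lowering lowering.step)

lemma lowered_K: "h \<in> cart R \<Longrightarrow> a \<in> lowered \<Longrightarrow> gn (K h) * a \<in> lowered"
proof (rule lowered_mult)
  fix k b assume h: "h \<in> cart R" and "(k, b) \<in> lowering R"
  from this(2) show "gn (K h) * b \<in> lowered"
  proof (induction k b rule: lowering.induct)
    case one
    then show ?case using K_eigen[OF h] lowered_cong[OF _ lowered_cst] by (auto simp: cong_L_def)
  next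
    case (step k b i r)
    then show ?case
      by (intro lowered_cong[OF K_X_cong] lowered_cst_mult lowered_X_neg h lowering_falg)
  qed
qed (auto intro: falg_gn)

lemma H_X_cong:
  assumes "i \<in> idx R" "j \<in> idx R" "m \<noteq> 0" "b \<in> falg R"
  shows "gn (H i m) * (gn (X e j r) * b) \<approx> gn (X e j r) * (gn (H i m) * b)
    + cst (of_int (sg e) * (1 / of_int m) * qint t (m * cmat R i j)) * (gn (X e j (m + r)) * b)"
  using L_relator[OF relators.h_x[OF assms(1-3)] assms(4), of e r]
  by (simp add: cong_L_def algebra_simps)

lemma lowered_H: "i \<in> idx R \<Longrightarrow> m \<noteq> 0 \<Longrightarrow> a \<in> lowered \<Longrightarrow> gn (H i m) * a \<in> lowered"
proof (rule lowered_mult)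
  fix k b assume i: "i \<in> idx R" "m \<noteq> 0" and "(k, b) \<in> lowering R"
  from this(3) show "gn (H i m) * b \<in> lowered"
  proof (induction k b rule: lowering.induct)
    case one
    then show ?case using H_eigen[OF i] lowered_cong[OF _ lowered_cst] by (auto simp: cong_L_def)
  next
    case (step k b j r)
    have "gn (X Neg j r) * (gn (H i m) * b) \<in> lowered" "gn (X Neg j (m + r)) * b \<in> lowered"
      using step lowered_lowering by (auto intro: lowered_X_neg)
    with step show ?case
      by (intro lowered_cong[OF H_X_cong] lowered_add lowered_cst_mult i lowering_falg)
  qed
qed (auto intro: falg_gn)

lemma lowered_phi: "i \<in> idx R \<Longrightarrow> a \<in> lowered \<Longrightarrow> phi_elt t e i m * a \<in> lowered"
proof -
  assume i: "i \<in> idx R" and a: "a \<in> lowered"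
  have "\<forall>a\<in>lowered. phi_elt t e i m * a \<in> lowered"
    by (rule phi_elt_closed[of "\<lambda>x. \<forall>a\<in>lowered. x * a \<in> lowered"])
      (auto simp: distrib_right mult.assoc intro: lowered_cst_mult lowered_add lowered_K lowered_H
        cart_coroot i)
  then show ?thesis using a by blast
qed

lemma lowered_X_pos: "i \<in> idx R \<Longrightarrow> a \<in> lowered \<Longrightarrow> gn (X Pos i r) * a \<in> lowered"
proof (rule lowered_mult)
  fix k b assume i: "i \<in> idx R" and "(k, b) \<in> lowering R"
  from this(2) show "gn (X Pos i r) * b \<in> lowered"
  proof (induction k b rule: lowering.induct)
    case one
    then show ?case using X_pos[OF i] by (auto intro: lowered_L)
  next
    case (step k b j r')
    let ?\<phi> = "cst (1 / qdiff t) * (phi_elt t Pos i (r + r') - phi_elt t Neg i (r + r'))"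
    let ?c = "if i = j then ?\<phi> else 0"
    have comm: "gn (X Pos i r) * (gn (X Neg j r') * b) \<approx> gn (X Neg j r') * (gn (X Pos i r) * b) + ?c * b"
      using L_relator[OF relators.x_plus_minus[OF i step(2)] lowering_falg[OF step(1)], of r r']
      by (simp add: cong_L_def algebra_simps)
    have c: "?c * b \<in> lowered"
      using lowered_lowering[OF step(1)] lowered_cst[of 0]
      by (auto simp: mult.assoc left_diff_distrib intro!: lowered_cst_mult lowered_diff lowered_phi step(2))
    show ?case
      by (rule lowered_cong[OF comm]) (intro lowered_add c lowered_X_neg step)
  qed
qed (auto intro: falg_gn)

lemma falg_lowered: "a \<in> falg R \<Longrightarrow> a \<in> lowered"
proof (induction a rule: falg_induct)
  case (gen g a)
  then consider e i r where "g = X e i r" "i \<in> idx R" | h where "g = K h" "h \<in> cart R"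
    | i m where "g = H i m" "i \<in> idx R" "m \<noteq> 0"
    by (auto simp: gens_def)
  then show ?case
  proof cases
    case 1
    then show ?thesis using gen by (cases e) (auto intro: lowered_X_pos lowered_X_neg)
  qed (use gen in \<open>auto intro: lowered_K lowered_H\<close>)
qed (auto intro: lowered_cst lowered_add)

lemma K_rho_lowering:
  "(k, b) \<in> lowering R \<Longrightarrow> gn (K \<rho>) * b \<approx> cst (qpi t (- int k) * \<kappa>) * b"
proof (induction k b rule: lowering.induct)
  case one
  then show ?case using K_rho by (simp add: cong_L_def)
next
  case (step k b i r)
  have "gn (K \<rho>) * (gn (X Neg i r) * b) \<approx>
      cst (qpow t (of_int (sg Neg) * pairing (simple_root R i) \<rho>)) * (gn (X Neg i r) * (gn (K \<rho>) * b))"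
    by (intro K_X_cong rho step lowering_falg[OF step(1)])
  also have "\<dots> = cst (qpi t (-1)) * (gn (X Neg i r) * (gn (K \<rho>) * b))"
    using rho(2)[OF step(2)] by simp
  also have "\<dots> \<approx> cst (qpi t (-1)) * (gn (X Neg i r) * (cst (qpi t (- int k) * \<kappa>) * b))"
    by (intro cong_cst_mult cong_mult falg_gn step)
  also have "\<dots> = cst (qpi t (- int (Suc k)) * \<kappa>) * (gn (X Neg i r) * b)"
  proof -
    have "qpi t (- int (Suc k)) = qpi t (-1) * qpi t (- int k)"
      by (simp flip: qpow_add of_int_add)
    then show ?thesis by (simp add: cst_left_commute[of "gn _"] cst_mult mult.assoc del: of_nat_Suc)
  qed
  finally show ?case .
qed

text \<open>
  The polynomial in \<open>k\<^sub>\<rho>\<close> whose zeros are the eigenvalues in degrees \<open>1, \<dots>, N\<close>. As \<open>q\<close> is not a root of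
  unity, the eigenvalue in degree \<open>0\<close> is not among them.
\<close>

fun degree_filter :: "nat \<Rightarrow> freealg" where
  "degree_filter 0 = 1"
| "degree_filter (Suc N) = (gn (K \<rho>) - cst (qpi t (- int (Suc N)) * \<kappa>)) * degree_filter N"

lemma degree_filter_falg: "degree_filter N \<in> falg R"
  by (induction N) (auto simp del: of_nat_Suc intro: falg_intros rho)

lemma degree_filter_lowering:
  assumes "(k, b) \<in> lowering R"
  shows "degree_filter N * b \<approx> cst (\<Prod>j=1..N. (qpi t (- int k) - qpi t (- int j)) * \<kappa>) * b"
proof (induction N)
  case (Suc N)
  let ?x = "gn (K \<rho>) - cst (qpi t (- int (Suc N)) * \<kappa>)"
  let ?p = "cst (\<Prod>j=1..N. (qpi t (- int k) - qpi t (- int j)) * \<kappa>)"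
  have "degree_filter (Suc N) * b = ?x * (degree_filter N * b)"
    by (simp add: mult.assoc)
  also have "\<dots> \<approx> ?x * (?p * b)"
    by (intro cong_mult Suc.IH falg_intros rho)
  also have "\<dots> = ?p * (?x * b)" by (rule cst_left_commute)
  also have "?x * b \<approx> cst (qpi t (- int k) * \<kappa>) * b - cst (qpi t (- int (Suc N)) * \<kappa>) * b"
    unfolding left_diff_distrib by (intro cong_diff K_rho_lowering assms cong_refl)
  then have "?p * (?x * b) \<approx> ?p * (cst (qpi t (- int k) * \<kappa>) * b - cst (qpi t (- int (Suc N)) * \<kappa>) * b)"
    by (rule cong_cst_mult)
  also have "\<dots> = cst (\<Prod>j=1..Suc N. (qpi t (- int k) - qpi t (- int j)) * \<kappa>) * b"
    by (simp del: of_nat_Suc add: cst_mult cst_diff left_diff_distrib mult.assoc)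
  finally show ?case .
qed simp

lemma degree_filter_span:
  "s \<in> lowering_span R \<Longrightarrow> \<exists>M. \<forall>N\<ge>M. degree_filter N * s \<in> L"
proof (induction s rule: lowering_span.induct)
  case (add s k b d)
  then obtain M where M: "\<And>N. N \<ge> M \<Longrightarrow> degree_filter N * s \<in> L" by auto
  have "degree_filter N * (cst d * b + s) \<in> L" if "N \<ge> max M (Suc k)" for N
  proof -
    have p: "(\<Prod>j=1..N. (qpi t (- int (Suc k)) - qpi t (- int j)) * \<kappa>) = 0"
      by (rule prod_zero[of _]) (use that in \<open>auto intro!: bexI[of _ "Suc k"]\<close>)
    have "degree_filter N * b \<in> L"
      using degree_filter_lowering[OF add(2), of N] unfolding p by (simp add: cong_L_def)
    then show ?thesis using M[of N] that
      by (simp add: distrib_left cst_left_commute L_add L_mult)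
  qed
  then show ?case by blast
qed (simp add: L_zero)

text \<open>
  Every element is congruent to its highest weight component \<open>c\<close> plus a term \<open>s\<close> that can be
  removed by an element \<open>g\<close> acting on the highest weight vector as a nonzero scalar.
\<close>

lemma highest_weight_component:
  assumes "a \<in> falg R"
  obtains c s g d where "g \<in> falg R" "d \<noteq> 0" "a - (cst c + s) \<in> L" "g * s \<in> L" "g - cst d \<in> L"
proof -
  obtain c s where s: "s \<in> lowering_span R" "a \<approx> cst c + s"
    using falg_lowered[OF assms] by (auto simp: lowered_def)
  obtain N where N: "degree_filter N * s \<in> L" using degree_filter_span[OF s(1)] by auto
  define d where "d = (\<Prod>j=1..N. (qpi t (- int 0) - qpi t (- int j)) * \<kappa>)"
  have "qpi t (- int 0) - qpi t (- int j) \<noteq> 0" if "j \<ge> 1" for j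
    using qpi_inj[of "- int 0" "- int j"] that by (simp del: of_int_minus of_nat_0)
  then have "d \<noteq> 0"
    using K_rho(2) by (auto simp: d_def simp del: of_int_minus of_nat_0)
  moreover have "degree_filter N \<approx> cst d"
    using degree_filter_lowering[OF lowering.one, of N] unfolding d_def[symmetric] by simp
  ultimately show ?thesis
    using that[OF degree_filter_falg \<open>d \<noteq> 0\<close> _ N] s(2) by (simp add: cong_L_def)
qed

end

text \<open>
  A simple highest weight module is the quotient of the algebra by the annihilator of its highest
  weight vector. The intersection of the annihilators of \<open>v\<close> and \<open>w\<close> is again an ideal of the kind
  studied above, and this controls the difference between the two.
\<close>

locale same_highest_weight = V: quantum_module R t V + W: quantum_module R t W + generic_parameter t
  for R t and V :: "(freealg set, 'v) module" and W :: "(freealg set, 'w) module" +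
  fixes v :: 'v and w :: 'w and \<rho> :: cartan_elt and \<kappa> :: complex
  assumes v: "v \<in> carrier V" "v \<noteq> \<zero>\<^bsub>V\<^esub>" and w: "w \<in> carrier W" "w \<noteq> \<zero>\<^bsub>W\<^esub>"
    and simple: "simple_module (quantum_alg R t) V" "simple_module (quantum_alg R t) W"
    and X_pos: "i \<in> idx R \<Longrightarrow> V.opr (gn (X Pos i r)) v = \<zero>\<^bsub>V\<^esub>"
      "i \<in> idx R \<Longrightarrow> W.opr (gn (X Pos i r)) w = \<zero>\<^bsub>W\<^esub>"
    and H_eigen: "i \<in> idx R \<Longrightarrow> m \<noteq> 0 \<Longrightarrow>
      \<exists>c. V.opr (gn (H i m)) v = V.opr (cst c) v \<and> W.opr (gn (H i m)) w = W.opr (cst c) w"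
    and K_eigen: "h \<in> cart R \<Longrightarrow>
      \<exists>c. V.opr (gn (K h)) v = V.opr (cst c) v \<and> W.opr (gn (K h)) w = W.opr (cst c) w"
    and rho: "\<rho> \<in> cart R" "j \<in> idx R \<Longrightarrow> pairing (simple_root R j) \<rho> = 1"
    and K_rho: "V.opr (gn (K \<rho>)) v = V.opr (cst \<kappa>) v" "W.opr (gn (K \<rho>)) w = W.opr (cst \<kappa>) w" "\<kappa> \<noteq> 0"
begin

definition annV :: "freealg set" where "annV = {a \<in> falg R. V.opr a v = \<zero>\<^bsub>V\<^esub>}"
definition annW :: "freealg set" where "annW = {a \<in> falg R. W.opr a w = \<zero>\<^bsub>W\<^esub>}"

sublocale AV: quantum_left_ideal R t annV
  unfolding annV_def by (rule V.annihilator_left_ideal[OF v(1)])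

sublocale AW: quantum_left_ideal R t annW
  unfolding annW_def by (rule W.annihilator_left_ideal[OF w(1)])

lemma diff_in_annV: "a \<in> falg R \<Longrightarrow> b \<in> falg R \<Longrightarrow> a - b \<in> annV \<longleftrightarrow> V.opr a v = V.opr b v"
  by (simp add: annV_def falg_diff V.opr_diff_eq_zero_iff v)

lemma diff_in_annW: "a \<in> falg R \<Longrightarrow> b \<in> falg R \<Longrightarrow> a - b \<in> annW \<longleftrightarrow> W.opr a w = W.opr b w"
  by (simp add: annW_def falg_diff W.opr_diff_eq_zero_iff w)

sublocale HW: highest_weight_ideal R t "annV \<inter> annW" \<rho> \<kappa>
proof unfold_locales
  fix i r assume "i \<in> idx R"
  then show "gn (X Pos i r) \<in> annV \<inter> annW" by (simp add: annV_def annW_def X_pos falg_gn)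
next
  fix i and m :: int assume "i \<in> idx R" "m \<noteq> 0"
  then show "\<exists>c. gn (H i m) - cst c \<in> annV \<inter> annW"
    using H_eigen[of i m] by (simp add: diff_in_annV diff_in_annW falg_gn)
next
  fix h assume "h \<in> cart R"
  then show "\<exists>c. gn (K h) - cst c \<in> annV \<inter> annW"
    using K_eigen[of h] by (simp add: diff_in_annV diff_in_annW falg_gn)
next
  show "gn (K \<rho>) - cst \<kappa> \<in> annV \<inter> annW"
    using K_rho rho(1) by (simp add: diff_in_annV diff_in_annW falg_gn)
qed (auto simp: K_rho rho AV.L_zero AW.L_zero AV.L_add AW.L_add AV.L_mult AW.L_mult
    AV.L_relator AW.L_relator)

text \<open>
  If the annihilator of \<open>v\<close> did not annihilate \<open>w\<close>, simplicity would give an element that kills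
  \<open>v\<close> and fixes \<open>w\<close>; its component along the highest weight space would be both \<open>0\<close> and \<open>1\<close>.
\<close>

lemma annV_subset_annW: "annV \<subseteq> annW"
proof -
  let ?N = "(\<lambda>a. W.opr a w) ` annV"
  have "submodule ?N (quantum_alg R t) W"
    unfolding W.submodule_iff
  proof (intro conjI ballI)
    show "?N \<subseteq> carrier W" by (auto simp: annV_def W.opr_closed w)
    show "\<zero>\<^bsub>W\<^esub> \<in> ?N" using AV.L_zero W.opr_zero[OF w(1)] by force
  next
    fix x y assume "x \<in> ?N" "y \<in> ?N"
    then obtain a b where "a \<in> annV" "b \<in> annV" "x = W.opr a w" "y = W.opr b w" by auto
    then show "x \<oplus>\<^bsub>W\<^esub> y \<in> ?N"
      using AV.L_add[of a b] W.opr_add[of a b w] w by (auto simp: annV_def intro!: image_eqI[of _ _ "a + b"])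
  next
    fix a x assume "a \<in> falg R" "x \<in> ?N"
    then obtain b where "b \<in> annV" "x = W.opr b w" by auto
    then show "W.opr a x \<in> ?N"
      using AV.L_mult[of a b] W.opr_mult[of a b w] w \<open>a \<in> falg R\<close>
      by (auto simp: annV_def intro!: image_eqI[of _ _ "a * b"])
  qed
  then have "?N = {\<zero>\<^bsub>W\<^esub>} \<or> ?N = carrier W" using simple by (auto simp: simple_module_def)
  moreover have "?N \<noteq> carrier W"
  proof
    assume "?N = carrier W"
    then obtain a where a: "a \<in> annV" "W.opr a w = w" using w(1) by (metis imageE)
    have af: "a \<in> falg R" using a by (simp add: annV_def)
    obtain c s g d where gs: "g \<in> falg R" "d \<noteq> 0" "a - (cst c + s) \<in> annV \<inter> annW"
      "g * s \<in> annV \<inter> annW" "g - cst d \<in> annV \<inter> annW"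
      by (rule HW.highest_weight_component[OF af])
    have decomp: "g * a - g * (cst c + s) \<in> annV \<inter> annW"
      using HW.L_mult[OF gs(1,3)] by (simp add: right_diff_distrib)
    have gcs: "g * (cst c + s) = cst c * (g - cst d) + cst (c * d) + g * s"
      by (simp add: distrib_left right_diff_distrib cst_commute[of g] cst_mult)
    \<comment> \<open>\<open>g a\<close> kills \<open>v\<close>, while it acts on \<open>v\<close> as \<open>c d\<close>\<close>
    have "cst (c * d) = (g * a - (g * a - g * (cst c + s))) - cst c * (g - cst d) - g * s"
      by (simp add: gcs)
    also have "\<dots> \<in> annV"
      using AV.L_diff[OF AV.L_diff[OF AV.L_diff[OF AV.L_mult[OF gs(1) a(1)] IntD1[OF decomp]]
            AV.L_mult[OF falg_cst IntD1[OF gs(5)]]] IntD1[OF gs(4)]] .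
    finally have "cst (1 / (c * d)) * cst (c * d) \<in> annV" by (intro AV.L_mult falg_cst)
    moreover have "1 \<notin> annV" using v by (simp add: annV_def V.opr_one)
    ultimately have c: "c = 0" using gs(2) by (cases "c = 0") (auto simp flip: cst_mult)
    have "a - 1 \<in> annW" using a af w by (simp add: diff_in_annW W.opr_one)
    then have *: "g * (a - 1) \<in> annW" by (rule AW.L_mult[OF gs(1)])
    \<comment> \<open>\<open>g a\<close> acts on \<open>w\<close> as \<open>g\<close>, that is, as \<open>d\<close>, but also as \<open>g s\<close>, that is, as \<open>0\<close>\<close>
    have "cst d = (g * a - g * (cst c + s)) + g * s - g * (a - 1) - (g - cst d)"
      by (simp add: c right_diff_distrib)
    also have "\<dots> \<in> annW"
      using AW.L_diff[OF AW.L_diff[OF AW.L_add[OF IntD2[OF decomp] IntD2[OF gs(4)]] *] IntD2[OF gs(5)]] .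
    finally have "cst (1 / d) * cst d \<in> annW" by (intro AW.L_mult falg_cst)
    moreover have "1 \<notin> annW" using w by (simp add: annW_def W.opr_one)
    ultimately show False using gs(2) by (simp flip: cst_mult)
  qed
  ultimately show ?thesis by (auto simp: annV_def annW_def)
qed

end

lemma (in quantum_module) generated_by_nonzero:
  assumes "simple_module (quantum_alg R t) W" "x \<in> carrier W" "x \<noteq> \<zero>\<^bsub>W\<^esub>"
  shows "carrier W = (\<lambda>a. opr a x) ` falg R"
proof -
  let ?N = "(\<lambda>a. opr a x) ` falg R"
  have "submodule ?N (quantum_alg R t) W"
    unfolding submodule_iff
  proof (intro conjI ballI)
    show "\<zero>\<^bsub>W\<^esub> \<in> ?N" using opr_zero[OF assms(2)] falg_0 by (metis imageI)
  next
    fix y z assume "y \<in> ?N" "z \<in> ?N"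
    then show "y \<oplus>\<^bsub>W\<^esub> z \<in> ?N" using assms(2) by (auto simp flip: opr_add intro: falg_add)
  next
    fix a y assume "a \<in> falg R" "y \<in> ?N"
    then show "opr a y \<in> ?N" using assms(2) by (auto simp flip: opr_mult intro: falg_mult)
  qed (use assms in \<open>auto simp: opr_closed\<close>)
  moreover have "x \<in> ?N" using opr_one[OF assms(2)] falg_1 by (metis imageI)
  ultimately show ?thesis using assms by (auto simp: simple_module_def)
qed

context same_highest_weight
begin

lemma swapped: "same_highest_weight R t W V w v \<rho> \<kappa>"
proof unfold_locales
  fix i and m :: int assume "i \<in> idx R" "m \<noteq> 0"
  then show "\<exists>c. W.opr (gn (H i m)) w = W.opr (cst c) w \<and> V.opr (gn (H i m)) v = V.opr (cst c) v"
    using H_eigen by blast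
next
  fix h assume "h \<in> cart R"
  then show "\<exists>c. W.opr (gn (K h)) w = W.opr (cst c) w \<and> V.opr (gn (K h)) v = V.opr (cst c) v"
    using K_eigen by blast
qed (use v w simple X_pos rho K_rho in auto)

lemma annV_eq_annW: "annV = annW"
proof
  show "annW \<subseteq> annV"
    using same_highest_weight.annV_subset_annW[OF swapped]
    unfolding same_highest_weight.annV_def[OF swapped] same_highest_weight.annW_def[OF swapped]
      annV_def annW_def .
qed (rule annV_subset_annW)

theorem isomorphic: "module_iso (quantum_alg R t) V W"
proof -
  have same: "V.opr a v = V.opr b v \<longleftrightarrow> W.opr a w = W.opr b w" if "a \<in> falg R" "b \<in> falg R" for a b
    using diff_in_annV[OF that] diff_in_annW[OF that] annV_eq_annW by simp
  define f where "f x = W.opr (SOME a. a \<in> falg R \<and> V.opr a v = x) w" for x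
  have f: "f (V.opr a v) = W.opr a w" if "a \<in> falg R" for a
  proof -
    let ?b = "SOME b. b \<in> falg R \<and> V.opr b v = V.opr a v"
    have "?b \<in> falg R \<and> V.opr ?b v = V.opr a v" by (rule someI[of _ a]) (use that in auto)
    then show ?thesis unfolding f_def using same that by blast
  qed
  have V: "carrier V = (\<lambda>a. V.opr a v) ` falg R"
    by (rule V.generated_by_nonzero[OF simple(1) v])
  have W: "carrier W = (\<lambda>a. W.opr a w) ` falg R"
    by (rule W.generated_by_nonzero[OF simple(2) w])
  have "bij_betw f (carrier V) (carrier W)"
    unfolding V W by (rule bij_betwI') (auto simp: f same)
  moreover have "f (x \<oplus>\<^bsub>V\<^esub> y) = f x \<oplus>\<^bsub>W\<^esub> f y" if "x \<in> carrier V" "y \<in> carrier V" for x y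
    using that unfolding V by (auto simp: f falg_add v w simp flip: V.opr_add W.opr_add)
  moreover have "f (a \<odot>\<^bsub>V\<^esub> x) = a \<odot>\<^bsub>W\<^esub> f x"
    if ax: "a \<in> carrier (quantum_alg R t)" "x \<in> carrier V" for a x
  proof -
    obtain b c where b: "b \<in> falg R" "a = cls R t b" and c: "c \<in> falg R" "x = V.opr c v"
      using ax V by (auto simp: V.quantum_alg_carrier)
    have "f (V.opr b x) = W.opr b (f x)"
      using b c by (simp add: f falg_mult v w flip: V.opr_mult W.opr_mult)
    then show ?thesis by (simp add: b V.opr_def W.opr_def)
  qed
  ultimately show ?thesis unfolding module_iso_def by blast
qed

end

section \<open>Thin monomials\<close>

text \<open>
  Weighted sums of the exponents of the variables \<open>Y\<^bsub>i,l\<^esub>\<close> with \<open>i\<close> fixed. They are additive in the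
  monomial, which makes the change of eigenvalues under \<open>A\<^bsub>i,l\<^esub>\<close> a computation with generators.
\<close>

definition level_sum :: "nat \<Rightarrow> (int \<Rightarrow> 'a::comm_ring_1) \<Rightarrow> ymon \<Rightarrow> 'a" where
  "level_sum i g u = (\<Sum>l\<in>{l. expon u i l \<noteq> 0}. of_int (expon u i l) * g l)"

lemma finite_levels: "finite {l. expon u i l \<noteq> 0}"
  by (rule finite_subset[of _ "snd ` keys u"]) (force simp: in_keys_iff)+

lemma level_sum_superset:
  assumes "finite A" "{l. expon u i l \<noteq> 0} \<subseteq> A"
  shows "level_sum i g u = (\<Sum>l\<in>A. of_int (expon u i l) * g l)"
  unfolding level_sum_def using assms by (intro sum.mono_neutral_left) auto

lemma level_sum_add: "level_sum i g (u + v) = level_sum i g u + level_sum i g v"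
proof -
  let ?A = "{l. expon u i l \<noteq> 0} \<union> {l. expon v i l \<noteq> 0}"
  have "level_sum i g w = (\<Sum>l\<in>?A. of_int (expon w i l) * g l)" if "w \<in> {u, v, u + v}" for w
    by (rule level_sum_superset) (use that in \<open>auto simp: finite_levels lookup_add\<close>)
  then show ?thesis by (simp add: lookup_add distrib_right sum.distrib)
qed

lemma level_sum_zero [simp]: "level_sum i g 0 = 0"
  by (simp add: level_sum_def)

lemma level_sum_diff: "level_sum i g (u - v) = level_sum i g u - level_sum i g v"
  using level_sum_add[of i g "u - v" v] by simp

lemma level_sum_sum: "level_sum i g (sum f A) = (\<Sum>a\<in>A. level_sum i g (f a))"
  by (induction A rule: infinite_finite_induct) (simp_all add: level_sum_add)

lemma expon_Yv: "expon (Yv j k) i l = (if i = j \<and> l = k then 1 else 0)"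
  by (auto simp: Yv_def lookup_single when_def)

lemma level_sum_Yv: "level_sum i g (Yv j k) = (if i = j then g k else 0)"
  by (subst level_sum_superset[of "{k}"]) (auto simp: expon_Yv)

lemma total_expon_level_sum: "total_expon u i = level_sum i (\<lambda>_. 1) u"
  by (simp add: total_expon_def level_sum_def)

text \<open>
  The \<open>i\<close>-th part of the monomial \<open>u\<close> is \<open>Y\<^bsub>i,l\<^esub>\<^sup>c\<close>. Occupied and unoccupied nodes are covered
  alike, the latter by \<open>c = 0\<close>.
\<close>

definition sole_at :: "nat \<Rightarrow> int \<Rightarrow> int \<Rightarrow> ymon \<Rightarrow> bool" where
  "sole_at i c l u \<longleftrightarrow> (\<forall>l'. expon u i l' = (if l' = l then c else 0))"

definition thin_at :: "nat \<Rightarrow> ymon \<Rightarrow> bool" where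
  "thin_at i u \<longleftrightarrow> (\<exists>c l. c \<in> {-1, 0, 1} \<and> sole_at i c l u)"

lemma sole_at_unique: "sole_at i c l u \<Longrightarrow> sole_at i c' l' u \<Longrightarrow> c = c' \<and> (c \<noteq> 0 \<longrightarrow> l = l')"
  unfolding sole_at_def by metis

lemma level_sum_sole: "sole_at i c l u \<Longrightarrow> level_sum i g u = of_int c * g l"
  by (subst level_sum_superset[of "{l}"]) (auto simp: sole_at_def split: if_splits)

lemma vphi_upto_sole:
  assumes "sole_at i c l u"
  shows "vphi_upto i L u = (if l \<le> L then c else 0)"
proof -
  have "{l'. l' \<le> L \<and> expon u i l' \<noteq> 0} = (if l \<le> L \<and> c \<noteq> 0 then {l} else {})"
    using assms by (auto simp: sole_at_def split: if_splits)
  then show ?thesis using assms by (auto simp: vphi_upto_def sole_at_def)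
qed

lemma veps_from_sole:
  assumes "sole_at i c l u"
  shows "veps_from i L u = (if L \<le> l then - c else 0)"
proof -
  have "{l'. L \<le> l' \<and> expon u i l' \<noteq> 0} = (if L \<le> l \<and> c \<noteq> 0 then {l} else {})"
    using assms by (auto simp: sole_at_def split: if_splits)
  then show ?thesis using assms by (auto simp: veps_from_def sole_at_def)
qed

lemma vphi_sole:
  assumes "sole_at i c l u" shows "vphi i u = max 0 c"
proof -
  have "range (\<lambda>L. vphi_upto i L u) = {0, c}"
    unfolding vphi_upto_sole[OF assms] by (auto intro: rev_image_eqI[of "l - 1"] rev_image_eqI[of l])
  then show ?thesis by (simp add: vphi_def)
qed

lemma veps_sole:
  assumes "sole_at i c l u" shows "veps i u = max 0 (- c)"
proof -
  have "range (\<lambda>L. veps_from i L u) = {0, - c}"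
    unfolding veps_from_sole[OF assms] by (auto intro: rev_image_eqI[of "l + 1"] rev_image_eqI[of l])
  then show ?thesis by (simp add: veps_def)
qed

lemma q_pos_sole: "sole_at i c l u \<Longrightarrow> c > 0 \<Longrightarrow> q_pos i u = l"
  unfolding q_pos_def by (rule Least_equality) (auto simp: vphi_sole vphi_upto_sole split: if_splits)

lemma p_pos_sole: "sole_at i c l u \<Longrightarrow> c < 0 \<Longrightarrow> p_pos i u = l"
  unfolding p_pos_def by (rule Greatest_equality) (auto simp: veps_sole veps_from_sole split: if_splits)

section \<open>Eigenvalues attached to thin monomials\<close>

lemma fps_const_nth_mult_geometric:
  "fps_nth ((1 - fps_const b * fps_X) * inverse (1 - fps_const a * fps_X)) m
     = (if m = 0 then 1 else a ^ m - b * a ^ (m - 1) :: complex)"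
proof -
  have inv: "inverse (1 - fps_const a * fps_X) = Abs_fps (\<lambda>m. a ^ m)"
  proof (rule fps_inverse_unique)
    show "(1 - fps_const a * fps_X) * Abs_fps (\<lambda>m. a ^ m) = 1"
    proof (rule fps_ext)
      fix n
      show "fps_nth ((1 - fps_const a * fps_X) * Abs_fps (\<lambda>m. a ^ m)) n = fps_nth 1 n"
        by (cases n) (simp_all add: left_diff_distrib mult.assoc)
    qed
  qed
  show ?thesis unfolding inv by (cases m) (simp_all add: left_diff_distrib mult.assoc)
qed

lemma log_derivative_unique:
  fixes F G :: "complex fps"
  assumes "fps_deriv F = D * F" "fps_deriv G = D * G" "fps_nth F 0 = fps_nth G 0" "fps_nth G 0 \<noteq> 0"
  shows "F = G"
proof -
  have G: "G \<noteq> 0" using assms(4) by auto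
  have "fps_deriv (F * inverse G) = 0"
  proof -
    have "G * inverse (G * G) = inverse G"
      using assms(4) by (simp add: fps_inverse_mult inverse_mult_eq_1' flip: mult.assoc)
    then show ?thesis
      using assms by (simp add: fps_inverse_deriv' fps_divide_unit power2_eq_square algebra_simps)
  qed
  then have "F * inverse G = fps_const (fps_nth (F * inverse G) 0)"
    by (simp only: fps_deriv_eq_0_iff)
  also have "\<dots> = 1" using assms by simp
  finally have "F * inverse G * G = G" by simp
  then show ?thesis using assms(4) by (simp add: mult.assoc inverse_mult_eq_1)
qed

text \<open>
  The series is the formal logarithm of the right-hand side: both sides have the same logarithmic
  derivative and the same constant term.
\<close>

lemma cexpn_log_ratio:
  "cexpn (Abs_fps (\<lambda>m. (a ^ m - b ^ m) / of_nat m))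
     = (1 - fps_const b * fps_X) * inverse (1 - fps_const a * fps_X)"
  (is "cexpn ?S = ?F")
proof (rule log_derivative_unique)
  have S0: "fps_nth ?S 0 = 0" by simp
  show "fps_deriv (cexpn ?S) = fps_deriv ?S * cexpn ?S"
    unfolding cexpn_def using S0 by (simp add: fps_compose_deriv mult.commute)
  define A B where "A = 1 - fps_const a * fps_X" and "B = 1 - fps_const b * fps_X"
  have A: "inverse A * A = 1" and B: "inverse B * B = 1"
    unfolding A_def B_def by (rule inverse_mult_eq_1; simp)+
  have dS: "fps_deriv ?S = fps_const a * inverse A - fps_const b * inverse B"
  proof (rule fps_ext)
    fix n
    have g: "fps_nth (inverse (1 - fps_const c * fps_X)) n = (c :: complex) ^ n" for c
      using fps_const_nth_mult_geometric[of 0 c n] by (cases n) simp_all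
    show "fps_nth (fps_deriv ?S) n = fps_nth (fps_const a * inverse A - fps_const b * inverse B) n"
      by (simp add: A_def B_def g del: of_nat_Suc)
  qed
  have dA: "fps_deriv (inverse A) = fps_const a * inverse A * inverse A"
    by (simp add: A_def fps_inverse_deriv' fps_divide_unit power2_eq_square fps_inverse_mult mult.assoc)
  have "fps_deriv (B * inverse A) = B * (fps_const a * inverse A * inverse A) - fps_const b * inverse A"
    by (simp add: dA) (simp add: B_def flip: fps_const_neg)
  also have "\<dots> = B * (fps_const a * inverse A * inverse A) - fps_const b * (inverse B * B) * inverse A"
    by (simp add: B)
  also have "\<dots> = fps_deriv ?S * (B * inverse A)"
    unfolding dS by (simp only: algebra_simps)
  finally show "fps_deriv ?F = fps_deriv ?S * ?F" unfolding A_def B_def .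
qed (simp_all add: cexpn_nth)

text \<open>
  The eigenvalue of \<open>\<phi>\<^sub>i\<^sup>\<plusminus>(z)\<close> on a vector whose monomial has \<open>i\<close>-th part \<open>Y\<^bsub>i,l\<^esub>\<^sup>c\<close>, \<open>c \<in> {-1,0,1}\<close>.
  In terms of \<open>x = q\<^sup>\<plusminus>\<^sup>1\<close> both expansions are given by \<open>x\<^sup>c (1 - x\<^bsup>l-c\<^esup> y) / (1 - x\<^bsup>l+c\<^esup> y)\<close> with
  \<open>y = z\<^sup>\<plusminus>\<^sup>1\<close>, and inverting \<open>Y\<^bsub>i,l\<^esub>\<close> exchanges numerator and denominator.
\<close>

definition phi_series :: "complex \<Rightarrow> sgn \<Rightarrow> int \<Rightarrow> int \<Rightarrow> complex fps" where
  "phi_series t e c l = fps_const (qpi t (sg e * c)) *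
     ((1 - fps_const (qpi t (sg e * (l - c))) * fps_X) * inverse (1 - fps_const (qpi t (sg e * (l + c))) * fps_X))"

lemma phi_series_nth:
  assumes "c \<in> {-1, 0, 1}"
  shows "fps_nth (phi_series t e c l) m = (if m = 0 then qpi t (sg e * c)
    else of_int (sg e) * qdiff t * (of_int c * qpi t (sg e * int m * (l + c))))"
proof (cases "m = 0")
  case False
  define a where "a = qpi t (sg e * (l + c))"
  have q: "qpi t (sg e * c) * qpi t (sg e * (l - c)) = qpi t (- (sg e * c)) * a"
    unfolding a_def qpi_mult by (rule arg_cong[where f = "\<lambda>l. qpi t l"]) (simp add: algebra_simps)
  have a: "a ^ m = qpi t (sg e * int m * (l + c))"
    unfolding a_def qpi_power by (rule arg_cong[where f = "\<lambda>l. qpi t l"]) (simp add: algebra_simps)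
  have "fps_nth (phi_series t e c l) m = qpi t (sg e * c) * a ^ m - qpi t (- (sg e * c)) * (a * a ^ (m - 1))"
    using False q unfolding phi_series_def fps_mult_left_const_nth fps_const_nth_mult_geometric a_def[symmetric]
    by (simp only: if_False right_diff_distrib mult.assoc[symmetric])
  also have "a * a ^ (m - 1) = a ^ m" using False by (simp flip: power_Suc)
  finally show ?thesis using False assms
    by (cases e) (auto simp: a qdiff_def algebra_simps)
qed (simp add: phi_series_def)

text \<open>
  The eigenvalue of \<open>h\<^bsub>i,k\<^esub>\<close> on a vector with monomial \<open>u\<close>, read off from the logarithm of
  \<open>\<Prod>\<^sub>l (q (1 - z q\<^bsup>l-1\<^esup>) / (1 - z q\<^bsup>l+1\<^esup>))\<^bsup>u\<^sub>i\<^sub>,\<^sub>l\<^esup>\<close>.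
\<close>

definition h_value :: "complex \<Rightarrow> nat \<Rightarrow> int \<Rightarrow> ymon \<Rightarrow> complex" where
  "h_value t i k u = qint t k / of_int k * level_sum i (\<lambda>l. qpi t (k * l)) u"

lemma (in generic_parameter) phi_series_eq_cexpn:
  assumes "sole_at i c l u" "c \<in> {-1, 0, 1}"
  shows "fps_const (qpi t (sg e * c)) * cexpn (log_series t e (\<lambda>m. h_value t i (sg e * int m) u))
    = phi_series t e c l"
proof -
  define a where "a = qpi t (sg e * (l + c))"
  define b where "b = qpi t (sg e * (l - c))"
  have "log_series t e (\<lambda>m. h_value t i (sg e * int m) u) = Abs_fps (\<lambda>m. (a ^ m - b ^ m) / of_nat m)"
  proof (rule fps_ext)
    fix m
    show "fps_nth (log_series t e (\<lambda>m. h_value t i (sg e * int m) u)) m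
        = fps_nth (Abs_fps (\<lambda>m. (a ^ m - b ^ m) / of_nat m)) m"
    proof (cases "m = 0")
      case False
      have ab: "a ^ m = qpi t (sg e * int m * (l + c))" "b ^ m = qpi t (sg e * int m * (l - c))"
        unfolding a_def b_def qpi_power
        by (rule arg_cong[where f = "\<lambda>l. qpi t l"], simp add: algebra_simps)+
      have "of_int (sg e) * qdiff t * h_value t i (sg e * int m) u =
          (qpi t (sg e * int m) - qpi t (- (sg e * int m))) * (of_int c * qpi t (sg e * int m * l)) / of_nat m"
        using qdiff_nonzero by (cases e) (simp_all add: h_value_def level_sum_sole[OF assms(1)] qint_def)
      also have "\<dots> = (a ^ m - b ^ m) / of_nat m"
      proof -
        have "(qpi t (sg e * int m) - qpi t (- (sg e * int m))) * qpi t (sg e * int m * l) =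
          qpi t (sg e * int m * (l + 1)) - qpi t (sg e * int m * (l - 1))"
          unfolding left_diff_distrib qpi_mult
          by (rule arg_cong2[where f = "\<lambda>k l. qpi t k - qpi t l"]) (simp_all add: algebra_simps)
        then show ?thesis
          unfolding ab using assms(2) by (auto simp: mult_ac)
      qed
      finally show ?thesis using False by (simp add: log_series_def)
    qed (simp add: log_series_def)
  qed
  then show ?thesis by (simp add: cexpn_log_ratio phi_series_def a_def b_def)
qed

text \<open>
  Since \<open>\<phi>\<^sup>\<plusminus>\<^sub>i(z)\<close> determines the \<open>h\<^bsub>i,m\<^esub>\<close>, a joint eigenvector of the former whose eigenvalues
  belong to a thin monomial is an eigenvector of the latter.
\<close>

lemma (in quantum_module) H_eigenvalue_of_monomial:
  assumes q: "generic_parameter t" and v: "v \<in> carrier W" and i: "i \<in> idx R" and m: "m \<noteq> 0"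
    and c: "sole_at i c l u" "c \<in> {-1, 0, 1}"
    and K: "\<And>e. opr (gn (K (single (Hc i) (of_int (sg e))))) v = opr (cst (qpi t (sg e * c))) v"
    and phi: "\<And>e k. opr (phi_elt t e i (sg e * int k)) v = opr (cst (fps_nth (phi_series t e c l) k)) v"
  shows "opr (gn (H i m)) v = opr (cst (h_value t i m u)) v"
proof -
  interpret generic_parameter t by (rule q)
  let ?L = "{a \<in> falg R. opr a v = \<zero>\<^bsub>W\<^esub>}"
  interpret L: quantum_left_ideal R t ?L by (rule annihilator_left_ideal[OF v])
  have eigen: "L.cong_L a (cst z) \<longleftrightarrow> opr a v = opr (cst z) v" if "a \<in> falg R" for a z
    using that by (simp add: L.cong_L_def opr_diff_eq_zero_iff v falg_diff)
  define e where "e = (if m > 0 then Pos else Neg)"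
  have m': "m = sg e * int (nat \<bar>m\<bar>)" "nat \<bar>m\<bar> > 0" using m by (auto simp: e_def)
  have K': "L.cong_L (gn (K (single (Hc i) (of_int (sg e))))) (cst (qpi t (sg e * c)))"
    using K by (subst eigen) (auto intro: falg_gn cart_coroot i)
  have "L.cong_L (gn (H i (sg e * int (nat \<bar>m\<bar>)))) (cst (h_value t i (sg e * int (nat \<bar>m\<bar>)) u))"
  proof (rule L.H_eigenvalue_of_phi[OF i qdiff_nonzero _ K' _ m'(2)])
    fix k
    have "fps_nth (phi_series t e c l) k = qpi t (sg e * c) *
        fps_nth (cexpn (log_series t e (\<lambda>m. h_value t i (sg e * int m) u))) k"
      unfolding phi_series_eq_cexpn[OF c, of e, symmetric] by (rule fps_mult_left_const_nth)
    then show "L.cong_L (phi_elt t e i (sg e * int k)) (cst (qpi t (sg e * c) *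
        fps_nth (cexpn (log_series t e (\<lambda>m. h_value t i (sg e * int m) u))) k))"
      using phi[of e k] by (subst eigen) (simp_all only: falg_phi_elt i)
  qed simp
  then have "L.cong_L (gn (H i m)) (cst (h_value t i m u))" unfolding m'(1)[symmetric] .
  then show ?thesis by (subst (asm) eigen) (rule falg_gn(3)[OF i m])
qed

section \<open>Crystals of thin monomials carry a module structure\<close>

lemma pairing_superset:
  "finite A \<Longrightarrow> keys h \<subseteq> A \<Longrightarrow>
     pairing \<omega> h = (\<Sum>b\<in>A. lookup \<omega> b * lookup h b)"
  unfolding pairing_def by (rule sum.mono_neutral_left) (auto simp: in_keys_iff)

lemma pairing_add_left: "pairing (\<omega> + \<omega>') h = pairing \<omega> h + pairing \<omega>' h"
  and pairing_diff_left: "pairing (\<omega> - \<omega>') h = pairing \<omega> h - pairing \<omega>' h"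
  by (simp_all add: pairing_def lookup_add lookup_minus distrib_right left_diff_distrib
      sum.distrib sum_subtractf)

lemma pairing_zero_right [simp]: "pairing \<omega> 0 = 0"
  by (simp add: pairing_def)

lemma pairing_add_right: "pairing \<omega> (h + h') = pairing \<omega> h + pairing \<omega> h'"
proof -
  let ?A = "keys h \<union> keys h'"
  have "pairing \<omega> g = (\<Sum>b\<in>?A. lookup \<omega> b * lookup g b)"
    if "g \<in> {h, h', h + h'}" for g
    by (rule pairing_superset) (use that keys_add[of h h'] in auto)
  then show ?thesis by (simp add: lookup_add distrib_left sum.distrib)
qed

lemma pairing_minus_right: "pairing \<omega> (- h) = - pairing \<omega> h"
  using pairing_add_right[of \<omega> h "- h"] by simp

lemma pairing_single: "pairing \<omega> (single b c) = lookup \<omega> b * c"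
  by (subst pairing_superset[of "{b}"]) auto

lemma (in simply_laced) level_sum_root:
  assumes ij: "i \<in> idx R" "j \<in> idx R"
  shows "level_sum j g (Yv i (l - 1) + Yv i (l + 1) - (\<Sum>j\<in>{j \<in> idx R. cmat R i j = -1}. Yv j l))
    = (if i = j then g (l - 1) + g (l + 1) else if cmat R i j = -1 then - g l else 0)"
proof -
  have "(\<Sum>k\<in>{k \<in> idx R. cmat R i k = -1}. level_sum j g (Yv k l))
      = (\<Sum>k\<in>{k \<in> idx R. cmat R i k = -1}. if k = j then g l else 0)"
    by (intro sum.cong) (auto simp: level_sum_Yv)
  also have "\<dots> = (if cmat R i j = -1 then g l else 0)"
    using ij finite_idx by (subst sum.delta) auto
  finally show ?thesis using ij cmat_diag[of i]
    by (auto simp: level_sum_add level_sum_diff level_sum_sum level_sum_Yv)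
qed

text \<open>
  The common description of the two monomial crystals. The elements may carry a weight in addition to
  the exponents, and the variables \<open>A\<^bsub>i,l\<^esub>\<close> are determined by the Cartan matrix.
\<close>

locale monomial_crystal = simply_laced R for R +
  fixes C :: "'m::ab_group_add mcrystal" and A :: "nat \<Rightarrow> int \<Rightarrow> 'm"
  assumes ind: "ind C = idx R"
    and etil_eq: "i \<in> idx R \<Longrightarrow> etil C i m =
      (if veps i (expo C m) = 0 then None else Some (m + A i (p_pos i (expo C m) - 1)))"
    and ftil_eq: "i \<in> idx R \<Longrightarrow> ftil C i m =
      (if vphi i (expo C m) = 0 then None else Some (m - A i (q_pos i (expo C m) + 1)))"
    and expo_add: "expo C (m + m') = expo C m + expo C m'"
    and expo_A: "i \<in> idx R \<Longrightarrow> expo C (A i l) =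
      Yv i (l - 1) + Yv i (l + 1) - (\<Sum>j\<in>{j \<in> idx R. cmat R i j = -1}. Yv j l)"
    and wt_add: "wt C (m + m') = wt C m + wt C m'"
    and wt_A: "i \<in> idx R \<Longrightarrow> wt C (A i l) = simple_root R i"
begin

lemma expo_diff: "expo C (m - m') = expo C m - expo C m'"
  using expo_add[of "m - m'" m'] by simp

lemma wt_diff: "wt C (m - m') = wt C m - wt C m'"
  using wt_add[of "m - m'" m'] by simp

lemma expo_A_self: "i \<in> idx R \<Longrightarrow>
    expon (expo C (A i l)) i l' = (if l' = l - 1 \<or> l' = l + 1 then 1 else 0)"
proof -
  assume i: "i \<in> idx R"
  then have "(\<Sum>j\<in>{j \<in> idx R. cmat R i j = -1}. expon (Yv j l) i l') = 0"
    using cmat_diag[of i] by (intro sum.neutral) (auto simp: expon_Yv)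
  with i show ?thesis by (simp add: expo_A lookup_add lookup_minus lookup_sum) (simp add: expon_Yv)
qed

lemma expo_A_other: "i \<in> idx R \<Longrightarrow> j \<in> idx R \<Longrightarrow> i \<noteq> j \<Longrightarrow>
    expon (expo C (A i l)) j l' = (if cmat R i j = -1 \<and> l' = l then -1 else 0)"
proof -
  assume ij: "i \<in> idx R" "j \<in> idx R" "i \<noteq> j"
  have "(\<Sum>k\<in>{k \<in> idx R. cmat R i k = -1}. expon (Yv k l) j l')
      = (\<Sum>k\<in>{k \<in> idx R. cmat R i k = -1}. if k = j then (if l' = l then 1 else 0) else 0)"
    by (intro sum.cong) (auto simp: expon_Yv)
  also have "\<dots> = (if cmat R i j = -1 \<and> l' = l then 1 else 0)"
    using ij finite_idx by (subst sum.delta) auto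
  finally show ?thesis using ij by (auto simp: expo_A lookup_add lookup_minus lookup_sum expon_Yv)
qed

lemma level_sum_A: "i \<in> idx R \<Longrightarrow> j \<in> idx R \<Longrightarrow>
    level_sum j g (expo C (A i l)) =
      (if i = j then g (l - 1) + g (l + 1) else if cmat R i j = -1 then - g l else 0)"
  by (simp only: expo_A level_sum_root)

end

text \<open>
  A subcrystal on which every variable family \<open>(Y\<^bsub>i,l\<^esub>)\<^sub>l\<close> occurs with total multiplicity at most
  one. In this situation each defining relation involves at most two neighbouring nodes and reduces
  to a comparison of levels.
\<close>

locale thin_crystal = monomial_crystal R C A + generic_parameter t
  for R t and C :: "'m::ab_group_add mcrystal" and A +
  fixes S :: "'m set"
  assumes wt_coroot: "m \<in> S \<Longrightarrow> i \<in> idx R \<Longrightarrow> pairing (wt C m) (hvec i) = of_int (total_expon (expo C m) i)"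
    and thin: "m \<in> S \<Longrightarrow> i \<in> idx R \<Longrightarrow> thin_at i (expo C m)"
    and etil_closed: "m \<in> S \<Longrightarrow> i \<in> idx R \<Longrightarrow> etil C i m = Some m' \<Longrightarrow> m' \<in> S"
    and ftil_closed: "m \<in> S \<Longrightarrow> i \<in> idx R \<Longrightarrow> ftil C i m = Some m' \<Longrightarrow> m' \<in> S"
begin

text \<open>
  The two families of operators are treated together: \<open>move Pos i\<close> is \<open>e\<^sub>i\<close>, \<open>move Neg i\<close> is
  \<open>f\<^sub>i\<close>, and \<open>pos e i m\<close> is the level of the variable \<open>A\<^bsub>i,l\<^esub>\<close> by which \<open>move e i\<close> multiplies
  or divides \<open>m\<close>.
\<close>

definition move :: "sgn \<Rightarrow> nat \<Rightarrow> 'm \<Rightarrow> 'm option" where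
  "move e i m = (case e of Pos \<Rightarrow> etil C i m | Neg \<Rightarrow> ftil C i m)"

definition pos :: "sgn \<Rightarrow> nat \<Rightarrow> 'm \<Rightarrow> int" where
  "pos e i m = (case e of Pos \<Rightarrow> p_pos i (expo C m) - 1 | Neg \<Rightarrow> q_pos i (expo C m) + 1)"

definition signed :: "sgn \<Rightarrow> 'm \<Rightarrow> 'm" where
  "signed e a = (case e of Pos \<Rightarrow> a | Neg \<Rightarrow> - a)"

fun opposite :: "sgn \<Rightarrow> sgn" where
  "opposite Pos = Neg" | "opposite Neg = Pos"

lemma sg_opposite [simp]: "sg (opposite e) = - sg e"
  by (cases e) auto

lemma sg_cases: "sg e = 1 \<or> sg e = -1"
  by (cases e) auto

lemma thinE:
  assumes "m \<in> S" "i \<in> idx R"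
  obtains c l where "sole_at i c l (expo C m)" "c = 0 \<or> c = sg e \<or> c = - sg e"
  using thin[OF assms] sg_cases[of e] unfolding thin_at_def by force

lemma expo_signed: "expon (expo C (m + signed e a)) j l = expon (expo C m) j l + sg e * expon (expo C a) j l"
  by (cases e) (simp_all add: signed_def expo_add expo_diff lookup_add lookup_minus)

lemma wt_signed: "pairing (wt C (m + signed e a)) h = pairing (wt C m) h + of_int (sg e) * pairing (wt C a) h"
  by (cases e) (simp_all add: signed_def wt_add wt_diff pairing_add_left pairing_diff_left)

lemma move_None:
  assumes "i \<in> idx R" "sole_at i c l (expo C m)" "c = 0 \<or> c = sg e"
  shows "move e i m = None"
  using assms by (cases e) (auto simp: move_def etil_eq ftil_eq veps_sole vphi_sole)

lemma move_Some:
  assumes "i \<in> idx R" "sole_at i (- sg e) l (expo C m)"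
  shows "move e i m = Some (m + signed e (A i (l - sg e)))" "pos e i m = l - sg e"
  using assms
  by (cases e; simp add: move_def pos_def signed_def etil_eq ftil_eq veps_sole vphi_sole
      q_pos_sole p_pos_sole)+

lemma move_SomeE:
  assumes "m \<in> S" "i \<in> idx R" "move e i m = Some m'"
  obtains l where "sole_at i (- sg e) l (expo C m)" "pos e i m = l - sg e"
    "m' = m + signed e (A i (l - sg e))"
proof -
  obtain c l where c: "sole_at i c l (expo C m)" "c = 0 \<or> c = sg e \<or> c = - sg e"
    by (rule thinE[OF assms(1,2)])
  then have "c = - sg e" using move_None[OF assms(2) c(1)] assms(3) by auto
  with c(1) show thesis using that[of l] move_Some[OF assms(2), of e l m] assms(3) by auto
qed

lemma move_closed: "m \<in> S \<Longrightarrow> i \<in> idx R \<Longrightarrow> move e i m = Some m' \<Longrightarrow> m' \<in> S"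
  by (cases e) (auto simp: move_def dest: etil_closed ftil_closed)

text \<open>
  The two factors \<open>Y\<^bsub>i,l-1\<^esub> Y\<^bsub>i,l+1\<^esub>\<close> of \<open>A\<^bsub>i,l\<^esub>\<close> replace \<open>Y\<^bsub>i,l-1\<^esub>\<close> by \<open>Y\<^bsub>i,l+1\<^esub>\<^sup>-\<^sup>1\<close> or conversely. The new
  variable selects the same \<open>A\<^bsub>i,l\<^esub>\<close> for the opposite operator.
\<close>

lemma move_self:
  assumes "m \<in> S" "i \<in> idx R" "move e i m = Some m'"
  shows "sole_at i (sg e) (pos e i m - sg e) (expo C m')"
proof -
  obtain l where l: "sole_at i (- sg e) l (expo C m)" "pos e i m = l - sg e"
    "m' = m + signed e (A i (l - sg e))" by (rule move_SomeE[OF assms])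
  show ?thesis unfolding sole_at_def l(2,3) expo_signed expo_A_self[OF assms(2)]
    using l(1) sg_cases[of e] by (auto simp: sole_at_def)
qed

lemma move_back:
  assumes "m \<in> S" "i \<in> idx R" "move e i m = Some m'"
  shows "move (opposite e) i m' = Some m" "pos (opposite e) i m' = pos e i m"
proof -
  obtain l where l: "sole_at i (- sg e) l (expo C m)" "pos e i m = l - sg e"
    "m' = m + signed e (A i (l - sg e))" by (rule move_SomeE[OF assms])
  have "sole_at i (- sg (opposite e)) (l - 2 * sg e) (expo C m')"
    using move_self[OF assms] l(2) by simp
  note moved = move_Some[OF assms(2) this]
  have level: "l - 2 * sg e - sg (opposite e) = l - sg e" by simp
  have "signed (opposite e) a = - signed e a" for a by (cases e) (simp_all add: signed_def)
  then show "move (opposite e) i m' = Some m" using moved(1) unfolding level by (simp add: l(3))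
  show "pos (opposite e) i m' = pos e i m" using moved(2) unfolding level l(2) .
qed

lemma move_twice:
  assumes "m \<in> S" "i \<in> idx R" "move e i m = Some m'"
  shows "move e i m' = None"
  using move_None[OF assms(2) move_self[OF assms]] by simp

text \<open>
  The effect of a move at \<open>j\<close> on a neighbouring node \<open>i\<close>: either \<open>i\<close> was unoccupied and becomes ready
  for the same move one level further, or the new variable cancels the one present at \<open>i\<close>. Every other
  possibility would violate thinness.
\<close>

lemma move_neighbour:
  assumes m: "m \<in> S" and ij: "i \<in> idx R" "j \<in> idx R" "cmat R i j = -1" and mv: "move e j m = Some m'"
  shows "sole_at i 0 0 (expo C m) \<and> sole_at i (- sg e) (pos e j m) (expo C m') \<or>
         sole_at i (sg e) (pos e j m) (expo C m) \<and> sole_at i 0 0 (expo C m')"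
proof -
  have ne: "i \<noteq> j" using ij cmat_diag by auto
  have sym: "cmat R j i = -1" using ij cmat_sym by simp
  obtain l where l: "pos e j m = l - sg e" "m' = m + signed e (A j (l - sg e))"
    by (rule move_SomeE[OF m ij(2) mv])
  have ch: "expon (expo C m') i l' = expon (expo C m) i l' - (if l' = pos e j m then sg e else 0)" for l'
    using ne sym by (simp add: l expo_signed expo_A_other ij)
  obtain c k where c: "sole_at i c k (expo C m)" "c = 0 \<or> c = sg e \<or> c = - sg e"
    by (rule thinE[OF m ij(1)])
  obtain c' k' where c': "sole_at i c' k' (expo C m')" "c' = 0 \<or> c' = sg e \<or> c' = - sg e"
    by (rule thinE[OF move_closed[OF m ij(2) mv] ij(1)])
  have eq: "(if l' = k' then c' else 0) = (if l' = k then c else 0) - (if l' = pos e j m then sg e else 0)" for l'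
    using ch[of l'] c(1) c'(1) by (simp add: sole_at_def)
  consider "c = 0" | "c = sg e" "k = pos e j m" | "c = sg e" "k \<noteq> pos e j m" | "c = - sg e"
    using c by blast
  then show ?thesis
  proof cases
    case 1
    then show ?thesis using c(1) ch by (auto simp: sole_at_def)
  next
    case 2
    then show ?thesis using c(1) ch by (auto simp: sole_at_def)
  next
    case 3
    then show ?thesis using eq[of k] eq[of "pos e j m"] sg_cases[of e] c'(2) by (auto split: if_splits)
  next
    case 4
    then show ?thesis using eq[of k] eq[of "pos e j m"] sg_cases[of e] c'(2) by (auto split: if_splits)
  qed
qed

lemma neighbour_opposite:
  assumes "m \<in> S" "i \<in> idx R" "j \<in> idx R" "cmat R i j = -1" "move e j m = Some m'"
  shows "move (opposite e) i m' = None"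
  using move_neighbour[OF assms] move_None[OF assms(2), of 0 0 m' "opposite e"]
    move_None[OF assms(2), of "- sg e" "pos e j m" m' "opposite e"] by auto

text \<open>The comparison of levels behind the quadratic relation between neighbouring nodes.\<close>

lemma neighbour_level:
  assumes "m \<in> S" "i \<in> idx R" "j \<in> idx R" "cmat R i j = -1" "move e j m = Some m'" "move e i m' = Some m''"
  shows "pos e i m' = pos e j m - sg e"
  using move_neighbour[OF assms(1-5)] move_None[OF assms(2), of 0 0 m' e] assms(6)
    move_Some(2)[OF assms(2), of e "pos e j m" m'] by auto

text \<open>
  The term \<open>x\<^sub>i x\<^sub>j x\<^sub>i\<close> of the Serre relation vanishes: after the first move the node \<open>i\<close> is occupied,
  so the move at \<open>j\<close> cancels its variable.
\<close>

lemma neighbour_between: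
  assumes "m \<in> S" "i \<in> idx R" "j \<in> idx R" "cmat R i j = -1"
    and "move e i m = Some m'" "move e j m' = Some m''"
  shows "move e i m'' = None"
proof -
  have m': "m' \<in> S" by (rule move_closed[OF assms(1,2,5)])
  have "sole_at i (sg e) (pos e i m - sg e) (expo C m')"
    by (rule move_self[OF assms(1,2,5)])
  then have "\<not> sole_at i 0 0 (expo C m')"
    using sole_at_unique sg_cases[of e] by fastforce
  then have "sole_at i 0 0 (expo C m'')"
    using move_neighbour[OF m' assms(2-4,6)] by auto
  then show ?thesis using move_None[OF assms(2)] by blast
qed

text \<open>
  The variable \<open>A\<^bsub>j,l\<^esub>\<close> has no factor at a node \<open>i\<close> that is neither \<open>j\<close> nor adjacent to it, so the
  \<open>i\<close>-th part of the monomial, which alone decides about moves at \<open>i\<close>, is the same before and after.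
\<close>

lemma move_distant:
  assumes m: "m \<in> S" and ij: "i \<in> idx R" "j \<in> idx R" "i \<noteq> j" "cmat R i j = 0"
    and mv: "move e j m = Some m'"
  shows "pos e' i m' = pos e' i m"
    and "move e' i m' = map_option (\<lambda>n. n + (m' - m)) (move e' i m)"
proof -
  have sym: "cmat R j i = 0" using ij cmat_sym by simp
  obtain l where l: "m' = m + signed e (A j (l - sg e))"
    by (rule move_SomeE[OF m ij(2) mv])
  have ch: "expon (expo C m') i l' = expon (expo C m) i l'" for l'
    using ij sym by (simp add: l expo_signed expo_A_other)
  obtain c k where c: "sole_at i c k (expo C m)" "c = 0 \<or> c = sg e' \<or> c = - sg e'"
    by (rule thinE[OF m ij(1)])
  then have c': "sole_at i c k (expo C m')" by (simp add: sole_at_def ch)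
  have same: "vphi_upto i L (expo C m') = vphi_upto i L (expo C m)"
    "veps_from i L (expo C m') = veps_from i L (expo C m)" for L
    by (simp_all add: vphi_upto_sole[OF c'] vphi_upto_sole[OF c(1)] veps_from_sole[OF c'] veps_from_sole[OF c(1)])
  show "pos e' i m' = pos e' i m"
    by (simp add: pos_def p_pos_def q_pos_def veps_def vphi_def same split: sgn.split)
  show "move e' i m' = map_option (\<lambda>n. n + (m' - m)) (move e' i m)"
  proof (cases "c = - sg e'")
    case True
    show ?thesis using move_Some(1)[OF ij(1), of e' k] c(1) c' True by (simp add: algebra_simps)
  next
    case False
    then show ?thesis using move_None[OF ij(1)] c c' by (metis option.map(1))
  qed
qed

subsection \<open>The action of the generators\<close>

fun gen_act :: "qgen \<Rightarrow> 'm \<Rightarrow> ('m \<Rightarrow>\<^sub>0 complex)" where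
  "gen_act (X e i r) m = vscale (qpi t (r * pos e i m)) (bvec (move e i m))"
| "gen_act (K h) m = vscale (qpow t (pairing (wt C m) h)) (bvec (Some m))"
| "gen_act (H i k) m = vscale (h_value t i k (expo C m)) (bvec (Some m))"

abbreviation act :: "freealg \<Rightarrow> ('m \<Rightarrow>\<^sub>0 complex) \<Rightarrow> ('m \<Rightarrow>\<^sub>0 complex)" where
  "act \<equiv> alg_act gen_act"

lemma act_vscale: "act a (vscale c x) = vscale c (act a x)"
  by (rule linear_mapD(2)[OF linear_alg_act])

lemma act_gn_single [simp]: "act (gn g) (single m c) = vscale c (gen_act g m)"
  by (simp add: alg_act_gn)

definition xvec :: "sgn \<Rightarrow> nat \<Rightarrow> int \<Rightarrow> 'm option \<Rightarrow> ('m \<Rightarrow>\<^sub>0 complex)" where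
  "xvec e i r om = act (gn (X e i r)) (bvec om)"

lemma xvec_simps [simp]:
  "xvec e i r None = 0"
  "xvec e i r (Some m) = vscale (qpi t (r * pos e i m)) (bvec (move e i m))"
  by (simp_all add: xvec_def)

lemma bvec_closed: "(\<And>m. om = Some m \<Longrightarrow> m \<in> S) \<Longrightarrow> bvec om \<in> crystal_space S"
  by (cases om) (auto intro: crystal_space_single)

lemma gen_closed:
  assumes "g \<in> gens R" "m \<in> S"
  shows "gen_act g m \<in> crystal_space S"
  using assms(1) unfolding gens_def
  by (auto simp: assms(2) intro!: crystal_space_vscale bvec_closed crystal_space_single
      intro: move_closed[OF assms(2)])

text \<open>
  Eigenvalues of \<open>\<phi>\<^sup>\<plusminus>\<^sub>i\<close> are computed modulo the left ideal that annihilates the basis vector. At this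
  stage the relators are not yet known to act by zero.
\<close>

lemma annihilator_free_left_ideal:
  "free_left_ideal R {a. act a x = 0}"
  by unfold_locales (simp_all add: alg_act_add alg_act_mult)

lemma coroot_eigenvalue:
  assumes "m \<in> S" "i \<in> idx R" "sole_at i c l (expo C m)"
  shows "pairing (wt C m) (single (Hc i) (of_int (sg e))) = of_int (sg e * c)"
  using wt_coroot[OF assms(1,2)] level_sum_sole[OF assms(3), of "\<lambda>_. 1 :: int"]
  by (simp add: hvec_def pairing_single total_expon_level_sum)

lemma phi_act:
  assumes m: "m \<in> S" and i: "i \<in> idx R" and c: "sole_at i c l (expo C m)" "c \<in> {-1, 0, 1}"
  shows "act (phi_elt t e i (sg e * int k)) (bvec (Some m)) = vscale (fps_nth (phi_series t e c l) k) (bvec (Some m))"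
proof -
  let ?L = "{a. act a (bvec (Some m)) = 0}"
  interpret L: free_left_ideal R ?L by (rule annihilator_free_left_ideal)
  have eigen: "L.cong_L a (cst z) \<longleftrightarrow> act a (bvec (Some m)) = vscale z (bvec (Some m))" for a z
    unfolding L.cong_L_def by (simp add: alg_act_diff alg_act_cst)
  have K: "L.cong_L (gn (K (single (Hc i) (of_int (sg e))))) (cst (qpi t (sg e * c)))"
    unfolding eigen by (simp add: coroot_eigenvalue[OF m i c(1)])
  have "L.cong_L (phi_elt t e i (sg e * int k))
      (cst (qpi t (sg e * c) * fps_nth (cexpn (log_series t e (\<lambda>k. h_value t i (sg e * int k) (expo C m)))) k))"
    by (rule L.phi_eigenvalue[OF i K]) (unfold eigen, simp)
  then show ?thesis
    unfolding phi_series_eq_cexpn[OF c, symmetric] eigen by simp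
qed

text \<open>
  The series \<open>\<phi>\<^sup>+\<^sub>i\<close> and \<open>\<phi>\<^sup>-\<^sub>i\<close> are expansions of the same rational function at \<open>0\<close> and \<open>\<infinity>\<close>. Their
  difference is a multiple of a delta function at its only pole.
\<close>

lemma phi_difference_act:
  assumes m: "m \<in> S" and i: "i \<in> idx R" and c: "sole_at i c l (expo C m)" "c \<in> {-1, 0, 1}"
  shows "act (cst (1 / qdiff t) * (phi_elt t Pos i k - phi_elt t Neg i k)) (bvec (Some m))
    = vscale (of_int c * qpi t (k * (l + c))) (bvec (Some m))"
proof -
  let ?v = "bvec (Some m)"
  consider "k = 0" | "k > 0" | "k < 0" by linarith
  then show ?thesis
  proof cases
    case 1
    have "act (phi_elt t Pos i k - phi_elt t Neg i k) ?v = vscale (qpi t c - qpi t (- c)) ?v"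
      using phi_act[OF m i c, of Pos 0] phi_act[OF m i c, of Neg 0] 1 c(2)
      by (simp add: alg_act_diff phi_series_nth vscale_diff_left del: bvec.simps)
    moreover have "qpi t c - qpi t (- c) = of_int c * qdiff t"
      using c(2) by (auto simp: qdiff_def)
    ultimately show ?thesis
      using 1 qdiff_nonzero by (simp add: alg_act_mult alg_act_cst del: bvec.simps)
  next
    case 2
    have "phi_elt t Neg i k = 0" using 2 by (simp add: phi_elt_def)
    then show ?thesis
      using phi_act[OF m i c, of Pos "nat k"] 2 c(2) qdiff_nonzero
      by (simp add: alg_act_mult alg_act_cst phi_series_nth del: bvec.simps)
  next
    case 3
    have "phi_elt t Pos i k = 0" using 3 by (simp add: phi_elt_def)
    then show ?thesis
      using phi_act[OF m i c, of Neg "nat (- k)"] 3 c(2) qdiff_nonzero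
      by (simp add: alg_act_mult alg_act_cst alg_act_uminus phi_series_nth
          vscale_minus_left vscale_minus_right del: bvec.simps)
  qed
qed

text \<open>
  The weighted exponent sum of \<open>A\<^bsub>j,l\<^esub>\<close> at \<open>i\<close> is \<open>q\<^bsup>kl\<^esup>\<close> times \<open>q\<^sup>k + q\<^bsup>-k\<^esup>\<close>, \<open>-1\<close> or \<open>0\<close> according
  to the Cartan integer, and multiplied by \<open>[k]\<close> this gives \<open>[k C\<^bsub>i,j\<^esub>]\<close> in each case.
\<close>

lemma h_value_move:
  assumes "m \<in> S" "i \<in> idx R" "j \<in> idx R" "k \<noteq> 0" "move e j m = Some m'"
  shows "h_value t i k (expo C m') - h_value t i k (expo C m)
    = of_int (sg e) * (1 / of_int k) * qint t (k * cmat R i j) * qpi t (k * pos e j m)"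
proof -
  obtain l where l: "pos e j m = l - sg e" "m' = m + signed e (A j (l - sg e))"
    by (rule move_SomeE[OF assms(1,3,5)])
  let ?g = "\<lambda>l. qpi t (k * l)"
  have "level_sum i ?g (expo C m') = level_sum i ?g (expo C m) + of_int (sg e) * level_sum i ?g (expo C (A j (pos e j m)))"
    unfolding l by (cases e) (simp_all add: signed_def expo_add expo_diff level_sum_add level_sum_diff)
  then have "h_value t i k (expo C m') - h_value t i k (expo C m)
      = of_int (sg e) * (1 / of_int k) * (qint t k * level_sum i ?g (expo C (A j (pos e j m))))"
    by (simp add: h_value_def algebra_simps)
  also have "qint t k * level_sum i ?g (expo C (A j (pos e j m))) = qint t (k * cmat R i j) * ?g (pos e j m)"
  proof -
    define p where "p = pos e j m"
    consider "i = j" | "i \<noteq> j" "cmat R i j = -1" | "i \<noteq> j" "cmat R i j = 0"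
      using cmat_off_diag[OF assms(2,3)] by blast
    then show ?thesis unfolding p_def[symmetric]
    proof cases
      case 1
      have "(qpi t k - qpi t (- k)) * (?g (p - 1) + ?g (p + 1)) = (qpi t (k * 2) - qpi t (- (k * 2))) * ?g p"
        unfolding distrib_left left_diff_distrib qpi_mult
        by (simp only: algebra_simps) (simp add: mult.commute add.commute)
      then show "qint t k * level_sum i ?g (expo C (A j p)) = qint t (k * cmat R i j) * ?g p"
        using 1 assms cmat_diag by (simp add: level_sum_A qint_def)
    next
      case 2
      then show "qint t k * level_sum i ?g (expo C (A j p)) = qint t (k * cmat R i j) * ?g p"
        using assms cmat_sym[of i j] by (simp add: level_sum_A qint_def diff_divide_distrib algebra_simps)
    next
      case 3
      then show "qint t k * level_sum i ?g (expo C (A j p)) = qint t (k * cmat R i j) * ?g p"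
        using assms cmat_sym[of i j] by (simp add: level_sum_A qint_def)
    qed
  qed
  finally show ?thesis by (simp only: mult.assoc)
qed

lemma act_XX:
  "act (gn (X e i r) * gn (X e' j r')) (bvec (Some m)) = vscale (qpi t (r' * pos e' j m)) (xvec e i r (move e' j m))"
  by (simp add: alg_act_mult act_vscale xvec_def)

lemma act_X_distant_commute:
  assumes m: "m \<in> S" and ij: "i \<in> idx R" "j \<in> idx R" "i \<noteq> j" "cmat R i j = 0"
  shows "act (gn (X e i r) * gn (X e' j r')) (bvec (Some m)) = act (gn (X e' j r') * gn (X e i r)) (bvec (Some m))"
proof -
  have ji: "j \<noteq> i" "cmat R j i = 0" using ij cmat_sym by auto
  note distant = move_distant[OF m ij] move_distant[OF m ij(2,1) ji]
  show ?thesis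
  proof (cases "move e i m"; cases "move e' j m")
    fix a b assume ab: "move e i m = Some a" "move e' j m = Some b"
    have "a + (b - m) = b + (a - m)" by simp
    with distant(1,2)[OF ab(2), of e] distant(3,4)[OF ab(1), of e'] ab show ?thesis
      unfolding act_XX by (simp add: mult.commute)
  next
    fix a assume "move e i m = Some a" "move e' j m = None"
    then show ?thesis unfolding act_XX using distant(4)[of e a e'] by simp
  next
    fix b assume "move e i m = None" "move e' j m = Some b"
    then show ?thesis unfolding act_XX using distant(2)[of e' b e] by simp
  qed (unfold act_XX, simp)
qed

lemma act_XX_neighbour_opposite:
  assumes "m \<in> S" "i \<in> idx R" "j \<in> idx R" "cmat R i j = -1"
  shows "act (gn (X (opposite e) i r) * gn (X e j r')) (bvec (Some m)) = 0"
  unfolding act_XX using neighbour_opposite[OF assms] by (cases "move e j m") auto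

lemma act_XX_self: "m \<in> S \<Longrightarrow> i \<in> idx R \<Longrightarrow> act (gn (X e i r) * gn (X e i r')) (bvec (Some m)) = 0"
  unfolding act_XX using move_twice by (cases "move e i m") auto

subsection \<open>The defining relations\<close>

lemma wt_move:
  assumes "m \<in> S" "i \<in> idx R" "move e i m = Some m'"
  shows "pairing (wt C m') h = pairing (wt C m) h + of_int (sg e) * pairing (simple_root R i) h"
proof -
  obtain l where "m' = m + signed e (A i (l - sg e))" by (rule move_SomeE[OF assms])
  then show ?thesis by (simp add: wt_signed wt_A assms(2))
qed

lemma act_k_x:
  assumes "m \<in> S" "j \<in> idx R"
  shows "act (gn (K h) * gn (X e j r) * gn (K (- h))
     - cst (qpow t (of_int (sg e) * pairing (simple_root R j) h)) * gn (X e j r)) (bvec (Some m)) = 0"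
proof (cases "move e j m")
  case None
  then show ?thesis by (simp add: alg_act_diff alg_act_mult alg_act_cst)
next
  case (Some m')
  let ?a = "qpow t (pairing (wt C m') h)" and ?b = "qpow t (pairing (wt C m) (- h))"
    and ?x = "qpi t (r * pos e j m)" and ?z = "qpow t (of_int (sg e) * pairing (simple_root R j) h)"
  have "?a * ?b = ?z"
    by (simp add: wt_move[OF assms Some] pairing_minus_right flip: qpow_add)
  then have z: "?b * ?x * ?a = ?z * ?x" by (metis mult.assoc mult.commute)
  have "act (gn (K h) * gn (X e j r) * gn (K (- h))) (bvec (Some m)) = vscale (?b * ?x * ?a) (bvec (Some m'))"
    by (simp add: alg_act_mult Some)
  moreover have "act (cst ?z * gn (X e j r)) (bvec (Some m)) = vscale (?z * ?x) (bvec (Some m'))"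
    by (simp add: alg_act_mult alg_act_cst Some)
  ultimately show ?thesis unfolding alg_act_diff z by simp
qed

lemma act_h_x:
  assumes "m \<in> S" "i \<in> idx R" "j \<in> idx R" "k \<noteq> 0"
  shows "act (gn (H i k) * gn (X e j r) - gn (X e j r) * gn (H i k)
     - cst (of_int (sg e) * (1 / of_int k) * qint t (k * cmat R i j)) * gn (X e j (k + r))) (bvec (Some m)) = 0"
proof (cases "move e j m")
  case None
  then show ?thesis by (simp add: alg_act_diff alg_act_mult alg_act_cst)
next
  case (Some m')
  let ?p = "pos e j m" and ?c = "of_int (sg e) * (1 / of_int k) * qint t (k * cmat R i j)"
  have "qpi t (r * ?p) * h_value t i k (expo C m') - h_value t i k (expo C m) * qpi t (r * ?p)
      = qpi t (r * ?p) * (h_value t i k (expo C m') - h_value t i k (expo C m))"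
    by (simp add: algebra_simps)
  also have "\<dots> = ?c * (qpi t (k * ?p) * qpi t (r * ?p))"
    unfolding h_value_move[OF assms Some] by (simp only: mult_ac)
  also have "qpi t (k * ?p) * qpi t (r * ?p) = qpi t ((k + r) * ?p)"
    unfolding qpi_mult by (simp only: distrib_right)
  finally have "single m' (qpi t (r * ?p) * h_value t i k (expo C m') - h_value t i k (expo C m) * qpi t (r * ?p))
      = single m' (?c * qpi t ((k + r) * ?p))" by (rule arg_cong)
  then show ?thesis
    by (simp add: alg_act_diff alg_act_mult alg_act_cst Some single_diff del: of_int_add of_int_mult)
qed

text \<open>
  For \<open>i = j\<close> at most one of the two products is nonzero, and it returns to the starting vector at the
  level of the pole of \<open>\<phi>\<^sub>i\<close>. For neighbours both products vanish.
\<close>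

lemma act_x_plus_minus:
  assumes m: "m \<in> S" and ij: "i \<in> idx R" "j \<in> idx R"
  shows "act (gn (X Pos i r) * gn (X Neg j r') - gn (X Neg j r') * gn (X Pos i r)
     - (if i = j then cst (1 / qdiff t) * (phi_elt t Pos i (r + r') - phi_elt t Neg i (r + r')) else 0)) (bvec (Some m)) = 0"
proof -
  consider "i = j" | "i \<noteq> j" "cmat R i j = -1" | "i \<noteq> j" "cmat R i j = 0"
    using cmat_off_diag[OF ij] by blast
  then show ?thesis
  proof cases
    case 1
    obtain c l where c: "sole_at i c l (expo C m)" "c = 0 \<or> c = sg Pos \<or> c = - sg Pos"
      by (rule thinE[OF m ij(1)])
    then have c': "c \<in> {-1, 0, 1}" by auto
    have pm: "act (gn (X Pos i r) * gn (X Neg i r')) (bvec (Some m))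
        = (if c = 1 then vscale (qpi t ((r + r') * (l + c))) (bvec (Some m)) else 0)"
    proof (cases "c = 1")
      case True
      then obtain m' where m': "move Neg i m = Some m'" "pos Neg i m = l + 1"
        using move_Some[OF ij(1), of Neg l m] c by auto
      have "qpi t (r' * (l + 1)) * qpi t (r * (l + 1)) = qpi t ((r + r') * (l + c))"
        unfolding qpi_mult True by (simp only: distrib_right add.commute)
      then show ?thesis unfolding act_XX
        using True m' move_back[OF m ij(1) m'(1)] by (simp del: bvec.simps of_int_add of_int_mult)
    next
      case False
      then have "move Neg i m = None" using move_None[OF ij(1) c(1), of Neg] c(2) by auto
      then show ?thesis unfolding act_XX using False by simp
    qed
    have mp: "act (gn (X Neg i r') * gn (X Pos i r)) (bvec (Some m))
        = (if c = -1 then vscale (qpi t ((r + r') * (l + c))) (bvec (Some m)) else 0)"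
    proof (cases "c = -1")
      case True
      then obtain m' where m': "move Pos i m = Some m'" "pos Pos i m = l - 1"
        using move_Some[OF ij(1), of Pos l m] c by auto
      have "qpi t (r * (l - 1)) * qpi t (r' * (l - 1)) = qpi t ((r + r') * (l + c))"
        unfolding qpi_mult True by (simp only: distrib_right diff_conv_add_uminus)
      then show ?thesis unfolding act_XX
        using True m' move_back[OF m ij(1) m'(1)] by (simp del: bvec.simps of_int_add of_int_mult of_int_diff)
    next
      case False
      then have "move Pos i m = None" using move_None[OF ij(1) c(1), of Pos] c(2) by auto
      then show ?thesis unfolding act_XX using False by simp
    qed
    show ?thesis using c' unfolding 1[symmetric]
      by (auto simp: alg_act_diff[of _ "_ - _"] alg_act_diff[of _ "gn _ * gn _"] pm mp
          phi_difference_act[OF m ij(1) c(1) c'] vscale_minus_left simp del: bvec.simps)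
  next
    case 2
    have "cmat R j i = -1" using 2 cmat_sym ij by simp
    then show ?thesis
      using act_XX_neighbour_opposite[OF m ij(1,2) 2(2), of Neg r r']
        act_XX_neighbour_opposite[OF m ij(2,1), of Pos r' r] 2
      by (simp add: alg_act_diff del: bvec.simps)
  next
    case 3
    then show ?thesis using act_X_distant_commute[OF m ij 3, of Pos r Neg r']
      by (simp add: alg_act_diff del: bvec.simps)
  qed
qed

text \<open>
  For \<open>i = j\<close> all terms vanish. For neighbours the second operator acts at a level lower or higher by
  one than the first, and moving one unit of the loop degree from one to the other costs a factor
  \<open>q\<^sup>\<plusminus>\<^sup>1\<close>; this identifies the first term with the third and the second with the fourth.
\<close>

lemma act_x_quadratic:
  assumes m: "m \<in> S" and ij: "i \<in> idx R" "j \<in> idx R"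
  shows "act ((gn (X e i (r + 1)) * gn (X e j r')
      - cst (qpi t (sg e * cmat R i j)) * gn (X e j r') * gn (X e i (r + 1)))
     - (cst (qpi t (sg e * cmat R i j)) * gn (X e i r) * gn (X e j (r' + 1))
        - gn (X e j (r' + 1)) * gn (X e i r))) (bvec (Some m)) = 0"
proof -
  let ?q = "qpi t (sg e * cmat R i j)" and ?v = "bvec (Some m)"
  let ?ij = "\<lambda>r r'. act (gn (X e i r) * gn (X e j r')) ?v" and ?ji = "\<lambda>r' r. act (gn (X e j r') * gn (X e i r)) ?v"
  have goal: "?thesis \<longleftrightarrow> ?ij (r + 1) r' - vscale ?q (?ji r' (r + 1)) - (vscale ?q (?ij r (r' + 1)) - ?ji (r' + 1) r) = 0"
    by (simp only: alg_act_diff mult.assoc) (simp only: alg_act_mult[of _ "cst _"] alg_act_cst)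
  consider "i = j" | "i \<noteq> j" "cmat R i j = -1" | "i \<noteq> j" "cmat R i j = 0"
    using cmat_off_diag[OF ij] by blast
  then show ?thesis
  proof cases
    case 1
    then show ?thesis unfolding goal using act_XX_self[OF m ij(1)] by simp
  next
    case 2
    have ji: "cmat R j i = -1" using 2 cmat_sym ij by simp
    have shift: "act (gn (X e a (r + 1)) * gn (X e b r')) ?v = vscale ?q (act (gn (X e a r) * gn (X e b (r' + 1))) ?v)"
      if ab: "a \<in> idx R" "b \<in> idx R" "cmat R a b = -1" for a b r r'
    proof (cases "move e b m")
      case None
      then show ?thesis unfolding act_XX by simp
    next
      case (Some m')
      show ?thesis
      proof (cases "move e a m'")
        case None
        then show ?thesis unfolding act_XX Some by simp
      next
        case (Some m'')
        define p where "p = pos e b m"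
        have p: "pos e a m' = p - sg e"
          unfolding p_def by (rule neighbour_level[OF m ab \<open>move e b m = Some m'\<close> Some])
        have "qpi t (r' * p) * qpi t ((r + 1) * (p - sg e)) = ?q * (qpi t ((r' + 1) * p) * qpi t (r * (p - sg e)))"
          unfolding qpi_mult 2(2) by (rule arg_cong[where f = "\<lambda>l. qpi t l"]) (simp add: algebra_simps)
        then show ?thesis unfolding act_XX \<open>move e b m = Some m'\<close> p_def[symmetric]
          by (simp add: Some p del: bvec.simps of_int_add of_int_mult of_int_diff)
      qed
    qed
    have "?ij (r + 1) r' = vscale ?q (?ij r (r' + 1))" by (rule shift[OF ij 2(2)])
    moreover have "?ji (r' + 1) r = vscale ?q (?ji r' (r + 1))" by (rule shift[OF ij(2,1) ji])
    ultimately show ?thesis unfolding goal by simp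
  next
    case 3
    then show ?thesis unfolding goal using act_X_distant_commute[OF m ij 3, of e _ e] by simp
  qed
qed

text \<open>Each of the three terms vanishes: no operator acts twice in a row at one node.\<close>

lemma act_serre:
  assumes m: "m \<in> S" and ij: "i \<in> idx R" "j \<in> idx R" "cmat R i j = -1"
  shows "act (serre t e i j r1 r2 r') (bvec (Some m)) = 0"
proof -
  have two: "act (gn (X e i r1)) (act (gn (X e i r2)) x) = 0" if "x \<in> crystal_space S" for x
  proof -
    have "act (gn (X e i r1) * gn (X e i r2)) x = (\<lambda>_. 0) x"
      by (rule linear_maps_agree[OF linear_alg_act])
        (use that act_XX_self[OF _ ij(1)] in \<open>auto simp: linear_map_def crystal_space_def subset_iff\<close>)
    then show ?thesis by (simp add: alg_act_mult)
  qed
  have closed: "bvec (move e k m') \<in> crystal_space S" if "m' \<in> S" "k \<in> idx R" for k m'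
    using that move_closed by (auto intro!: bvec_closed)
  have between: "act (gn (X e i r1)) (act (gn (X e j r')) (act (gn (X e i r2)) (bvec (Some m)))) = 0"
  proof (cases "move e i m")
    case (Some m')
    show ?thesis
    proof (cases "move e j m'")
      case (Some m'')
      then show ?thesis using neighbour_between[OF m ij \<open>move e i m = Some m'\<close> Some] \<open>move e i m = Some m'\<close>
        by (simp add: act_vscale)
    qed (simp add: Some act_vscale)
  qed simp
  have "act (gn (X e j r')) (bvec (Some m)) \<in> crystal_space S"
    using closed[OF m ij(2)] by (simp add: crystal_space_vscale)
  moreover have "bvec (Some m) \<in> crystal_space S" using m by (simp add: crystal_space_single)
  ultimately show ?thesis
    unfolding serre_def alg_act_add alg_act_diff alg_act_mult alg_act_cst
    by (simp only: two between) (simp add: alg_act_mult)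
qed

lemma act_relator:
  assumes "a \<in> relators R t" "m \<in> S"
  shows "act a (single m 1) = 0"
proof -
  have "act a (bvec (Some m)) = 0"
    using assms(1)
  proof cases
    case (k_mult h h')
    then show ?thesis by (simp add: alg_act_diff alg_act_mult pairing_add_right qpow_add mult.commute)
  next
    case k_zero
    then show ?thesis by (simp add: alg_act_diff)
  next
    case (k_h_comm h j k)
    then show ?thesis by (simp add: alg_act_diff alg_act_mult mult.commute)
  next
    case (h_comm i j k k')
    then show ?thesis by (simp add: alg_act_diff alg_act_mult mult.commute)
  next
    case (k_x h j e r)
    then show ?thesis using act_k_x[OF assms(2)] by (simp only:)
  next
    case (h_x i j k e r)
    then show ?thesis using act_h_x[OF assms(2)] by (simp only:)
  next
    case (x_plus_minus i j r r')
    then show ?thesis using act_x_plus_minus[OF assms(2)] by (simp only:)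
  next
    case (x_quadratic i j e r r')
    then show ?thesis using act_x_quadratic[OF assms(2)] by (simp only:)
  next
    case (x_serre i j e r1 r2 r')
    then show ?thesis using act_serre[OF assms(2)] by (simp only: alg_act_add add_0)
  next
    case (x_comm i j e r1 r2)
    have "i \<noteq> j" using x_comm cmat_diag by auto
    from act_X_distant_commute[OF assms(2) x_comm(2,3) this x_comm(4), of e r1 e r2]
    show ?thesis unfolding x_comm(1) alg_act_diff by (simp only: diff_self)
  qed
  then show ?thesis by simp
qed

sublocale presented_action R t S gen_act
  by unfold_locales (auto intro: gen_closed act_relator)

abbreviation V :: "(freealg set, 'm \<Rightarrow>\<^sub>0 complex) module" where
  "V \<equiv> crystal_module S (quotient_act R t gen_act)"

text \<open>
  At most one of \<open>vphi\<close> and \<open>veps\<close> is nonzero, and then it is \<open>1\<close>. The formula is thus the coefficient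
  of a single geometric series.
\<close>

lemma phi_act_formula:
  assumes "m \<in> S" "i \<in> idx R" "k > 0"
  shows "act (phi_elt t e i (sg e * k)) (bvec (Some m)) = vscale (of_int (sg e) * qdiff t *
    (of_int (vphi i (expo C m)) * qpi t (sg e * k * (q_pos i (expo C m) + 1))
      - of_int (veps i (expo C m)) * qpi t (sg e * k * (p_pos i (expo C m) - 1)))) (bvec (Some m))"
proof -
  obtain c l where c: "sole_at i c l (expo C m)" "c \<in> {-1, 0, 1}"
    using thin[OF assms(1,2)] by (auto simp: thin_at_def)
  show ?thesis
    using phi_act[OF assms(1,2) c, of e "nat k"] assms(3) c
    by (auto simp: phi_series_nth vphi_sole veps_sole q_pos_sole p_pos_sole algebra_simps simp del: bvec.simps)
qed

lemma acts_by_formulas: "acts_by_formulas R t C S (quotient_act R t gen_act)"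
proof -
  have closed: "bvec (Some m) \<in> crystal_space S" if "m \<in> S" for m
    using that by (simp add: crystal_space_single)
  show ?thesis
    unfolding acts_by_formulas_def usc_def ux_def uphi_def uk_def
    by (simp add: quotient_act_cls closed falg_gn falg_phi_elt alg_act_cst phi_act_formula move_def pos_def
        del: bvec.simps) (simp add: move_def pos_def)
qed

end

section \<open>Expansions of rational functions\<close>

text \<open>In the expansion at infinity the reversed polynomials have constant terms different from \<open>1\<close>, which give the factor in front.\<close>

lemma expansion_linear:
  "expansion e [:1, - qpi t a:] [:1, - qpi t b:] = fps_const (if e = Pos then 1 else qpi t (a - b)) *
    ((1 - fps_const (qpi t (sg e * a)) * fps_X) * inverse (1 - fps_const (qpi t (sg e * b)) * fps_X))"
proof (cases e)
  case Pos
  have lin: "fps_of_poly [:1, - c:] = 1 - fps_const c * fps_X" for c :: complex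
    by (simp add: fps_of_poly_pCons mult.commute)
  show ?thesis by (simp add: Pos lin fps_divide_unit)
next
  case Neg
  have "reflect_poly [:1, - c:] = [:- c, 1:]" if "c \<noteq> 0" for c :: complex
    by (rule poly_eqI) (use that in \<open>auto simp: coeff_reflect_poly coeff_pCons split: nat.splits\<close>)
  moreover have "fps_of_poly [:- c, 1:] = fps_const (- c) * (1 - fps_const (inverse c) * fps_X)"
    if "c \<noteq> 0" for c :: complex
    by (rule fps_ext) (use that in \<open>auto simp: coeff_pCons fps_X_nth mult.assoc split: nat.split\<close>)
  ultimately have lin: "fps_of_poly (reflect_poly [:1, - qpi t c:])
      = fps_const (- qpi t c) * (1 - fps_const (inverse (qpi t c)) * fps_X)" for c
    by simp
  define x y where "x = 1 - fps_const (inverse (qpi t a)) * fps_X"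
    and "y = 1 - fps_const (inverse (qpi t b)) * fps_X"
  have nz: "fps_nth (fps_const (- qpi t b) * y) 0 \<noteq> 0" by (simp add: y_def)
  have c: "fps_const (- qpi t a) * inverse (fps_const (- qpi t b)) = fps_const (qpi t (a - b))"
    by (simp add: fps_const_inverse of_int_diff qpow_diff divide_inverse)
  have "expansion e [:1, - qpi t a:] [:1, - qpi t b:] = (fps_const (- qpi t a) * x) / (fps_const (- qpi t b) * y)"
    by (simp only: Neg expansion.simps lin x_def y_def)
  also have "\<dots> = (fps_const (- qpi t a) * inverse (fps_const (- qpi t b))) * (x * inverse y)"
    unfolding fps_divide_unit[OF nz] fps_inverse_mult by (simp only: mult_ac)
  finally show ?thesis unfolding c x_def y_def by (simp add: Neg qpow_minus)
qed

lemma phi_series_expansion: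
  "fps_const (qpi t 1) * expansion e [:1, - qpi t (l - 1):] [:1, - qpi t (l + 1):] = phi_series t e 1 l"
proof -
  have "fps_const (qpi t 1) * fps_const (if e = Pos then 1 else qpi t ((l - 1) - (l + 1))) = fps_const (qpi t (sg e * 1))"
    by (cases e) (simp_all flip: qpow_add)
  then show ?thesis unfolding expansion_linear phi_series_def by (simp only: mult.assoc[symmetric])
qed

lemma phi_series_inverse: "inverse (phi_series t e 1 l) = phi_series t e (-1) l"
proof -
  have "inverse (fps_const (qpi t (sg e))) = fps_const (qpi t (- sg e))"
    by (simp add: fps_const_inverse qpow_minus)
  then show ?thesis
    by (simp add: phi_series_def fps_inverse_mult mult_ac del: of_int_minus of_int_mult of_int_diff of_int_add)
qed

lemma phi_series_0: "phi_series t e 0 l = 1"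
  by (simp add: phi_series_def inverse_mult_eq_1')

lemma lweight_series_sole:
  assumes "sole_at i c l u" "c \<in> {-1, 0, 1}"
  shows "lweight_series t e i u = phi_series t e c l"
proof -
  have "{l'. expon u i l' \<noteq> 0} = (if c = 0 then {} else {l})"
    using assms(1) by (auto simp: sole_at_def split: if_splits)
  note levels = this
  have "lweight_series t e i u = (if c = 0 then 1 else phi_series t e 1 l powi c)"
    unfolding lweight_series_def phi_series_expansion levels using assms(1) by (simp add: sole_at_def)
  then show ?thesis using assms(2) by (auto simp: phi_series_0 phi_series_inverse power_int_minus)
qed

lemma drinfeld_series_fundamental:
  "drinfeld_series t e (if i = l then [:1, - qpi t k:] else 1) = phi_series t e (if i = l then 1 else 0) k"
proof (cases "i = l")
  case True
  have "pcompose [:1, - qpi t k:] [:0, qpi t 1:] = [:1, - qpi t (k + 1):]"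
    "pcompose [:1, - qpi t k:] [:0, qpi t (-1):] = [:1, - qpi t (k - 1):]"
    by (simp_all add: pcompose_pCons qpow_add qpow_diff qpow_minus divide_inverse mult.commute)
  moreover have "degree [:1, - qpi t k:] = 1" by simp
  ultimately show ?thesis
    using True phi_series_expansion[of t e k] by (simp only: drinfeld_series_def if_True of_nat_1 simp_thms)
next
  case False
  have "pcompose 1 q = (1 :: complex poly)" for q by (metis one_pCons pcompose_const)
  with False show ?thesis by (cases e) (simp_all add: drinfeld_series_def phi_series_0)
qed

section \<open>Linear combinations in modules\<close>

context quantum_module
begin

lemma lin_comb_opr: "lin_comb R t W b c = finsum W (\<lambda>x. opr (cst (lookup c x)) (b x)) (keys c)"
  by (simp add: lin_comb_def opr_def usc_def)

lemma lin_comb_superset: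
  assumes "finite A" "keys c \<subseteq> A" "b ` A \<subseteq> carrier W"
  shows "lin_comb R t W b c = finsum W (\<lambda>x. opr (cst (lookup c x)) (b x)) A"
  unfolding lin_comb_opr
  by (rule M.add.finprod_mono_neutral_cong_left)
    (use assms in \<open>auto simp: in_keys_iff opr_zero opr_closed image_subset_iff\<close>)

lemma lin_comb_closed:
  assumes "keys c \<subseteq> S" "b ` S \<subseteq> carrier W"
  shows "lin_comb R t W b c \<in> carrier W"
  unfolding lin_comb_opr by (rule M.finsum_closed) (use assms in \<open>auto simp: opr_closed image_subset_iff\<close>)

lemma lin_comb_single:
  assumes "b m \<in> carrier W"
  shows "lin_comb R t W b (single m c) = opr (cst c) (b m)"
  using lin_comb_superset[of "{m}" "single m c" b] assms
  by (simp add: opr_closed M.finsum_insert)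

lemma lin_comb_zero: "lin_comb R t W b 0 = \<zero>\<^bsub>W\<^esub>"
  by (simp add: lin_comb_opr)

lemma lin_comb_add:
  assumes "keys c \<subseteq> S" "keys c' \<subseteq> S" "b ` S \<subseteq> carrier W"
  shows "lin_comb R t W b (c + c') = lin_comb R t W b c \<oplus>\<^bsub>W\<^esub> lin_comb R t W b c'"
proof -
  let ?A = "keys c \<union> keys c'"
  have b: "b ` ?A \<subseteq> carrier W" using assms by auto
  have eq: "lin_comb R t W b d = finsum W (\<lambda>x. opr (cst (lookup d x)) (b x)) ?A"
    if "d \<in> {c, c', c + c'}" for d
    by (rule lin_comb_superset) (use that b keys_add[of c c'] in auto)
  have "finsum W (\<lambda>x. opr (cst (lookup (c + c') x)) (b x)) ?A =
      finsum W (\<lambda>x. opr (cst (lookup c x)) (b x) \<oplus>\<^bsub>W\<^esub> opr (cst (lookup c' x)) (b x)) ?A"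
    by (rule M.finsum_cong') (use b in \<open>auto simp: lookup_add cst_add opr_add opr_closed image_subset_iff\<close>)
  also have "\<dots> = finsum W (\<lambda>x. opr (cst (lookup c x)) (b x)) ?A
      \<oplus>\<^bsub>W\<^esub> finsum W (\<lambda>x. opr (cst (lookup c' x)) (b x)) ?A"
    by (rule M.finsum_addf) (use b in \<open>auto simp: opr_closed image_subset_iff\<close>)
  finally show ?thesis using eq by simp
qed

lemma opr_cst_cst: "x \<in> carrier W \<Longrightarrow> opr (cst a) (opr (cst b) x) = opr (cst (a * b)) x"
  by (simp add: cst_mult opr_mult)

lemma opr_cst_commute:
  "a \<in> falg R \<Longrightarrow> x \<in> carrier W \<Longrightarrow> opr a (opr (cst c) x) = opr (cst c) (opr a x)"
  by (simp add: cst_commute flip: opr_mult)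

lemma lin_comb_vscale:
  assumes "keys c \<subseteq> S" "b ` S \<subseteq> carrier W"
  shows "lin_comb R t W b (vscale z c) = opr (cst z) (lin_comb R t W b c)"
  using assms(1)
proof (induction c rule: formal_sum_induct)
  case zero
  show ?case by (simp add: lin_comb_zero opr_zero_right)
next
  case (add m d y)
  have s: "keys (single m a) \<subseteq> S" "b m \<in> carrier W" for a using add(1) assms by auto
  have y: "keys (vscale z y) \<subseteq> S" using add(2) by (auto simp: in_keys_iff)
  have "lin_comb R t W b (vscale z (single m d + y))
      = opr (cst (z * d)) (b m) \<oplus>\<^bsub>W\<^esub> opr (cst z) (lin_comb R t W b y)"
    using add by (simp add: vscale_add_right lin_comb_add[OF s(1) y assms(2)] lin_comb_single s)
  also have "\<dots> = opr (cst z) (lin_comb R t W b (single m d + y))"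
    using add by (simp add: lin_comb_add[OF s(1) _ assms(2)] lin_comb_single s opr_add_right opr_closed
        opr_cst_cst lin_comb_closed[OF _ assms(2)])
  finally show ?case .
qed

end

section \<open>Structure of the crystal module\<close>

context thin_crystal
begin

lemma act_diagonal_lookup:
  "lookup (act (gn (H i k)) x) m = h_value t i k (expo C m) * lookup x m"
  using subset_UNIV[of "keys x"]
proof (induction x rule: formal_sum_induct)
  case (add m' c x)
  then show ?case
    by (simp add: linear_mapD[OF linear_alg_act] lookup_add lookup_single when_def distrib_left)
qed simp

text \<open>
  On the parts \<open>1\<close>, \<open>Y\<^bsub>i,l\<^esub>\<close> and \<open>Y\<^bsub>i,l\<^esub>\<^sup>-\<^sup>1\<close> the element \<open>h\<^bsub>i,1\<^esub>\<close> has the eigenvalues \<open>0\<close>, \<open>q\<^sup>l\<close> and \<open>-q\<^sup>l\<close>.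
  These are distinct for all \<open>l\<close>, because \<open>q\<^sup>l = -q\<^bsup>l'\<^esup>\<close> would make \<open>q\<^bsup>2(l-l')\<^esup>\<close> equal to \<open>1\<close>.
\<close>

lemma h_value_separates:
  assumes "m \<in> S" "m' \<in> S" "i \<in> idx R"
    and eq: "h_value t i 1 (expo C m) = h_value t i 1 (expo C m')"
  shows "expon (expo C m) i k = expon (expo C m') i k"
proof -
  obtain c l where c: "sole_at i c l (expo C m)" "c = 0 \<or> c = sg Pos \<or> c = - sg Pos"
    by (rule thinE[OF assms(1,3)])
  obtain c' l' where c': "sole_at i c' l' (expo C m')" "c' = 0 \<or> c' = sg Pos \<or> c' = - sg Pos"
    by (rule thinE[OF assms(2,3)])
  have hv: "of_int c * qpi t l = of_int c' * qpi t l'"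
    using eq qint_eq_0_iff[of 1]
    by (simp add: h_value_def level_sum_sole[OF c(1)] level_sum_sole[OF c'(1)])
  have no_sign: "qpi t l \<noteq> - qpi t l'"
  proof
    assume neg: "qpi t l = - qpi t l'"
    then have "qpi t l ^ 2 = qpi t l' ^ 2" by simp
    then have "l = l'" unfolding qpi_power qpi_inj by simp
    with neg show False by simp
  qed
  have no_sign': "- qpi t l \<noteq> qpi t l'"
  proof
    assume "- qpi t l = qpi t l'"
    then have "qpi t l = - qpi t l'" by (rule minus_equation_iff[THEN iffD1, symmetric])
    with no_sign show False ..
  qed
  have same: "l = l'" if "qpi t l = qpi t l'" using that by (simp only: qpi_inj)
  have "c = 0 \<or> c = 1 \<or> c = -1" using c(2) by simp
  moreover have "c' = 0 \<or> c' = 1 \<or> c' = -1" using c'(2) by simp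
  ultimately have "c = c' \<and> (c \<noteq> 0 \<longrightarrow> l = l')"
    using hv no_sign no_sign' same by (elim disjE) simp_all
  then show ?thesis using c(1) c'(1) by (auto simp: sole_at_def)
qed

lemma V_submodule_iff:
  "submodule N (quantum_alg R t) V \<longleftrightarrow> N \<subseteq> crystal_space S \<and> 0 \<in> N \<and> (\<forall>x\<in>N. \<forall>y\<in>N. x + y \<in> N) \<and>
     (\<forall>a\<in>falg R. \<forall>x\<in>N. act a x \<in> N)"
proof (cases "N \<subseteq> crystal_space S")
  case True
  then have "opr a x = act a x" if "a \<in> falg R" "x \<in> N" for a x
    using that by (intro opr_eq) auto
  then show ?thesis by (simp add: submodule_iff)
qed (simp add: submodule_iff)

lemma basis_expansion: "keys x \<subseteq> S \<Longrightarrow> lin_comb R t V (\<lambda>m. bvec (Some m)) x = x"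
proof (induction x rule: formal_sum_induct)
  case zero
  show ?case by (simp add: lin_comb_zero[unfolded crystal_module_simps])
next
  case (add m c y)
  have b: "(\<lambda>m. bvec (Some m)) ` S \<subseteq> carrier V" by (auto intro: crystal_space_single)
  have m: "keys (single m c) \<subseteq> S" using add(1) by auto
  have "lin_comb R t V (\<lambda>m. bvec (Some m)) (single m c) = single m c"
    using add(1) by (subst lin_comb_single) (auto simp: crystal_space_single opr_eq alg_act_cst)
  then show ?case using lin_comb_add[OF m add(2) b] add(3) by simp
qed

lemma is_basis_V: "is_basis R t V S (\<lambda>m. bvec (Some m))"
  unfolding is_basis_def
proof (intro conjI ballI)
  show "(\<lambda>m. bvec (Some m)) ` S \<subseteq> carrier V" by (auto intro: crystal_space_single)
  fix x assume "x \<in> carrier V"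
  then have x: "keys x \<subseteq> S" by (simp add: crystal_space_def)
  show "\<exists>!c. keys c \<subseteq> S \<and> x = lin_comb R t V (\<lambda>m. bvec (Some m)) c"
    by (rule ex1I[of _ x]) (use x basis_expansion in metis)+
qed

lemma fin_dimensional_V:
  assumes "finite S"
  shows "fin_dimensional R t V"
  unfolding fin_dimensional_def
proof (intro exI[of _ "(\<lambda>m. bvec (Some m)) ` S"] conjI ballI)
  let ?B = "(\<lambda>m. bvec (Some m)) ` S"
  show "finite ?B" using assms by simp
  show B: "?B \<subseteq> carrier V" by (auto intro: crystal_space_single)
  fix x assume "x \<in> carrier V"
  then have x: "keys x \<subseteq> S" by (simp add: crystal_space_def)
  have id: "(\<lambda>x. x) ` ?B \<subseteq> carrier V" using B by simp
  from x show "\<exists>c. keys c \<subseteq> ?B \<and> x = lin_comb R t V (\<lambda>x. x) c"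
  proof (induction x rule: formal_sum_induct)
    case zero
    show ?case by (intro exI[of _ 0]) (simp add: lin_comb_zero[unfolded crystal_module_simps])
  next
    case (add m z y)
    then obtain c where c: "keys c \<subseteq> ?B" "y = lin_comb R t V (\<lambda>x. x) c" by blast
    have m: "m \<in> S" by fact
    let ?s = "single (bvec (Some m)) z"
    have s: "keys ?s \<subseteq> ?B" using m by auto
    have "single m z = lin_comb R t V (\<lambda>x. x) ?s"
      using m by (subst lin_comb_single) (auto simp: crystal_space_single opr_eq alg_act_cst)
    then have "single m z + y = lin_comb R t V (\<lambda>x. x) (?s + c)"
      using lin_comb_add[OF s c(1) id] c(2) by simp
    moreover have "keys (?s + c) \<subseteq> ?B" using keys_add[of ?s c] s c by blast
    ultimately show ?case by blast
  qed
qed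

end

text \<open>
  If the monomials are determined by their exponents and all are reached from one of them, the
  module is simple: the \<open>h\<^bsub>i,1\<^esub>\<close> have simple joint spectrum, so a nonzero submodule contains a basis
  vector, and since every move can be undone, all others are obtained from it.
\<close>

locale connected_thin_crystal = thin_crystal R t C A S for R t and C :: "'m::ab_group_add mcrystal" and A S +
  fixes m0 :: 'm
  assumes separated: "m \<in> S \<Longrightarrow> m' \<in> S \<Longrightarrow> (\<And>i l. i \<in> idx R \<Longrightarrow> expon (expo C m) i l = expon (expo C m') i l) \<Longrightarrow> m = m'"
    and m0: "m0 \<in> S"
    and connected: "T \<subseteq> S \<Longrightarrow> m0 \<in> T \<Longrightarrow>
      (\<And>m i m'. m \<in> T \<Longrightarrow> i \<in> idx R \<Longrightarrow> etil C i m = Some m' \<or> ftil C i m = Some m' \<Longrightarrow> m' \<in> T) \<Longrightarrow> S \<subseteq> T"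
begin

lemma connected_move:
  assumes "T \<subseteq> S" "m0 \<in> T"
    and closed: "\<And>e m i m'. m \<in> T \<Longrightarrow> i \<in> idx R \<Longrightarrow> move e i m = Some m' \<Longrightarrow> m' \<in> T"
  shows "S \<subseteq> T"
proof (rule connected[OF assms(1,2)])
  fix m i m' assume "m \<in> T" "i \<in> idx R" "etil C i m = Some m' \<or> ftil C i m = Some m'"
  then show "m' \<in> T"
    using closed[of m i Pos m'] closed[of m i Neg m'] by (simp only: move_def sgn.case) blast
qed

text \<open>
  If the support of \<open>x\<close> has two elements, some \<open>h\<^bsub>i,1\<^esub>\<close> takes different values on them, and subtracting
  one of the values gives a nonzero vector of smaller support in the same submodule.
\<close>

lemma submodule_contains_basis_vector:
  assumes N: "submodule N (quantum_alg R t) V" and "x \<in> N" "x \<noteq> 0"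
  shows "\<exists>m\<in>S. single m 1 \<in> N"
  using assms(2,3)
proof (induction "card (keys x)" arbitrary: x rule: less_induct)
  case less
  note N' = N[unfolded V_submodule_iff]
  have xS: "keys x \<subseteq> S" using N' less(2) by (auto simp: crystal_space_def)
  obtain m where m: "m \<in> keys x" using less(3) by (metis all_not_in_conv keys_eq_empty)
  have scale: "vscale c y \<in> N" if "y \<in> N" for c y
    using N' that falg_cst[of c R] alg_act_cst[of gen_act c y] by metis
  show ?case
  proof (cases "keys x = {m}")
    case True
    then have x: "x = single m (lookup x m)"
      by (intro poly_mapping_eqI) (auto simp: lookup_single when_def in_keys_iff)
    have "vscale (1 / lookup x m) x = single m 1"
      using m by (subst (2) x) (simp add: in_keys_iff)
    then show ?thesis using scale[OF less(2), of "1 / lookup x m"] m xS by auto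
  next
    case False
    then obtain m' where m': "m' \<in> keys x" "m' \<noteq> m" using m by auto
    obtain i where i: "i \<in> idx R" "h_value t i 1 (expo C m') \<noteq> h_value t i 1 (expo C m)"
      using separated[of m' m] h_value_separates[of m' m] m m' xS by blast
    let ?h = "h_value t i 1 (expo C m)"
    define y where "y = act (gn (H i 1)) x + vscale (- ?h) x"
    have y: "lookup y k = (h_value t i 1 (expo C k) - ?h) * lookup x k" for k
      by (simp add: y_def lookup_add act_diagonal_lookup algebra_simps)
    have "y \<in> N" unfolding y_def
      using N' less(2) scale[OF less(2)] falg_gn(3)[OF i(1), of 1] by auto
    moreover have "y \<noteq> 0" using y[of m'] i(2) m'(1) by (auto simp: in_keys_iff)
    moreover have "keys y \<subset> keys x"
      using y y[of m] m by (auto simp: in_keys_iff)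
    ultimately show ?thesis by (intro less(1)) (simp_all add: psubset_card_mono)
  qed
qed

lemma simple_V: "simple_module (quantum_alg R t) V"
  unfolding simple_module_def
proof (intro conjI allI impI)
  have "single m0 1 \<in> crystal_space S" using m0 by (simp add: crystal_space_single)
  moreover have "single m0 1 \<noteq> (0 :: 'm \<Rightarrow>\<^sub>0 complex)" by (metis lookup_single_eq lookup_zero zero_neq_one)
  ultimately show "carrier V \<noteq> {\<zero>\<^bsub>V\<^esub>}" by auto
next
  fix N assume N: "submodule N (quantum_alg R t) V"
  note N' = N[unfolded V_submodule_iff]
  show "N = {\<zero>\<^bsub>V\<^esub>} \<or> N = carrier V"
  proof (cases "N = {0}")
    case False
    then obtain x where "x \<in> N" "x \<noteq> 0" using N' by auto
    from submodule_contains_basis_vector[OF N this]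
    obtain m1 where m1: "m1 \<in> S" "single m1 1 \<in> N" by auto
    define B where "B = {m \<in> S. single m 1 \<in> N}"
    have step: "m' \<in> B" if "m \<in> B" "i \<in> idx R" "move e i m = Some m'" for e m i m'
    proof -
      have "act (gn (X e i 0)) (single m 1) \<in> N"
        using N' that by (auto simp: B_def falg_gn simp del: act_gn_single)
      then show ?thesis using that move_closed by (auto simp: B_def)
    qed
    \<comment> \<open>since moves can be undone, the complement of \<open>B\<close> is stable as well\<close>
    have undo: "m' \<in> S - B" if "m \<in> S - B" "i \<in> idx R" "move e i m = Some m'" for e m i m'
      using step[of m' i "opposite e" m] move_back(1)[of m i e m'] move_closed[of m i e m'] that by auto
    have "m0 \<in> B"
    proof (rule ccontr)
      assume "m0 \<notin> B"
      then have "m0 \<in> S - B" using m0 by simp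
      have "S \<subseteq> S - B"
      proof (rule connected_move)
        show "m0 \<in> S - B" by fact
        show "m' \<in> S - B" if "m \<in> S - B" "i \<in> idx R" "move e i m = Some m'" for e m i m'
          by (rule undo[OF that])
      qed simp
      then show False using m1 by (auto simp: B_def)
    qed
    have "S \<subseteq> B"
    proof (rule connected_move)
      show "B \<subseteq> S" by (auto simp: B_def)
      show "m0 \<in> B" by fact
    qed (rule step)
    have "x \<in> N" if x: "x \<in> crystal_space S" for x
      using x[unfolded crystal_space_def mem_Collect_eq]
    proof (induction x rule: formal_sum_induct)
      case zero
      show ?case using N' by simp
    next
      case (add m c y)
      then have "single m 1 \<in> N" using \<open>S \<subseteq> B\<close> by (auto simp: B_def)
      then have "act (cst c) (single m 1) \<in> N" using N' falg_cst by blast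
      then have "single m c \<in> N" by (simp add: alg_act_cst)
      then show ?case using N' add(3) by blast
    qed
    then show ?thesis using N' by auto
  qed simp
qed

end

section \<open>Modules determined by their weights and the degree zero operators\<close>

text \<open>
  A module with a basis on which \<open>k\<^sub>h\<close>, \<open>\<phi>\<^sup>\<plusminus>\<^sub>i(z)\<close> and \<open>x\<^sup>\<plusminus>\<^bsub>i,0\<^esub>\<close> act as on the crystal module. The
  other generators are recovered from these, \<open>x\<^sup>\<plusminus>\<^bsub>i,r\<^esub>\<close> being a nonzero multiple of the commutator of
  \<open>h\<^bsub>i,r\<^esub>\<close> and \<open>x\<^sup>\<plusminus>\<^bsub>i,0\<^esub>\<close>.
\<close>

locale same_loop_weights = thin_crystal R t C A S + W: quantum_module R t W
  for R t and C :: "'m::ab_group_add mcrystal" and A S and W :: "(freealg set, 'w) module" +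
  fixes b :: "'m \<Rightarrow> 'w"
  assumes basis: "is_basis R t W S b"
    and K_b: "m \<in> S \<Longrightarrow> h \<in> cart R \<Longrightarrow> W.opr (gn (K h)) (b m) = W.opr (cst (qpow t (pairing (wt C m) h))) (b m)"
    and phi_b: "m \<in> S \<Longrightarrow> i \<in> idx R \<Longrightarrow> W.opr (phi_elt t e i (sg e * int k)) (b m)
      = W.opr (cst (fps_nth (lweight_series t e i (expo C m)) k)) (b m)"
    and X_b: "m \<in> S \<Longrightarrow> i \<in> idx R \<Longrightarrow> W.opr (gn (X e i 0)) (b m)
      = (case move e i m of None \<Rightarrow> \<zero>\<^bsub>W\<^esub> | Some m' \<Rightarrow> b m')"
begin

lemma b_image: "b ` S \<subseteq> carrier W"
  using basis unfolding is_basis_def by (rule conjunct1)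

lemma b_closed: "m \<in> S \<Longrightarrow> b m \<in> carrier W"
  using b_image by blast

lemma H_b:
  assumes m: "m \<in> S" and i: "i \<in> idx R" and k: "k \<noteq> 0"
  shows "W.opr (gn (H i k)) (b m) = W.opr (cst (h_value t i k (expo C m))) (b m)"
proof -
  obtain c l where c: "sole_at i c l (expo C m)" "c \<in> {-1, 0, 1}"
    using thin[OF m i] by (auto simp: thin_at_def)
  show ?thesis
  proof (rule W.H_eigenvalue_of_monomial[OF generic_parameter_axioms b_closed[OF m] i k c])
    show "W.opr (gn (K (single (Hc i) (of_int (sg e))))) (b m) = W.opr (cst (qpi t (sg e * c))) (b m)" for e
      using K_b[OF m cart_coroot[OF i]] by (simp only: coroot_eigenvalue[OF m i c(1)])
  qed (simp only: phi_b[OF m i] lweight_series_sole[OF c])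
qed

text \<open>
  The factor \<open>[2r]/r\<close> in the commutator of \<open>h\<^bsub>i,r\<^esub>\<close> and \<open>x\<^sup>\<plusminus>\<^bsub>i,0\<^esub>\<close> is nonzero, and both products are
  known, so the action of \<open>x\<^sup>\<plusminus>\<^bsub>i,r\<^esub>\<close> is forced. Its coefficient is the difference of two eigenvalues of
  \<open>h\<^bsub>i,r\<^esub>\<close>, which has been computed for the crystal module.
\<close>

lemma X_all_b:
  assumes m: "m \<in> S" and i: "i \<in> idx R"
  shows "W.opr (gn (X e i r)) (b m)
    = (case move e i m of None \<Rightarrow> \<zero>\<^bsub>W\<^esub> | Some m' \<Rightarrow> W.opr (cst (qpi t (r * pos e i m))) (b m'))"
proof (cases "r = 0")
  case True
  then show ?thesis using X_b[OF m i] move_closed[OF m i]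
    by (auto simp: W.opr_one b_closed split: option.split)
next
  case False
  let ?z = "of_int (sg e) * (1 / of_int r) * qint t (r * cmat R i i)"
  have z: "?z \<noteq> 0" using False qint_eq_0_iff[of "r * 2"] by (cases e) (simp_all add: cmat_diag i)
  note falg = falg_gn(1)[OF i] falg_gn(3)[OF i False] falg_cst falg_mult
  have "gn (H i r) * gn (X e i 0) - gn (X e i 0) * gn (H i r) - cst ?z * gn (X e i (r + 0)) \<in> relators R t"
    by (rule relators.h_x[OF i i False])
  from W.opr_relator[OF this b_closed[OF m]]
  have "W.opr (gn (H i r) * gn (X e i 0) - (gn (X e i 0) * gn (H i r) + cst ?z * gn (X e i r))) (b m) = \<zero>\<^bsub>W\<^esub>"
    by (simp add: algebra_simps)
  then have rel: "W.opr (gn (H i r)) (W.opr (gn (X e i 0)) (b m)) =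
      W.opr (cst (h_value t i r (expo C m))) (W.opr (gn (X e i 0)) (b m)) \<oplus>\<^bsub>W\<^esub> W.opr (cst ?z) (W.opr (gn (X e i r)) (b m))"
    using m by (subst (asm) W.opr_diff_eq_zero_iff)
      (auto simp: falg falg_add b_closed W.opr_mult W.opr_add H_b i False W.opr_cst_commute)
  have X: "W.opr (gn (X e i r)) (b m) \<in> carrier W" by (simp add: W.opr_closed falg b_closed m)
  have scale: "y = W.opr (cst (1 / ?z)) (W.opr (cst ?z) y)" if "y \<in> carrier W" for y
    using z that by (simp only: W.opr_cst_cst) (simp add: W.opr_one)
  show ?thesis
  proof (cases "move e i m")
    case None
    then have "W.opr (cst ?z) (W.opr (gn (X e i r)) (b m)) = \<zero>\<^bsub>W\<^esub>"
      using rel X_b[OF m i, of e] X by (simp add: W.opr_zero_right falg W.opr_closed)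
    then show ?thesis using scale[OF X] None by (simp add: W.opr_zero_right)
  next
    case (Some m')
    have m': "b m' \<in> carrier W" using move_closed[OF m i Some] by (rule b_closed)
    let ?p = "qpi t (r * pos e i m)"
    have "h_value t i r (expo C m') = h_value t i r (expo C m) + ?z * ?p"
      using h_value_move[OF m i i False Some] by (simp add: algebra_simps)
    then have "W.opr (cst (h_value t i r (expo C m))) (b m') \<oplus>\<^bsub>W\<^esub> W.opr (cst ?z) (W.opr (gn (X e i r)) (b m))
        = W.opr (cst (h_value t i r (expo C m))) (b m') \<oplus>\<^bsub>W\<^esub> W.opr (cst ?z) (W.opr (cst ?p) (b m'))"
      using rel X_b[OF m i, of e] Some H_b[OF move_closed[OF m i Some] i False] m'
      by (simp only: W.opr_cst_cst option.case cst_add W.opr_add falg_cst)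
    then have "W.opr (cst ?z) (W.opr (gn (X e i r)) (b m)) = W.opr (cst ?z) (W.opr (cst ?p) (b m'))"
      using X m' by (simp add: W.opr_closed)
    then have "W.opr (gn (X e i r)) (b m) = W.opr (cst ?p) (b m')"
      using scale[OF X] scale[of "W.opr (cst ?p) (b m')"] m' by (simp add: W.opr_closed)
    then show ?thesis by (simp add: Some)
  qed
qed

lemma gen_b:
  assumes "m \<in> S" "g \<in> gens R"
  shows "lin_comb R t W b (gen_act g m) = W.opr (gn g) (b m)"
proof -
  have single: "lin_comb R t W b (single m' c) = W.opr (cst c) (b m')" if "m' \<in> S" for m' c
    using that by (simp add: W.lin_comb_single b_closed)
  from assms(2) consider e i r where "g = X e i r" "i \<in> idx R" | h where "g = K h" "h \<in> cart R"
    | i k where "g = H i k" "i \<in> idx R" "k \<noteq> 0"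
    by (auto simp: gens_def)
  then show ?thesis
  proof cases
    case 1
    then show ?thesis using assms(1) X_all_b move_closed
      by (auto simp: single W.lin_comb_zero split: option.split)
  qed (use assms(1) in \<open>auto simp: single K_b H_b\<close>)
qed

lemma intertwines:
  assumes "a \<in> falg R" "x \<in> crystal_space S"
  shows "lin_comb R t W b (act a x) = W.opr a (lin_comb R t W b x)"
  using assms(1)
proof (induction a rule: falg_induct)
  case (cst c)
  show ?case using assms(2) by (simp add: alg_act_cst W.lin_comb_vscale[OF _ b_image] crystal_space_def)
next
  case (add a a')
  have "lin_comb R t W b x \<in> carrier W"
    using assms(2) by (intro W.lin_comb_closed[OF _ b_image]) (simp add: crystal_space_def)
  then show ?case
    using add alg_act_closed[OF _ assms(2)] by (simp add: alg_act_add W.lin_comb_add[OF _ _ b_image] W.opr_add crystal_space_def)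
next
  case (gen g a)
  have g: "gn g \<in> falg R" using gen by (simp add: falg_gn_iff)
  have one: "lin_comb R t W b (act (gn g) y) = W.opr (gn g) (lin_comb R t W b y)"
    if "y \<in> crystal_space S" for y
    using that[unfolded crystal_space_def mem_Collect_eq]
  proof (induction y rule: formal_sum_induct)
    case zero
    show ?case by (simp add: W.lin_comb_zero W.opr_zero_right g)
  next
    case (add m c y)
    have s: "single m c \<in> crystal_space S" using add(1) by (rule crystal_space_single)
    have y: "y \<in> crystal_space S" using add(2) by (simp add: crystal_space_def)
    have "lin_comb R t W b (act (gn g) (single m c)) = W.opr (gn g) (lin_comb R t W b (single m c))"
      using add(1) gen_closed[OF gen(1) add(1)]
      by (simp add: W.lin_comb_vscale[OF _ b_image] crystal_space_def gen_b gen(1) W.lin_comb_single b_closed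
          W.opr_cst_commute g)
    moreover have "act (gn g) (single m c) \<in> crystal_space S" "act (gn g) y \<in> crystal_space S"
      by (rule alg_act_closed[OF g s], rule alg_act_closed[OF g y])
    ultimately show ?case
      using add s y W.lin_comb_closed[OF _ b_image] g
      by (auto simp: linear_mapD[OF linear_alg_act] W.lin_comb_add[OF _ _ b_image] crystal_space_def
          W.opr_add_right simp del: act_gn_single)
  qed
  have "lin_comb R t W b x \<in> carrier W"
    using assms(2) by (intro W.lin_comb_closed[OF _ b_image]) (simp add: crystal_space_def)
  then show ?case using gen g by (simp add: alg_act_mult one alg_act_closed assms(2) W.opr_mult)
qed

theorem isomorphic: "module_iso (quantum_alg R t) V W"
  unfolding module_iso_def
proof (intro exI conjI ballI)
  let ?f = "lin_comb R t W b"
  show "bij_betw ?f (carrier V) (carrier W)"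
  proof (rule bij_betwI')
    fix x y assume "x \<in> carrier V" "y \<in> carrier V"
    then have xy: "keys x \<subseteq> S" "keys y \<subseteq> S" by (auto simp: crystal_space_def)
    then have "\<exists>!c. keys c \<subseteq> S \<and> ?f x = ?f c"
      using basis W.lin_comb_closed[OF xy(1) b_image] unfolding is_basis_def by blast
    with xy show "(?f x = ?f y) = (x = y)" by blast
  next
    fix x assume "x \<in> carrier V"
    then show "?f x \<in> carrier W" by (intro W.lin_comb_closed[OF _ b_image]) (simp add: crystal_space_def)
  next
    fix y assume "y \<in> carrier W"
    then obtain c where "keys c \<subseteq> S" "y = ?f c"
      using basis unfolding is_basis_def by blast
    then show "\<exists>x\<in>carrier V. y = ?f x" by (intro bexI[of _ c]) (simp_all add: crystal_space_def)
  qed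
next
  fix x y assume "x \<in> carrier V" "y \<in> carrier V"
  then have "keys x \<subseteq> S" "keys y \<subseteq> S" by (auto simp: crystal_space_def)
  from W.lin_comb_add[OF this b_image]
  show "lin_comb R t W b (x \<oplus>\<^bsub>V\<^esub> y) = lin_comb R t W b x \<oplus>\<^bsub>W\<^esub> lin_comb R t W b y" by simp
next
  fix a x assume "a \<in> carrier (quantum_alg R t)" "x \<in> carrier V"
  then obtain a' where a': "a' \<in> falg R" "a = cls R t a'" and x: "x \<in> crystal_space S"
    by (auto simp: quantum_alg_carrier)
  show "lin_comb R t W b (a \<odot>\<^bsub>V\<^esub> x) = a \<odot>\<^bsub>W\<^esub> lin_comb R t W b x"
    using intertwines[OF a'(1) x] unfolding a'(2) W.opr_def
    by (simp add: quotient_act_cls[OF a'(1) x])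
qed

end

section \<open>The crystals of types \<open>A\<^sub>n\<close> and \<open>A\<^sub>n\<^sup>(\<^sup>1\<^sup>)\<close>\<close>

lemma fin_datum_simps [simp]:
  "idx (fin_datum n) = {1..n}"
  "cmat (fin_datum n) i j = (if i = j then 2 else if i = Suc j \<or> j = Suc i then -1 else 0)"
  "cart (fin_datum n) = {h. keys h \<subseteq> Hc ` {1..n}}"
  by (simp_all add: fin_datum_def)

lemma aff_datum_simps [simp]:
  "idx (aff_datum n) = {0..n}"
  "cmat (aff_datum n) i j = (if i = j then 2
     else if i = Suc j mod Suc n \<or> j = Suc i mod Suc n then -1 else 0)"
  "cart (aff_datum n) = {h. keys h \<subseteq> insert Dc (Hc ` {0..n})}"
  by (simp_all add: aff_datum_def)

lemma keys_uminus: "keys (- h) = keys (h :: 'a \<Rightarrow>\<^sub>0 'b::ab_group_add)"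
  by (auto simp: in_keys_iff)

lemma simply_laced_fin: "simply_laced (fin_datum n)"
proof unfold_locales
  fix h h' assume "h \<in> cart (fin_datum n)" "h' \<in> cart (fin_datum n)"
  then show "h + h' \<in> cart (fin_datum n)" using keys_add[of h h'] by auto
qed (auto simp: keys_uminus)

lemma simply_laced_aff: "simply_laced (aff_datum n)"
proof unfold_locales
  fix h h' assume "h \<in> cart (aff_datum n)" "h' \<in> cart (aff_datum n)"
  then show "h + h' \<in> cart (aff_datum n)" using keys_add[of h h'] by auto
qed (auto simp: keys_uminus)

lemma lookup_simple_root:
  "finite (idx R) \<Longrightarrow> j \<in> idx R \<Longrightarrow> lookup (simple_root R i) (Hc j) = of_int (cmat R j i)"
  by (simp add: simple_root_def lookup_add lookup_sum lookup_single when_def)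

lemma fin_crystal_simps [simp]:
  "els (fin_crystal n s) = ymons {1..n} s" "expo (fin_crystal n s) m = m" "ind (fin_crystal n s) = {1..n}"
  by (simp_all add: fin_crystal_def)

lemma wt_fin: "wt (fin_crystal n s) m = (\<Sum>i\<in>{1..n}. single (Hc i) (of_int (total_expon m i)))"
  by (simp add: fin_crystal_def)

lemma lookup_wt_fin: "i \<in> {1..n} \<Longrightarrow> lookup (wt (fin_crystal n s) m) (Hc i) = of_int (total_expon m i)"
  by (simp add: wt_fin lookup_sum lookup_single when_def)

lemma total_expon_add: "total_expon (u + v) i = total_expon u i + total_expon v i"
  by (simp add: total_expon_level_sum level_sum_add)

lemma monomial_crystal_fin: "monomial_crystal (fin_datum n) (fin_crystal n s) (fin_A n)"
proof -
  interpret simply_laced "fin_datum n" by (rule simply_laced_fin)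
  show ?thesis
  proof unfold_locales
    fix m m'
    show "wt (fin_crystal n s) (m + m') = wt (fin_crystal n s) m + wt (fin_crystal n s) m'"
      by (simp add: wt_fin total_expon_add single_add sum.distrib)
  next
    fix i l assume i: "i \<in> idx (fin_datum n)"
    have "total_expon (fin_A n i l) j = cmat (fin_datum n) j i" if "j \<in> {1..n}" for j
      using level_sum_root[OF i, of j "\<lambda>_. 1 :: int" l] that i
      by (auto simp: fin_A_def total_expon_level_sum)
    then show "wt (fin_crystal n s) (fin_A n i l) = simple_root (fin_datum n) i"
      using i by (simp add: wt_fin simple_root_def del: fin_datum_simps(2))
  qed (simp_all add: fin_crystal_def fin_A_def)
qed

lemma aff_crystal_simps [simp]:
  "els (aff_crystal n s) = {(\<omega>, m). \<omega> \<in> weight_lattice n \<and> m \<in> ymons {0..n} s \<and>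
     (\<forall>i\<in>{0..n}. of_int (total_expon m i) = pairing \<omega> (hvec i))}"
  "expo (aff_crystal n s) = snd" "ind (aff_crystal n s) = {0..n}" "wt (aff_crystal n s) = fst"
  by (simp_all add: aff_crystal_def)

lemma cyclic_succ: "i \<le> n \<Longrightarrow> (i + 1) mod Suc n = (if i = n then 0 else i + 1)"
  and cyclic_pred: "i \<le> n \<Longrightarrow> (i + n) mod Suc n = (if i = 0 then n else i - 1)"
proof -
  show "i \<le> n \<Longrightarrow> (i + 1) mod Suc n = (if i = n then 0 else i + 1)" by simp
  assume i: "i \<le> n"
  show "(i + n) mod Suc n = (if i = 0 then n else i - 1)"
  proof (cases "i = 0")
    case False
    then have "i + n = (i - 1) + Suc n" by simp
    then have "(i + n) mod Suc n = (i - 1) mod Suc n" by (simp only: mod_add_self2)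
    then show ?thesis using False i by simp
  qed simp
qed

lemma aff_neighbours:
  assumes "n \<ge> 2" "i \<le> n"
  shows "{j \<in> {0..n}. cmat (aff_datum n) i j = -1} = {(i + n) mod Suc n, (i + 1) mod Suc n}"
    and "(i + n) mod Suc n \<noteq> (i + 1) mod Suc n"
proof -
  have "cmat (aff_datum n) i j = -1 \<longleftrightarrow> j = (i + n) mod Suc n \<or> j = (i + 1) mod Suc n" if "j \<le> n" for j
    using that assms cyclic_succ[of i n] cyclic_pred[of i n] cyclic_succ[of j n]
    by (auto split: if_splits)
  then show "{j \<in> {0..n}. cmat (aff_datum n) i j = -1} = {(i + n) mod Suc n, (i + 1) mod Suc n}"
    by (auto simp: less_Suc_eq_le[symmetric] simp del: aff_datum_simps(2))
  show "(i + n) mod Suc n \<noteq> (i + 1) mod Suc n"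
    using assms cyclic_succ[of i n] cyclic_pred[of i n] by (auto split: if_splits)
qed

lemma monomial_crystal_aff:
  assumes n: "n \<ge> 2"
  shows "monomial_crystal (aff_datum n) (aff_crystal n s) (aff_A n)"
proof -
  interpret simply_laced "aff_datum n" by (rule simply_laced_aff)
  show ?thesis
  proof unfold_locales
    fix i l assume i: "i \<in> idx (aff_datum n)"
    then have "(\<Sum>j\<in>{j \<in> idx (aff_datum n). cmat (aff_datum n) i j = -1}. Yv j l)
        = Yv ((i + n) mod Suc n) l + Yv ((i + 1) mod Suc n) l"
      using aff_neighbours[OF n, of i] by (simp del: aff_datum_simps(2))
    then show "expo (aff_crystal n s) (aff_A n i l) =
        Yv i (l - 1) + Yv i (l + 1) - (\<Sum>j\<in>{j \<in> idx (aff_datum n). cmat (aff_datum n) i j = -1}. Yv j l)"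
      by (simp add: aff_A_def algebra_simps)
  next
    fix i l
    show "wt (aff_crystal n s) (aff_A n i l) = simple_root (aff_datum n) i"
      by (simp add: aff_A_def)
  qed (simp_all add: aff_crystal_def)
qed

subsection \<open>Stability of the monomial groups and of subcrystals\<close>

context monomial_crystal
begin

text \<open>
  All levels at \<open>i\<close> have the parity of \<open>s i\<close>. The factors of \<open>A\<^bsub>i,l+d\<^esub>\<close> at \<open>i\<close> are an even number of
  levels away from \<open>l\<close> and those at the neighbours an odd number, as the parity function demands.
\<close>

lemma ymons_A:
  assumes s: "parity_function R s" and u: "u \<in> ymons (idx R) s" and i: "i \<in> idx R"
    and c: "sole_at i c l u" "c \<noteq> 0" and d: "d = 1 \<or> d = -1"
  shows "expo C (A i (l + d)) \<in> ymons (idx R) s"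
proof -
  have si: "s i = 0 \<or> s i = 1" using s i by (auto simp: parity_function_def)
  have "expon u i l \<noteq> 0" using c by (simp add: sole_at_def)
  then have l: "l mod 2 \<noteq> (s i + 1) mod 2" using u i by (auto simp: ymons_def)
  have out: "expon (expo C (A i p)) j l' = 0" if "j \<notin> idx R" for j p l'
  proof -
    have "expon (Yv i k) j l' = 0" for k using that i by (auto simp: expon_Yv)
    moreover have "(\<Sum>k\<in>{k \<in> idx R. cmat R i k = -1}. expon (Yv k p) j l') = 0"
      by (rule sum.neutral) (use that in \<open>auto simp: expon_Yv\<close>)
    ultimately show ?thesis by (simp add: expo_A[OF i] lookup_add lookup_minus lookup_sum)
  qed
  have par: "expon (expo C (A i (l + d))) j l' = 0"
    if j: "j \<in> idx R" "l' mod 2 = (s j + 1) mod 2" for j l'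
  proof (cases "i = j")
    case True
    then have "l' \<noteq> l + d - 1" "l' \<noteq> l + d + 1" using j l d si by presburger+
    then show ?thesis using True expo_A_self[OF i, of "l + d" l'] by simp
  next
    case False
    show ?thesis
    proof (cases "cmat R i j = -1")
      case True
      then have "s i + s j = 1" using s i j by (auto simp: parity_function_def)
      then have "l' \<noteq> l + d" using j l d si by presburger
      then show ?thesis using False by (simp add: expo_A_other i j)
    qed (simp add: expo_A_other i j False)
  qed
  show ?thesis using out par by (auto simp: ymons_def)
qed

end

lemma ymons_iff:
  "u \<in> ymons J s \<longleftrightarrow> (\<forall>i l. i \<notin> J \<or> l mod 2 = (s i + 1) mod 2 \<longrightarrow> expon u i l = 0)"
  by (auto simp: ymons_def)

lemma ymons_add: "u \<in> ymons J s \<Longrightarrow> v \<in> ymons J s \<Longrightarrow> u + v \<in> ymons J s"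
  and ymons_diff: "u \<in> ymons J s \<Longrightarrow> v \<in> ymons J s \<Longrightarrow> u - v \<in> ymons J s"
  by (simp_all add: ymons_iff lookup_add lookup_minus)

lemma subcrystal_base: "m \<in> subcrystal Z m"
  by (simp add: subcrystal_def)

lemma subcrystal_minimal:
  assumes "T \<subseteq> els Z" "m \<in> T"
    and "\<And>x i y. x \<in> T \<Longrightarrow> i \<in> ind Z \<Longrightarrow> etil Z i x = Some y \<or> ftil Z i x = Some y \<Longrightarrow> y \<in> T"
  shows "subcrystal Z m \<subseteq> T"
  unfolding subcrystal_def by (rule Inter_lower) (simp add: assms(1,2), use assms(3) in blast)

lemma subcrystal_closed:
  assumes "x \<in> subcrystal Z m" "i \<in> ind Z" "etil Z i x = Some y \<or> ftil Z i x = Some y"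
  shows "y \<in> subcrystal Z m"
  unfolding subcrystal_def
proof (rule InterI)
  fix T assume T: "T \<in> {T. T \<subseteq> els Z \<and> m \<in> T \<and>
     (\<forall>x\<in>T. \<forall>i\<in>ind Z. \<forall>y. etil Z i x = Some y \<or> ftil Z i x = Some y \<longrightarrow> y \<in> T)}"
  then have "x \<in> T" using assms(1) unfolding subcrystal_def by (rule InterD[rotated])
  moreover have "\<forall>x\<in>T. \<forall>i\<in>ind Z. \<forall>y. etil Z i x = Some y \<or> ftil Z i x = Some y \<longrightarrow> y \<in> T"
    using T by (elim CollectE conjE)
  ultimately show "y \<in> T" using assms(2,3) by blast
qed

text \<open>
  The condition that makes \<open>Q\<close> an upper bound for the exponents in a subcrystal. The patterns \<open>u'\<close> are
  described by their exponents at the nodes of the diagram, which frees the families below from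
  parity conditions and weights.
\<close>

definition stable_thin :: "cartan_datum \<Rightarrow> ymon set \<Rightarrow> bool" where
  "stable_thin R Q \<longleftrightarrow> (\<forall>u\<in>Q. \<forall>i\<in>idx R. thin_at i u \<and>
     (\<forall>c l u'. c \<in> {-1, 1} \<and> sole_at i c l u \<and>
        (\<forall>j\<in>idx R. \<forall>l'. expon u' j l' = expon u j l' - c *
           (if i = j then (if l' = l + c - 1 \<or> l' = l + c + 1 then 1 else 0)
            else if cmat R i j = -1 \<and> l' = l + c then -1 else 0)) \<longrightarrow> u' \<in> Q))"

text \<open>On thin monomials the operators multiply by exactly those \<open>A\<^bsub>i,l\<^esub>\<^sup>\<plusminus>\<^sup>1\<close> that are allowed in \<open>stable_thin\<close>.\<close>

lemma (in monomial_crystal) subcrystal_stable_thin: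
  assumes Q: "stable_thin R Q" and m0: "m0 \<in> els C" "expo C m0 \<in> Q"
    and els: "\<And>m i c l. m \<in> els C \<Longrightarrow> i \<in> idx R \<Longrightarrow> c \<in> {-1, 1} \<Longrightarrow> sole_at i c l (expo C m) \<Longrightarrow>
      (if c = 1 then m - A i (l + 1) else m + A i (l - 1)) \<in> els C"
  shows "subcrystal C m0 \<subseteq> {m \<in> els C. expo C m \<in> Q}"
proof (rule subcrystal_minimal)
  fix m i m' assume m: "m \<in> {m \<in> els C. expo C m \<in> Q}" and "i \<in> ind C"
    and mv: "etil C i m = Some m' \<or> ftil C i m = Some m'"
  then have i: "i \<in> idx R" by (simp add: ind)
  obtain c l where c: "sole_at i c l (expo C m)" "c \<in> {-1, 0, 1}"
    using Q m i unfolding stable_thin_def thin_at_def by blast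
  have m': "c \<in> {-1, 1}" "m' = (if c = 1 then m - A i (l + 1) else m + A i (l - 1))"
    using mv c by (auto simp: etil_eq ftil_eq i veps_sole vphi_sole p_pos_sole q_pos_sole split: if_splits)
  have "expon (expo C m') j l' = expon (expo C m) j l' - c *
           (if i = j then (if l' = l + c - 1 \<or> l' = l + c + 1 then 1 else 0)
            else if cmat R i j = -1 \<and> l' = l + c then -1 else 0)" if "j \<in> idx R" for j l'
  proof -
    have "expon (expo C m') j l' = expon (expo C m) j l' - c * expon (expo C (A i (l + c))) j l'"
      using m' by (auto simp: expo_add expo_diff lookup_add lookup_minus)
    then show ?thesis using that i by (simp add: expo_A_self expo_A_other)
  qed
  then have "expo C m' \<in> Q" using Q m i c m'(1) unfolding stable_thin_def by blast
  moreover have "m' \<in> els C" using els[OF _ i m'(1) c(1)] m m'(2) by auto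
  ultimately show "m' \<in> {m \<in> els C. expo C m \<in> Q}" by simp
qed (use m0 in auto)

lemma els_step_fin:
  assumes s: "parity_function (fin_datum n) s" and m: "m \<in> els (fin_crystal n s)"
    and i: "i \<in> idx (fin_datum n)" and c: "c \<in> {-1, 1}" "sole_at i c l (expo (fin_crystal n s) m)"
  shows "(if c = 1 then m - fin_A n i (l + 1) else m + fin_A n i (l - 1)) \<in> els (fin_crystal n s)"
proof -
  interpret monomial_crystal "fin_datum n" "fin_crystal n s" "fin_A n" by (rule monomial_crystal_fin)
  have "fin_A n i (l + 1) \<in> ymons {1..n} s" "fin_A n i (l + (- 1)) \<in> ymons {1..n} s"
    using ymons_A[OF s _ i, of m c l 1] ymons_A[OF s _ i, of m c l "-1"] m c by auto
  then show ?thesis using m c by (auto intro: ymons_add ymons_diff)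
qed

lemma weight_lattice_iff:
  "\<omega> \<in> weight_lattice n \<longleftrightarrow> (\<forall>b. b \<notin> insert Dc (Hc ` {0..n}) \<longrightarrow> lookup \<omega> b = 0) \<and>
     (\<forall>i\<in>{0..n}. lookup \<omega> (Hc i) \<in> \<int>)"
  unfolding weight_lattice_def hvec_def pairing_single mem_Collect_eq subset_iff in_keys_iff mult_1_right
  by blast

lemma weight_lattice_add: "\<omega> \<in> weight_lattice n \<Longrightarrow> \<omega>' \<in> weight_lattice n \<Longrightarrow> \<omega> + \<omega>' \<in> weight_lattice n"
  and weight_lattice_diff: "\<omega> \<in> weight_lattice n \<Longrightarrow> \<omega>' \<in> weight_lattice n \<Longrightarrow> \<omega> - \<omega>' \<in> weight_lattice n"
  unfolding weight_lattice_iff by (simp_all add: lookup_add lookup_minus)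

lemma weight_lattice_simple_root:
  assumes "i \<in> {0..n}"
  shows "simple_root (aff_datum n) i \<in> weight_lattice n"
  unfolding weight_lattice_iff
proof (intro conjI allI impI ballI)
  fix b assume "b \<notin> insert Dc (Hc ` {0..n})"
  then show "lookup (simple_root (aff_datum n) i) b = 0"
    by (cases b) (auto simp: simple_root_def lookup_add lookup_sum lookup_single when_def intro!: sum.neutral)
qed (simp add: lookup_simple_root del: aff_datum_simps(2))

lemma els_step_aff:
  assumes n: "n \<ge> 2" and s: "parity_function (aff_datum n) s" and m: "m \<in> els (aff_crystal n s)"
    and i: "i \<in> idx (aff_datum n)" and c: "c \<in> {-1, 1}" "sole_at i c l (expo (aff_crystal n s) m)"
  shows "(if c = 1 then m - aff_A n i (l + 1) else m + aff_A n i (l - 1)) \<in> els (aff_crystal n s)"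
proof -
  interpret monomial_crystal "aff_datum n" "aff_crystal n s" "aff_A n" by (rule monomial_crystal_aff[OF n])
  obtain \<omega> u where m': "m = (\<omega>, u)" "\<omega> \<in> weight_lattice n" "u \<in> ymons {0..n} s"
    "\<And>j. j \<in> {0..n} \<Longrightarrow> of_int (total_expon u j) = pairing \<omega> (hvec j)"
    using m by auto
  define a where "a = snd (aff_A n i (l + c))"
  have a: "a \<in> ymons {0..n} s"
    using ymons_A[OF s _ i, of u c l c] m' c by (auto simp: a_def)
  have tot: "of_int (total_expon a j) = pairing (simple_root (aff_datum n) i) (hvec j)" if "j \<in> {0..n}" for j
  proof -
    have "total_expon a j = cmat (aff_datum n) j i"
      using level_sum_A[OF i, of j "\<lambda>_. 1 :: int" "l + c"] that i
      by (auto simp: a_def total_expon_level_sum)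
    then show ?thesis
      using that by (simp add: hvec_def pairing_single lookup_simple_root del: aff_datum_simps(2))
  qed
  have A: "aff_A n i (l + c) = (simple_root (aff_datum n) i, a)"
    by (simp add: a_def aff_A_def)
  have root: "simple_root (aff_datum n) i \<in> weight_lattice n"
    using i by (intro weight_lattice_simple_root) simp
  have "total_expon (u - a) j = total_expon u j - total_expon a j" for j
    by (simp add: total_expon_level_sum level_sum_diff)
  then have "m - aff_A n i (l + c) \<in> els (aff_crystal n s)" "m + aff_A n i (l + c) \<in> els (aff_crystal n s)"
    unfolding A m'(1) using a root m' tot
    by (auto simp: ymons_add ymons_diff weight_lattice_add weight_lattice_diff total_expon_add
        pairing_add_left pairing_diff_left)
  then show ?thesis using c(1) by auto
qed

section \<open>Thinness of the crystals\<close>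

text \<open>
  The monomials of a fundamental crystal of type \<open>A\<^sub>n\<close>, and those of the affine crystal for the
  middle node, come from a height function \<open>g\<close> on the nodes with
  steps \<open>\<plusminus>1\<close>, with \<open>Y\<^bsub>i,g i\<^esub>\<close> at each local minimum and \<open>Y\<^bsub>i,g i\<^esub>\<^sup>-\<^sup>1\<close> at each local maximum. The
  operators turn a local minimum into a local maximum and conversely. Here \<open>a i\<close> and \<open>b i\<close> are the
  two neighbours of \<open>i\<close>, and the heights outside the diagram are fixed boundary values.
\<close>

definition height_family :: "nat set \<Rightarrow> (nat \<Rightarrow> nat) \<Rightarrow> (nat \<Rightarrow> nat) \<Rightarrow> (nat \<Rightarrow> int) \<Rightarrow> ymon set" where
  "height_family J a b g0 = {u. \<exists>g. (\<forall>x. x \<notin> J \<longrightarrow> g x = g0 x) \<and>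
     (\<forall>j\<in>J. \<bar>g j - g (a j)\<bar> = 1 \<and> \<bar>g j - g (b j)\<bar> = 1) \<and>
     (\<forall>j\<in>J. sole_at j ((g (a j) + g (b j) - 2 * g j) div 2) (g j) u)}"

text \<open>
  Changing \<open>g i\<close> from a local minimum \<open>l\<close> to the local maximum \<open>l + 2\<close> raises the second difference of
  \<open>g\<close> at each neighbour by one; these neighbours have height \<open>l + 1\<close>. This is the effect of
  \<open>A\<^bsub>i,l+1\<^esub>\<^sup>-\<^sup>1\<close> on the exponents.
\<close>

lemma stable_thin_height_family:
  assumes nb: "\<And>i j. i \<in> idx R \<Longrightarrow> j \<in> idx R \<Longrightarrow> a j = i \<longleftrightarrow> b i = j"
    and ne: "\<And>j. j \<in> idx R \<Longrightarrow> a j \<noteq> j \<and> b j \<noteq> j \<and> a j \<noteq> b j"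
    and cm: "\<And>i j. i \<in> idx R \<Longrightarrow> j \<in> idx R \<Longrightarrow> cmat R i j = -1 \<longleftrightarrow> j = a i \<or> j = b i"
  shows "stable_thin R (height_family (idx R) a b g0)"
  unfolding stable_thin_def
proof (intro ballI conjI allI impI)
  fix u i assume "u \<in> height_family (idx R) a b g0" and i: "i \<in> idx R"
  then obtain g where g0: "\<And>x. x \<notin> idx R \<Longrightarrow> g x = g0 x"
    and step: "\<And>j. j \<in> idx R \<Longrightarrow> \<bar>g j - g (a j)\<bar> = 1 \<and> \<bar>g j - g (b j)\<bar> = 1"
    and u: "\<And>j. j \<in> idx R \<Longrightarrow> sole_at j ((g (a j) + g (b j) - 2 * g j) div 2) (g j) u"
    unfolding height_family_def by blast
  have curv: "(g (a j) + g (b j) - 2 * g j) div 2 \<in> {-1, 0, 1}" if "j \<in> idx R" for j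
    using step[OF that] by (auto simp: abs_if split: if_splits)
  show "thin_at i u" unfolding thin_at_def using u[OF i] curv[OF i] by blast
  fix c l u'
  assume "c \<in> {-1, 1} \<and> sole_at i c l u \<and> (\<forall>j\<in>idx R. \<forall>l'. expon u' j l' = expon u j l' - c *
           (if i = j then (if l' = l + c - 1 \<or> l' = l + c + 1 then 1 else 0)
            else if cmat R i j = -1 \<and> l' = l + c then -1 else 0))"
  then have c: "c = -1 \<or> c = 1" "sole_at i c l u"
    and u': "\<And>j l'. j \<in> idx R \<Longrightarrow> expon u' j l' = expon u j l' - c *
           (if i = j then (if l' = l + c - 1 \<or> l' = l + c + 1 then 1 else 0)
            else if cmat R i j = -1 \<and> l' = l + c then -1 else 0)" by auto
  have ci: "c = (g (a i) + g (b i) - 2 * g i) div 2" "l = g i"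
    using sole_at_unique[OF c(2) u[OF i]] c(1) by auto
  \<comment> \<open>\<open>c = 1\<close> is a local minimum that is raised, \<open>c = -1\<close> a local maximum that is lowered\<close>
  have gab: "g (a i) = l + c" "g (b i) = l + c"
    using ci c(1) step[OF i] by (auto simp: abs_if split: if_splits)
  define g' where "g' = g(i := l + 2 * c)"
  have "\<bar>g' j - g' (a j)\<bar> = 1 \<and> \<bar>g' j - g' (b j)\<bar> = 1" if j: "j \<in> idx R" for j
  proof (cases "j = i")
    case True
    then show ?thesis using ne[OF i] gab c(1) by (auto simp: g'_def)
  next
    case False
    have "a j = i \<Longrightarrow> g j = l + c" "b j = i \<Longrightarrow> g j = l + c"
      using nb[OF i j] nb[OF j i] gab by auto
    then show ?thesis using False step[OF j] c(1) by (auto simp: g'_def)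
  qed
  moreover have "sole_at j ((g' (a j) + g' (b j) - 2 * g' j) div 2) (g' j) u'" if j: "j \<in> idx R" for j
  proof (cases "j = i")
    case True
    have "(g' (a i) + g' (b i) - 2 * g' i) div 2 = - c"
      using ne[OF i] gab c(1) by (auto simp: g'_def)
    moreover have "expon u' i l' = (if l' = g' i then - c else 0)" for l'
      using u'[OF i, of l'] c by (auto simp: sole_at_def g'_def)
    ultimately show ?thesis using True by (simp add: sole_at_def)
  next
    case False
    let ?k = "(g (a j) + g (b j) - 2 * g j) div 2"
    have ex: "expon u j l' = (if l' = g j then ?k else 0)" for l'
      using u[OF j] by (simp add: sole_at_def)
    show ?thesis
    proof (cases "a j = i \<or> b j = i")
      case True
      have gj: "g j = l + c" using True nb[OF i j] nb[OF j i] gab by auto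
      have adj: "cmat R i j = -1" using True nb[OF i j] nb[OF j i] cm[OF i j] by auto
      have "(g' (a j) + g' (b j) - 2 * g' j) = (g (a j) + g (b j) - 2 * g j) + c * 2"
        using True ne[OF j] False ci(2) by (auto simp: g'_def)
      then have "(g' (a j) + g' (b j) - 2 * g' j) div 2 = ?k + c" by simp
      moreover have "expon u' j l' = (if l' = g j then ?k + c else 0)" for l'
        using u'[OF j, of l'] ex[of l'] False adj gj by auto
      ultimately show ?thesis using False by (simp add: sole_at_def g'_def)
    next
      case no: False
      then have "cmat R i j \<noteq> -1" using nb[OF i j] nb[OF j i] cm[OF i j] by auto
      then have "expon u' j l' = expon u j l'" for l' using u'[OF j, of l'] False by simp
      then show ?thesis using u[OF j] no False by (simp add: sole_at_def g'_def)
    qed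
  qed
  moreover have "\<And>x. x \<notin> idx R \<Longrightarrow> g' x = g0 x" using g0 i by (auto simp: g'_def)
  ultimately show "u' \<in> height_family (idx R) a b g0"
    unfolding height_family_def by blast
qed

text \<open>
  For the first and the last node the affine crystal is a single particle moving around the cyclic
  diagram. Each revolution raises the levels by \<open>n + 1\<close>, so the monomials are indexed by all integers \<open>j\<close>
  and do not come from a height function on the cyclic diagram.
\<close>

definition particle_family :: "nat set \<Rightarrow> (int \<Rightarrow> nat) \<Rightarrow> ymon set" where
  "particle_family J a = {u. \<exists>j. \<forall>i\<in>J. \<forall>l. expon u i l =
     (if i = a j \<and> l = j - 1 then 1 else if i = a (j - 1) \<and> l = j then -1 else 0)}"

lemma stable_thin_particle_family:
  assumes a: "\<And>j. a j \<in> idx R" and ne: "\<And>j. a j \<noteq> a (j + 1)" "\<And>j. a (j - 1) \<noteq> a (j + 1)"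
    and cm: "\<And>i j. i \<in> idx R \<Longrightarrow> cmat R (a j) i = -1 \<longleftrightarrow> i = a (j - 1) \<or> i = a (j + 1)"
  shows "stable_thin R (particle_family (idx R) a)"
  unfolding stable_thin_def
proof (intro ballI conjI allI impI)
  fix u i assume "u \<in> particle_family (idx R) a" and i: "i \<in> idx R"
  then obtain j where u: "\<And>i l. i \<in> idx R \<Longrightarrow> expon u i l =
      (if i = a j \<and> l = j - 1 then 1 else if i = a (j - 1) \<and> l = j then -1 else 0)"
    unfolding particle_family_def by blast
  have nj: "a j \<noteq> a (j - 1)" "a (j - 1) \<noteq> a (j + 1)" "a j \<noteq> a (j + 1)" "a (j - 2) \<noteq> a j" "a (j - 2) \<noteq> a (j - 1)"
    using ne(1)[of j] ne(1)[of "j - 1"] ne(2)[of j] ne(2)[of "j - 1"] ne(1)[of "j - 2"] by (auto simp: algebra_simps)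
  have sole: "sole_at i (if i = a j then 1 else if i = a (j - 1) then -1 else 0) (if i = a j then j - 1 else j) u"
    if "i \<in> idx R" for i
    using u[OF that] nj by (auto simp: sole_at_def)
  show "thin_at i u" unfolding thin_at_def
    by (rule exI, rule exI, rule conjI[OF _ sole[OF i]]) simp
  fix c l u'
  assume "c \<in> {-1, 1} \<and> sole_at i c l u \<and> (\<forall>j\<in>idx R. \<forall>l'. expon u' j l' = expon u j l' - c *
           (if i = j then (if l' = l + c - 1 \<or> l' = l + c + 1 then 1 else 0)
            else if cmat R i j = -1 \<and> l' = l + c then -1 else 0))"
  then have c: "c = -1 \<or> c = 1" "sole_at i c l u"
    and u': "\<And>j l'. j \<in> idx R \<Longrightarrow> expon u' j l' = expon u j l' - c *
           (if i = j then (if l' = l + c - 1 \<or> l' = l + c + 1 then 1 else 0)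
            else if cmat R i j = -1 \<and> l' = l + c then -1 else 0)" by auto
  have "c = 1 \<and> i = a j \<and> l = j - 1 \<or> c = -1 \<and> i = a (j - 1) \<and> l = j"
    using sole_at_unique[OF c(2) sole[OF i]] c(1) by (auto split: if_splits)
  then show "u' \<in> particle_family (idx R) a"
  proof (elim disjE conjE)
    assume d: "c = 1" "i = a j" "l = j - 1"
    have "expon u' k l' = (if k = a (j + 1) \<and> l' = j + 1 - 1 then 1 else if k = a (j + 1 - 1) \<and> l' = j + 1 then -1 else 0)"
      if k: "k \<in> idx R" for k l'
      using u'[OF k, of l'] u[OF k, of l'] cm[OF k, of j] nj d by auto
    then show ?thesis unfolding particle_family_def by blast
  next
    assume d: "c = -1" "i = a (j - 1)" "l = j"
    have "expon u' k l' = (if k = a (j - 1) \<and> l' = (j - 1) - 1 then 1 else if k = a ((j - 1) - 1) \<and> l' = j - 1 then -1 else 0)"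
      if k: "k \<in> idx R" for k l'
    proof -
      have "cmat R (a (j - 1)) k = -1 \<longleftrightarrow> k = a (j - 2) \<or> k = a j"
        using cm[OF k, of "j - 1"] by simp
      moreover have "j - 1 - 1 = j - 2" by simp
      ultimately show ?thesis
        unfolding u'[OF k] u[OF k] d using nj
        by (cases "k = a j"; cases "k = a (j - 1)"; cases "k = a (j - 2)"; simp)
    qed
    then show ?thesis unfolding particle_family_def by blast
  qed
qed

subsection \<open>Type \<open>A\<^sub>n\<close>\<close>

abbreviation fin_heights :: "nat \<Rightarrow> nat \<Rightarrow> int \<Rightarrow> ymon set" where
  "fin_heights n l k \<equiv> height_family {1..n} (\<lambda>j. j - 1) (\<lambda>j. j + 1) (\<lambda>x. k + \<bar>int x - int l\<bar>)"

lemma stable_thin_fin: "stable_thin (fin_datum n) (fin_heights n l k)"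
proof -
  have "stable_thin (fin_datum n) (height_family (idx (fin_datum n)) (\<lambda>j. j - 1) (\<lambda>j. j + 1) (\<lambda>x. k + \<bar>int x - int l\<bar>))"
    by (rule stable_thin_height_family) (auto split: if_splits)
  then show ?thesis by simp
qed

lemma fundamental_in_fin_heights:
  assumes "1 \<le> l" "l \<le> n"
  shows "Yv l k \<in> fin_heights n l k"
  unfolding height_family_def
proof (intro CollectI exI[of _ "\<lambda>x. k + \<bar>int x - int l\<bar>"] conjI ballI)
  fix j assume j: "j \<in> {1..n}"
  then have "int (j - 1) = int j - 1" by auto
  then show "\<bar>k + \<bar>int j - int l\<bar> - (k + \<bar>int (j - 1) - int l\<bar>)\<bar> = 1"
    "\<bar>k + \<bar>int j - int l\<bar> - (k + \<bar>int (j + 1) - int l\<bar>)\<bar> = 1"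
    "sole_at j ((k + \<bar>int (j - 1) - int l\<bar> + (k + \<bar>int (j + 1) - int l\<bar>) - 2 * (k + \<bar>int j - int l\<bar>)) div 2)
      (k + \<bar>int j - int l\<bar>) (Yv l k)"
    by (auto simp: sole_at_def expon_Yv abs_if)
qed auto

text \<open>A height function starts at the fixed value \<open>g 0\<close> and makes steps \<open>\<plusminus>1\<close>, so only finitely many levels occur.\<close>

lemma finite_fin_heights: "finite (ymons {1..n} s \<inter> fin_heights n l k)"
proof -
  let ?K = "{1..n} \<times> {k + int l - int n..k + int l + int n}"
  let ?F = "{f :: nat \<times> int \<Rightarrow> int. \<forall>x. (x \<in> ?K \<longrightarrow> f x \<in> {-1, 0, 1}) \<and> (x \<notin> ?K \<longrightarrow> f x = 0)}"
  have "lookup u \<in> ?F" if u: "u \<in> ymons {1..n} s" "u \<in> fin_heights n l k" for u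
  proof -
    obtain g where g: "g 0 = k + int l"
      and step: "\<And>j. j \<in> {1..n} \<Longrightarrow> \<bar>g j - g (j - 1)\<bar> = 1 \<and> \<bar>g j - g (j + 1)\<bar> = 1"
      and sole: "\<And>j. j \<in> {1..n} \<Longrightarrow> sole_at j ((g (j - 1) + g (j + 1) - 2 * g j) div 2) (g j) u"
      using u(2) unfolding height_family_def by auto
    have bound: "j \<le> n \<Longrightarrow> \<bar>g j - (k + int l)\<bar> \<le> int j" for j
    proof (induction j)
      case (Suc j)
      then show ?case using step[of "Suc j"] by auto
    qed (simp add: g)
    have "expon u i l' \<in> {-1, 0, 1} \<and> ((i, l') \<notin> ?K \<longrightarrow> expon u i l' = 0)" for i l'
    proof (cases "i \<in> {1..n}")
      case True
      have "(g (i - 1) + g (i + 1) - 2 * g i) div 2 \<in> {-1, 0, 1}"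
        using step[OF True] by (auto simp: abs_if split: if_splits)
      moreover have "g i \<in> {k + int l - int n..k + int l + int n}" using bound[of i] True by auto
      ultimately show ?thesis using sole[OF True] True by (auto simp: sole_at_def)
    next
      case False
      then show ?thesis using u(1) by (auto simp: ymons_iff)
    qed
    then show ?thesis by auto
  qed
  then have "lookup ` (ymons {1..n} s \<inter> fin_heights n l k) \<subseteq> ?F" by auto
  moreover have "finite ?F" by (rule finite_set_of_finite_funs) auto
  ultimately have "finite (lookup ` (ymons {1..n} s \<inter> fin_heights n l k))"
    by (rule finite_subset)
  then show ?thesis by (rule finite_imageD) (rule inj_onI, rule poly_mapping_eqI, simp)
qed

text \<open>Half the sum of the positive coroots, which takes the value \<open>1\<close> at every simple root.\<close>

definition rho_check :: "nat \<Rightarrow> cartan_elt" where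
  "rho_check n = (\<Sum>i\<in>{1..n}. single (Hc i) (of_nat i * (of_nat n + 1 - of_nat i) / 2))"

lemma pairing_sum_right: "pairing \<omega> (sum f A) = (\<Sum>a\<in>A. pairing \<omega> (f a))"
  by (induction A rule: infinite_finite_induct) (simp_all add: pairing_add_right)

lemma rho_check_cart: "rho_check n \<in> cart (fin_datum n)"
proof -
  have "lookup (rho_check n) b = 0" if "b \<notin> Hc ` {1..n}" for b
    unfolding rho_check_def lookup_sum
    by (rule sum.neutral) (use that in \<open>auto simp: lookup_single when_def\<close>)
  then show ?thesis unfolding fin_datum_simps mem_Collect_eq subset_iff in_keys_iff by blast
qed

text \<open>The pairing is minus the second difference of the quadratic function \<open>i (n + 1 - i) / 2\<close>, which vanishes at \<open>0\<close> and \<open>n + 1\<close>.\<close>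

lemma pairing_root_rho:
  assumes j: "j \<in> {1..n}"
  shows "pairing (simple_root (fin_datum n) j) (rho_check n) = 1"
proof -
  define c :: "nat \<Rightarrow> rat" where "c i = of_nat i * (of_nat n + 1 - of_nat i) / 2" for i
  have "pairing (simple_root (fin_datum n) j) (rho_check n) = (\<Sum>i\<in>{1..n}. of_int (cmat (fin_datum n) i j) * c i)"
    by (simp add: rho_check_def pairing_sum_right pairing_single lookup_simple_root c_def del: fin_datum_simps(2))
  also have "\<dots> = (\<Sum>i\<in>{1..n}. (if i = j then 2 * c i else 0) - (if i = Suc j then c i else 0)
      - (if i = j - 1 then c i else 0))"
    using j by (intro sum.cong) auto
  also have "\<dots> = 2 * c j - (if Suc j \<le> n then c (Suc j) else 0) - (if 1 \<le> j - 1 then c (j - 1) else 0)"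
    using j by (auto simp: sum_subtractf)
  also have "\<dots> = 2 * c j - c (Suc j) - c (j - 1)"
  proof -
    have "c (Suc j) = 0" if "\<not> Suc j \<le> n"
    proof -
      have "j = n" using that j by simp
      then show ?thesis by (simp add: c_def)
    qed
    moreover have "c (j - 1) = 0" if "\<not> 1 \<le> j - 1"
    proof -
      have "j - 1 = 0" using that by simp
      then show ?thesis by (simp add: c_def)
    qed
    ultimately show ?thesis by auto
  qed
  also have "\<dots> = 1"
  proof -
    obtain i where "j = Suc i" using j by (cases j) auto
    then show ?thesis by (simp add: c_def field_simps)
  qed
  finally show ?thesis .
qed

section \<open>Fundamental modules\<close>

locale fundamental_highest_weight = quantum_module "fin_datum n" t W + generic_parameter t
  for n t and W :: "(freealg set, 'w) module" +
  fixes l :: nat and k :: int and v :: 'w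
  assumes l: "1 \<le> l" "l \<le> n"
    and lhw: "lhw_vector n t (\<lambda>i. if i = l then [:1, - qpi t k:] else 1) W v"
begin

lemma highest_weight:
  "(\<Sum>i\<in>{1..n}. single (Hc i) (of_nat (degree (if i = l then [:1, - qpi t k:] else 1)))) = fund_weight l"
proof -
  have "(\<Sum>i\<in>{1..n}. single (Hc i) (of_nat (degree (if i = l then [:1, - qpi t k:] else 1))))
      = (\<Sum>i\<in>{1..n}. if i = l then single (Hc i) (1 :: rat) else 0)"
    by (intro sum.cong) auto
  then show ?thesis using l by (simp add: fund_weight_def)
qed

lemma v: "v \<in> carrier W" "v \<noteq> \<zero>\<^bsub>W\<^esub>"
  and X_v: "i \<in> {1..n} \<Longrightarrow> opr (gn (X Pos i r)) v = \<zero>\<^bsub>W\<^esub>"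
  and phi_v: "i \<in> {1..n} \<Longrightarrow> opr (phi_elt t e i (sg e * int m)) v
    = opr (cst (fps_nth (phi_series t e (if i = l then 1 else 0) k) m)) v"
  using lhw unfolding lhw_vector_def Let_def drinfeld_series_fundamental
  by (simp_all add: opr_def ux_def uphi_def usc_def)

lemma K_v: "h \<in> cart (fin_datum n) \<Longrightarrow> opr (gn (K h)) v = opr (cst (qpow t (pairing (fund_weight l) h))) v"
  using lhw unfolding lhw_vector_def Let_def fin_datum_simps(1) highest_weight
  by (simp add: opr_def uk_def usc_def)

lemma sole_Yv: "sole_at i (if i = l then 1 else 0) k (Yv l k)"
  by (simp add: sole_at_def expon_Yv)

lemma H_v:
  assumes i: "i \<in> {1..n}" and m: "m \<noteq> 0"
  shows "opr (gn (H i m)) v = opr (cst (h_value t i m (Yv l k))) v"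
proof -
  have i': "i \<in> idx (fin_datum n)" using i by simp
  let ?c = "if i = l then 1 else 0 :: int"
  show ?thesis
  proof (rule H_eigenvalue_of_monomial[OF generic_parameter_axioms v(1) i' m sole_Yv])
    fix e
    have "pairing (fund_weight l) (single (Hc i) (of_int (sg e))) = of_int (sg e * ?c)"
      by (auto simp: fund_weight_def pairing_single lookup_single when_def)
    then show "opr (gn (K (single (Hc i) (of_int (sg e))))) v = opr (cst (qpi t (sg e * ?c))) v"
      using K_v[OF cart_coroot[OF i']] by (simp only:)
  qed (simp_all add: phi_v[OF i])
qed

end

theorem (in generic_parameter) fundamental_module_unique:
  assumes "1 \<le> l" "l \<le> n"
    and V: "is_fundamental_module n t l k V" and W: "is_fundamental_module n t l k W"
  shows "module_iso (quantum_alg (fin_datum n) t) V W"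
proof -
  obtain v w where vw: "lhw_vector n t (\<lambda>i. if i = l then [:1, - qpi t k:] else 1) V v"
    "lhw_vector n t (\<lambda>i. if i = l then [:1, - qpi t k:] else 1) W w"
    using V W unfolding is_fundamental_module_def by blast
  have mods: "quantum_module (fin_datum n) t V" "quantum_module (fin_datum n) t W"
    using V W simply_laced_fin unfolding is_fundamental_module_def quantum_module_def by blast+
  interpret V: fundamental_highest_weight n t V l k v
    using mods(1) vw(1) assms(1,2) generic_parameter_axioms
    by (intro fundamental_highest_weight.intro fundamental_highest_weight_axioms.intro)
  interpret W: fundamental_highest_weight n t W l k w
    using mods(2) vw(2) assms(1,2) generic_parameter_axioms
    by (intro fundamental_highest_weight.intro fundamental_highest_weight_axioms.intro)
  interpret same_highest_weight "fin_datum n" t V W v w "rho_check n" "qpow t (pairing (fund_weight l) (rho_check n))"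
  proof unfold_locales
    fix i and m :: int assume "i \<in> idx (fin_datum n)" "m \<noteq> 0"
    then show "\<exists>c. V.opr (gn (H i m)) v = V.opr (cst c) v \<and> W.opr (gn (H i m)) w = W.opr (cst c) w"
      using V.H_v W.H_v by (metis fin_datum_simps(1))
  next
    fix h assume "h \<in> cart (fin_datum n)"
    then show "\<exists>c. V.opr (gn (K h)) v = V.opr (cst c) v \<and> W.opr (gn (K h)) w = W.opr (cst c) w"
      using V.K_v W.K_v by blast
  next
    show "simple_module (quantum_alg (fin_datum n) t) V" "simple_module (quantum_alg (fin_datum n) t) W"
      using V W by (simp_all add: is_fundamental_module_def)
  next
    show "V.opr (gn (K (rho_check n))) v = V.opr (cst (qpow t (pairing (fund_weight l) (rho_check n)))) v"
      "W.opr (gn (K (rho_check n))) w = W.opr (cst (qpow t (pairing (fund_weight l) (rho_check n)))) w"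
      by (rule V.K_v[OF rho_check_cart], rule W.K_v[OF rho_check_cart])
  qed (simp_all add: V.v W.v V.X_v W.X_v rho_check_cart pairing_root_rho del: fin_datum_simps(2,3))
  show ?thesis by (rule isomorphic)
qed

locale fundamental_crystal = generic_parameter t for t +
  fixes n l :: nat and k :: int and s :: "nat \<Rightarrow> int"
  assumes l: "1 \<le> l" "l \<le> n"
    and parity: "parity_function (fin_datum n) s"
    and els: "Yv l k \<in> els (fin_crystal n s)"
begin

abbreviation S :: "ymon set" where
  "S \<equiv> subcrystal (fin_crystal n s) (Yv l k)"

lemma S_subset: "S \<subseteq> {m \<in> els (fin_crystal n s). expo (fin_crystal n s) m \<in> fin_heights n l k}"
  by (rule monomial_crystal.subcrystal_stable_thin[OF monomial_crystal_fin stable_thin_fin els])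
    (use fundamental_in_fin_heights[OF l] els_step_fin[OF parity] in simp_all)

sublocale connected_thin_crystal "fin_datum n" t "fin_crystal n s" "fin_A n" S "Yv l k"
proof (intro connected_thin_crystal.intro thin_crystal.intro monomial_crystal_fin generic_parameter_axioms
    thin_crystal_axioms.intro connected_thin_crystal_axioms.intro)
  fix m i assume m: "m \<in> S" and i: "i \<in> idx (fin_datum n)"
  show "pairing (wt (fin_crystal n s) m) (hvec i) = of_int (total_expon (expo (fin_crystal n s) m) i)"
    using i by (simp add: hvec_def pairing_single lookup_wt_fin)
  show "thin_at i (expo (fin_crystal n s) m)"
    using S_subset m stable_thin_fin[where n = n and l = l and k = k] i unfolding stable_thin_def by blast
next
  fix m i m' assume "m \<in> S" "i \<in> idx (fin_datum n)" "etil (fin_crystal n s) i m = Some m'"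
  then show "m' \<in> S" using subcrystal_closed[of m "fin_crystal n s" "Yv l k" i m'] by simp
next
  fix m i m' assume "m \<in> S" "i \<in> idx (fin_datum n)" "ftil (fin_crystal n s) i m = Some m'"
  then show "m' \<in> S" using subcrystal_closed[of m "fin_crystal n s" "Yv l k" i m'] by simp
next
  fix m m' assume m: "m \<in> S" "m' \<in> S"
    and eq: "\<And>i l. i \<in> idx (fin_datum n) \<Longrightarrow>
      expon (expo (fin_crystal n s) m) i l = expon (expo (fin_crystal n s) m') i l"
  have "m \<in> ymons {1..n} s" "m' \<in> ymons {1..n} s" using m S_subset by auto
  then have "expon m i l = expon m' i l" for i l
    using eq[of i l] by (cases "i \<in> {1..n}") (auto simp: ymons_iff)
  then show "m = m'" by (intro poly_mapping_eqI) auto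
next
  show "Yv l k \<in> S" by (rule subcrystal_base)
next
  fix T assume T: "T \<subseteq> S" "Yv l k \<in> T"
    and cl: "\<And>m i m'. m \<in> T \<Longrightarrow> i \<in> idx (fin_datum n) \<Longrightarrow>
      etil (fin_crystal n s) i m = Some m' \<or> ftil (fin_crystal n s) i m = Some m' \<Longrightarrow> m' \<in> T"
  show "S \<subseteq> T"
    by (rule subcrystal_minimal) (use T S_subset cl in \<open>auto simp del: fin_crystal_simps(1)\<close>)
qed

lemma is_fundamental_V: "is_fundamental_module n t l k V"
proof -
  let ?v = "bvec (Some (Yv l k)) :: ymon \<Rightarrow>\<^sub>0 complex"
  have v: "?v \<in> crystal_space S" using m0 by (simp add: crystal_space_single)
  have v0: "?v \<noteq> 0" by (metis bvec.simps(2) lookup_single_eq lookup_zero zero_neq_one)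
  have sole: "sole_at i (if i = l then 1 else 0) k (Yv l k)" for i
    by (simp add: sole_at_def expon_Yv)
  have "finite S" by (rule finite_subset[OF _ finite_fin_heights[where n = n and s = s and l = l and k = k]]) (use S_subset in auto)
  moreover have "lhw_vector n t (\<lambda>i. if i = l then [:1, - qpi t k:] else 1) V ?v"
    unfolding lhw_vector_def Let_def
  proof (intro conjI ballI allI impI)
    show "?v \<in> carrier V" "?v \<noteq> \<zero>\<^bsub>V\<^esub>" using v v0 by simp_all
  next
    fix i r assume i: "i \<in> idx (fin_datum n)"
    have "move Pos i (Yv l k) = None"
      using move_None[OF i, of _ k "Yv l k" Pos] sole[of i] by (cases "i = l") auto
    then show "ux (fin_datum n) t Pos i r \<odot>\<^bsub>V\<^esub> ?v = \<zero>\<^bsub>V\<^esub>"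
      using v i by (simp add: ux_def quotient_act_cls falg_gn)
  next
    fix i e m assume i: "i \<in> idx (fin_datum n)"
    show "uphi (fin_datum n) t e i (sg e * int m) \<odot>\<^bsub>V\<^esub> ?v = usc (fin_datum n) t
        (fps_nth (drinfeld_series t e (if i = l then [:1, - qpi t k:] else 1)) m) \<odot>\<^bsub>V\<^esub> ?v"
      using phi_act[OF m0 i, of _ k e m] sole[of i] v i
      by (simp add: uphi_def usc_def quotient_act_cls falg_phi_elt alg_act_cst drinfeld_series_fundamental
          del: bvec.simps)
  next
    fix h assume h: "h \<in> cart (fin_datum n)"
    have "(\<Sum>i\<in>idx (fin_datum n). single (Hc i) (of_nat (degree (if i = l then [:1, - qpi t k:] else 1))))
        = wt (fin_crystal n s) (Yv l k)"
      unfolding wt_fin fin_datum_simps(1)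
      by (intro sum.cong) (auto simp: total_expon_level_sum level_sum_Yv)
    then show "uk (fin_datum n) t h \<odot>\<^bsub>V\<^esub> ?v = usc (fin_datum n) t (qpow t (pairing
        (\<Sum>i\<in>idx (fin_datum n). single (Hc i) (of_nat (degree (if i = l then [:1, - qpi t k:] else 1)))) h)) \<odot>\<^bsub>V\<^esub> ?v"
      using v h by (simp add: uk_def usc_def quotient_act_cls falg_gn alg_act_cst del: fin_datum_simps)
  next
    fix N assume "submodule N (quantum_alg (fin_datum n) t) V \<and> ?v \<in> N"
    then show "N = carrier V" using simple_V v0 by (auto simp: simple_module_def)
  qed
  ultimately show ?thesis
    unfolding is_fundamental_module_def using left_module_quotient_act simple_V fin_dimensional_V by blast
qed

end

section \<open>Extremal fundamental loop weight modules\<close>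

lemma stable_thin_aff_heights:
  assumes n: "n \<ge> 2"
  shows "stable_thin (aff_datum n) (height_family {0..n} (\<lambda>j. (j + n) mod Suc n) (\<lambda>j. (j + 1) mod Suc n) g0)"
proof -
  have "stable_thin (aff_datum n)
      (height_family (idx (aff_datum n)) (\<lambda>j. (j + n) mod Suc n) (\<lambda>j. (j + 1) mod Suc n) g0)"
  proof (rule stable_thin_height_family)
    fix i j assume "i \<in> idx (aff_datum n)" "j \<in> idx (aff_datum n)"
    then have ij: "i \<le> n" "j \<le> n" by simp_all
    then show "(j + n) mod Suc n = i \<longleftrightarrow> (i + 1) mod Suc n = j"
      using cyclic_succ[OF ij(1)] cyclic_pred[OF ij(2)] by (auto split: if_splits)
    have "cmat (aff_datum n) i j = -1 \<longleftrightarrow> j \<in> {j \<in> {0..n}. cmat (aff_datum n) i j = -1}"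
      using ij by (simp del: aff_datum_simps(2))
    then show "cmat (aff_datum n) i j = -1 \<longleftrightarrow> j = (i + n) mod Suc n \<or> j = (i + 1) mod Suc n"
      unfolding aff_neighbours(1)[OF n ij(1)] by simp
  next
    fix j assume "j \<in> idx (aff_datum n)"
    then have j: "j \<le> n" by simp
    then show "(j + n) mod Suc n \<noteq> j \<and> (j + 1) mod Suc n \<noteq> j \<and> (j + n) mod Suc n \<noteq> (j + 1) mod Suc n"
      using cyclic_succ[OF j] cyclic_pred[OF j] n aff_neighbours(2)[OF n j] by (auto split: if_splits)
  qed
  then show ?thesis by simp
qed

text \<open>
  The function \<open>\<bar>x - (r + 1)\<bar>\<close> closes up on the cyclic diagram exactly because \<open>r + 1\<close> is half of the
  number \<open>n + 1\<close> of nodes: its values at \<open>0\<close> and \<open>n + 1\<close> agree.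
\<close>

lemma middle_monomial_heights:
  assumes r: "r \<ge> 1" and n: "n = 2 * r + 1"
  shows "snd (loop_monomial n (r + 1)) \<in>
    height_family {0..n} (\<lambda>j. (j + n) mod Suc n) (\<lambda>j. (j + 1) mod Suc n) (\<lambda>x. \<bar>int x - int (r + 1)\<bar>)"
  unfolding height_family_def
proof (intro CollectI exI[of _ "\<lambda>x. \<bar>int x - int (r + 1)\<bar>"] conjI ballI)
  fix j assume "j \<in> {0..n}"
  then have j: "j \<le> n" by simp
  have u: "expon (snd (loop_monomial n (r + 1))) i l' =
      (if i = r + 1 \<and> l' = 0 then 1 else if i = 0 \<and> l' = int (r + 1) then -1 else 0)" for i l'
    using n by (auto simp: loop_monomial_def lookup_minus expon_Yv)
  consider "j = 0" | "0 < j" "j < n" | "j = n" "j > 0" using j by linarith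
  then have all: "\<bar>\<bar>int j - int (r + 1)\<bar> - \<bar>int ((j + n) mod Suc n) - int (r + 1)\<bar>\<bar> = 1 \<and>
    \<bar>\<bar>int j - int (r + 1)\<bar> - \<bar>int ((j + 1) mod Suc n) - int (r + 1)\<bar>\<bar> = 1 \<and>
    (\<bar>int ((j + n) mod Suc n) - int (r + 1)\<bar> + \<bar>int ((j + 1) mod Suc n) - int (r + 1)\<bar>
      - 2 * \<bar>int j - int (r + 1)\<bar>) div 2 = (if j = r + 1 then 1 else if j = 0 then -1 else 0)"
  proof cases
    case 1
    then show ?thesis using r n cyclic_succ[OF j] cyclic_pred[OF j] by (simp add: abs_if)
  next
    case 2
    then have "int (j - 1) = int j - 1" by auto
    then show ?thesis using 2 r n cyclic_succ[OF j] cyclic_pred[OF j] by (auto simp: abs_if)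
  next
    case 3
    then have "int (j - 1) = int j - 1" by auto
    then show ?thesis using 3 r n cyclic_succ[OF j] cyclic_pred[OF j] by (auto simp: abs_if)
  qed
  then show "\<bar>\<bar>int j - int (r + 1)\<bar> - \<bar>int ((j + n) mod Suc n) - int (r + 1)\<bar>\<bar> = 1"
    "\<bar>\<bar>int j - int (r + 1)\<bar> - \<bar>int ((j + 1) mod Suc n) - int (r + 1)\<bar>\<bar> = 1" by blast+
  from all show "sole_at j ((\<bar>int ((j + n) mod Suc n) - int (r + 1)\<bar> + \<bar>int ((j + 1) mod Suc n) - int (r + 1)\<bar>
      - 2 * \<bar>int j - int (r + 1)\<bar>) div 2) \<bar>int j - int (r + 1)\<bar> (snd (loop_monomial n (r + 1)))"
    unfolding sole_at_def u by auto
qed auto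

text \<open>The position of the particle, moving forwards (\<open>\<sigma> = 1\<close>) or backwards (\<open>\<sigma> = -1\<close>).\<close>

definition cyclic_walk :: "nat \<Rightarrow> int \<Rightarrow> int \<Rightarrow> nat" where
  "cyclic_walk n \<sigma> j = nat ((\<sigma> * j) mod int (Suc n))"

lemma cyclic_walk_neighbours:
  assumes "\<sigma> = 1 \<or> \<sigma> = -1"
  shows "cyclic_walk n \<sigma> j \<le> n"
    and "(cyclic_walk n \<sigma> j + 1) mod Suc n = cyclic_walk n \<sigma> (j + \<sigma>)"
    and "(cyclic_walk n \<sigma> j + n) mod Suc n = cyclic_walk n \<sigma> (j - \<sigma>)"
proof -
  have pos: "0 \<le> x mod int (Suc n)" "x mod int (Suc n) < int (Suc n)" for x by simp_all
  show "cyclic_walk n \<sigma> j \<le> n" using pos[of "\<sigma> * j"] unfolding cyclic_walk_def by linarith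
  have int: "int (cyclic_walk n \<sigma> i) = (\<sigma> * i) mod int (Suc n)" for i
    using pos(1)[of "\<sigma> * i"] by (simp add: cyclic_walk_def)
  have sq: "\<sigma> * (j + \<sigma>) = \<sigma> * j + 1" "\<sigma> * (j - \<sigma>) = \<sigma> * j - 1"
    using assms by auto
  have "int ((cyclic_walk n \<sigma> j + 1) mod Suc n) = ((\<sigma> * j) mod int (Suc n) + 1) mod int (Suc n)"
    by (simp only: zmod_int of_nat_add int of_nat_1)
  also have "\<dots> = int (cyclic_walk n \<sigma> (j + \<sigma>))"
    unfolding int sq by (rule mod_add_left_eq)
  finally show "(cyclic_walk n \<sigma> j + 1) mod Suc n = cyclic_walk n \<sigma> (j + \<sigma>)" by (simp only: of_nat_eq_iff)
  have "int ((cyclic_walk n \<sigma> j + n) mod Suc n) = ((\<sigma> * j) mod int (Suc n) + int n) mod int (Suc n)"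
    by (simp only: zmod_int of_nat_add int)
  also have "\<dots> = (\<sigma> * j + int n) mod int (Suc n)"
    by (rule mod_add_left_eq)
  also have "\<sigma> * j + int n = (\<sigma> * j - 1) + int (Suc n)" by simp
  also have "\<dots> mod int (Suc n) = int (cyclic_walk n \<sigma> (j - \<sigma>))"
    unfolding int sq by (rule mod_add_self2)
  finally show "(cyclic_walk n \<sigma> j + n) mod Suc n = cyclic_walk n \<sigma> (j - \<sigma>)" by (simp only: of_nat_eq_iff)
qed

lemma stable_thin_particle_walk:
  assumes n: "n \<ge> 2" and \<sigma>: "\<sigma> = 1 \<or> \<sigma> = -1"
  shows "stable_thin (aff_datum n) (particle_family {0..n} (cyclic_walk n \<sigma>))"
proof -
  have nb: "cyclic_walk n \<sigma> j \<le> n"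
    "{cyclic_walk n \<sigma> (j - 1), cyclic_walk n \<sigma> (j + 1)} =
      {(cyclic_walk n \<sigma> j + n) mod Suc n, (cyclic_walk n \<sigma> j + 1) mod Suc n}" for j
    using cyclic_walk_neighbours[OF \<sigma>, of n j] \<sigma> by auto
  have "stable_thin (aff_datum n) (particle_family (idx (aff_datum n)) (cyclic_walk n \<sigma>))"
  proof (rule stable_thin_particle_family)
    fix j
    show "cyclic_walk n \<sigma> j \<in> idx (aff_datum n)" using nb(1) by simp
    have ne: "(cyclic_walk n \<sigma> j + n) mod Suc n \<noteq> (cyclic_walk n \<sigma> j + 1) mod Suc n"
      "(cyclic_walk n \<sigma> j + n) mod Suc n \<noteq> cyclic_walk n \<sigma> j" "(cyclic_walk n \<sigma> j + 1) mod Suc n \<noteq> cyclic_walk n \<sigma> j"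
      using aff_neighbours(2)[OF n nb(1)] cyclic_succ[OF nb(1)] cyclic_pred[OF nb(1)] n
      by (auto split: if_splits)
    show "cyclic_walk n \<sigma> j \<noteq> cyclic_walk n \<sigma> (j + 1)" "cyclic_walk n \<sigma> (j - 1) \<noteq> cyclic_walk n \<sigma> (j + 1)"
    proof -
      have "cyclic_walk n \<sigma> (j + 1) \<in> {(cyclic_walk n \<sigma> j + n) mod Suc n, (cyclic_walk n \<sigma> j + 1) mod Suc n}"
        using nb(2)[of j] by blast
      then show "cyclic_walk n \<sigma> j \<noteq> cyclic_walk n \<sigma> (j + 1)" using ne(2,3) by (elim insertE) simp_all
      show "cyclic_walk n \<sigma> (j - 1) \<noteq> cyclic_walk n \<sigma> (j + 1)"
      proof
        assume "cyclic_walk n \<sigma> (j - 1) = cyclic_walk n \<sigma> (j + 1)"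
        then have "{cyclic_walk n \<sigma> (j + 1)} = {(cyclic_walk n \<sigma> j + n) mod Suc n, (cyclic_walk n \<sigma> j + 1) mod Suc n}"
          using nb(2)[of j] by simp
        then have "(cyclic_walk n \<sigma> j + n) mod Suc n \<in> {cyclic_walk n \<sigma> (j + 1)}"
          "(cyclic_walk n \<sigma> j + 1) mod Suc n \<in> {cyclic_walk n \<sigma> (j + 1)}" by blast+
        with ne(1) show False by simp
      qed
    qed
    fix i assume "i \<in> idx (aff_datum n)"
    then have "cmat (aff_datum n) (cyclic_walk n \<sigma> j) i = -1 \<longleftrightarrow>
        i \<in> {i \<in> {0..n}. cmat (aff_datum n) (cyclic_walk n \<sigma> j) i = -1}"
      by (simp del: aff_datum_simps(2))
    then show "cmat (aff_datum n) (cyclic_walk n \<sigma> j) i = -1 \<longleftrightarrow> i = cyclic_walk n \<sigma> (j - 1) \<or> i = cyclic_walk n \<sigma> (j + 1)"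
      unfolding aff_neighbours(1)[OF n nb(1)] nb(2)[symmetric] by simp
  qed
  then show ?thesis by simp
qed

lemma extremal_monomial_particle:
  assumes n: "n \<ge> 2" and \<sigma>: "\<sigma> = 1 \<and> l = 1 \<or> \<sigma> = -1 \<and> l = n"
  shows "snd (loop_monomial n l) \<in> particle_family {0..n} (cyclic_walk n \<sigma>)"
proof -
  have "cyclic_walk n \<sigma> 1 = l" "cyclic_walk n \<sigma> (1 - 1) = 0" "min l (n + 1 - l) = 1"
    using \<sigma> n by (auto simp: cyclic_walk_def zmod_minus1)
  then have "expon (snd (loop_monomial n l)) i l' = (if i = cyclic_walk n \<sigma> 1 \<and> l' = 1 - 1 then 1
      else if i = cyclic_walk n \<sigma> (1 - 1) \<and> l' = 1 then -1 else 0)" for i l'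
    using \<sigma> n by (auto simp: loop_monomial_def lookup_minus expon_Yv)
  then show ?thesis unfolding particle_family_def by blast
qed

lemma loop_monomial_stable_thin:
  assumes n: "n = 2 * r + 1" "1 \<le> r" and l: "l \<in> {1, r + 1, n}"
  obtains Q where "stable_thin (aff_datum n) Q" "snd (loop_monomial n l) \<in> Q"
proof -
  have n2: "n \<ge> 2" using n by simp
  consider "l = r + 1" | "l = 1" | "l = n" using l by auto
  then show thesis
  proof cases
    case 1
    then show ?thesis using that[OF stable_thin_aff_heights[OF n2]] middle_monomial_heights[OF n(2,1)] by blast
  next
    case 2
    then show ?thesis using that[OF stable_thin_particle_walk[OF n2]] extremal_monomial_particle[OF n2, of 1 l] by blast
  next
    case 3
    then show ?thesis using that[OF stable_thin_particle_walk[OF n2]] extremal_monomial_particle[OF n2, of "-1" l] by blast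
  qed
qed

locale loop_crystal = generic_parameter t for t +
  fixes n r l :: nat and s :: "nat \<Rightarrow> int"
  assumes n: "n = 2 * r + 1" "1 \<le> r" and l: "l \<in> {1, r + 1, n}"
    and parity: "parity_function (aff_datum n) s"
    and els: "loop_monomial n l \<in> els (aff_crystal n s)"
begin

abbreviation S :: "affmon set" where
  "S \<equiv> subcrystal (aff_crystal n s) (loop_monomial n l)"

lemma n2: "n \<ge> 2"
  using n by simp

sublocale thin_crystal "aff_datum n" t "aff_crystal n s" "aff_A n" S
proof -
  obtain Q where Q: "stable_thin (aff_datum n) Q" "snd (loop_monomial n l) \<in> Q"
    by (rule loop_monomial_stable_thin[OF n l])
  have sub: "S \<subseteq> {m \<in> els (aff_crystal n s). expo (aff_crystal n s) m \<in> Q}"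
    by (rule monomial_crystal.subcrystal_stable_thin[OF monomial_crystal_aff[OF n2] Q(1) els])
      (use Q(2) els_step_aff[OF n2 parity] in simp_all)
  show "thin_crystal (aff_datum n) t (aff_crystal n s) (aff_A n) S"
  proof (intro thin_crystal.intro monomial_crystal_aff[OF n2] generic_parameter_axioms thin_crystal_axioms.intro)
    fix m i assume m: "m \<in> S" and i: "i \<in> idx (aff_datum n)"
    show "pairing (wt (aff_crystal n s) m) (hvec i) = of_int (total_expon (expo (aff_crystal n s) m) i)"
      using sub m i by auto
    show "thin_at i (expo (aff_crystal n s) m)"
      using sub m Q(1) i unfolding stable_thin_def by blast
  next
    fix m i m' assume "m \<in> S" "i \<in> idx (aff_datum n)" "etil (aff_crystal n s) i m = Some m'"
    then show "m' \<in> S" using subcrystal_closed[of m "aff_crystal n s" "loop_monomial n l" i m'] by simp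
  next
    fix m i m' assume "m \<in> S" "i \<in> idx (aff_datum n)" "ftil (aff_crystal n s) i m = Some m'"
    then show "m' \<in> S" using subcrystal_closed[of m "aff_crystal n s" "loop_monomial n l" i m'] by simp
  qed
qed

lemma is_loop_weight_V: "is_loop_weight_module n t (aff_crystal n s) S V"
  unfolding is_loop_weight_module_def Let_def
proof (intro conjI exI[of _ "\<lambda>m. bvec (Some m)"] ballI allI left_module_quotient_act is_basis_V)
  fix m assume m: "m \<in> S"
  then have v: "bvec (Some m) \<in> crystal_space S" by (simp add: crystal_space_single)
  {
    fix h assume "h \<in> cart (aff_datum n)"
    then show "uk (aff_datum n) t h \<odot>\<^bsub>V\<^esub> bvec (Some m) =
        usc (aff_datum n) t (qpow t (pairing (wt (aff_crystal n s) m) h)) \<odot>\<^bsub>V\<^esub> bvec (Some m)"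
      using v by (simp add: uk_def usc_def quotient_act_cls falg_gn alg_act_cst)
  }
  fix i assume i: "i \<in> idx (aff_datum n)"
  {
    fix e k
    obtain c l where "sole_at i c l (expo (aff_crystal n s) m)" "c \<in> {-1, 0, 1}"
      using thin[OF m i] by (auto simp: thin_at_def)
    then show "uphi (aff_datum n) t e i (sg e * int k) \<odot>\<^bsub>V\<^esub> bvec (Some m) =
        usc (aff_datum n) t (fps_nth (lweight_series t e i (expo (aff_crystal n s) m)) k) \<odot>\<^bsub>V\<^esub> bvec (Some m)"
      using v i phi_act[OF m i, of c l e k]
      by (simp add: uphi_def usc_def quotient_act_cls falg_phi_elt alg_act_cst lweight_series_sole
          del: bvec.simps aff_crystal_simps)
  }
  show "ux (aff_datum n) t Pos i 0 \<odot>\<^bsub>V\<^esub> bvec (Some m) =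
      (case etil (aff_crystal n s) i m of None \<Rightarrow> \<zero>\<^bsub>V\<^esub> | Some m' \<Rightarrow> bvec (Some m'))"
    using v i by (simp add: ux_def quotient_act_cls falg_gn move_def split: option.split)
  show "ux (aff_datum n) t Neg i 0 \<odot>\<^bsub>V\<^esub> bvec (Some m) =
      (case ftil (aff_crystal n s) i m of None \<Rightarrow> \<zero>\<^bsub>V\<^esub> | Some m' \<Rightarrow> bvec (Some m'))"
    using v i by (simp add: ux_def quotient_act_cls falg_gn move_def split: option.split)
qed

lemma loop_weight_module_unique:
  assumes "is_loop_weight_module n t (aff_crystal n s) S W"
  shows "module_iso (quantum_alg (aff_datum n) t) V W"
proof -
  let ?R = "aff_datum n" and ?C = "aff_crystal n s"
  have W: "left_module (quantum_alg ?R t) W"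
    using assms by (simp add: is_loop_weight_module_def Let_def)
  obtain b where b: "is_basis ?R t W S b"
    and K: "\<And>m h. m \<in> S \<Longrightarrow> h \<in> cart ?R \<Longrightarrow> uk ?R t h \<odot>\<^bsub>W\<^esub> b m = usc ?R t (qpow t (pairing (wt ?C m) h)) \<odot>\<^bsub>W\<^esub> b m"
    and phi: "\<And>m i e k. m \<in> S \<Longrightarrow> i \<in> idx ?R \<Longrightarrow> uphi ?R t e i (sg e * int k) \<odot>\<^bsub>W\<^esub> b m
      = usc ?R t (fps_nth (lweight_series t e i (expo ?C m)) k) \<odot>\<^bsub>W\<^esub> b m"
    and X: "\<And>m i. m \<in> S \<Longrightarrow> i \<in> idx ?R \<Longrightarrow> ux ?R t Pos i 0 \<odot>\<^bsub>W\<^esub> b m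
      = (case etil ?C i m of None \<Rightarrow> \<zero>\<^bsub>W\<^esub> | Some m' \<Rightarrow> b m')"
      "\<And>m i. m \<in> S \<Longrightarrow> i \<in> idx ?R \<Longrightarrow> ux ?R t Neg i 0 \<odot>\<^bsub>W\<^esub> b m
      = (case ftil ?C i m of None \<Rightarrow> \<zero>\<^bsub>W\<^esub> | Some m' \<Rightarrow> b m')"
    using assms unfolding is_loop_weight_module_def Let_def by blast
  interpret W: quantum_module ?R t W
    by (intro quantum_module.intro simply_laced_aff W)
  interpret same_loop_weights ?R t ?C "aff_A n" S W b
  proof (intro same_loop_weights.intro same_loop_weights_axioms.intro thin_crystal_axioms W.quantum_module_axioms)
    show "is_basis ?R t W S b" by (rule b)
  next
    fix m h assume "m \<in> S" "h \<in> cart ?R"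
    from K[OF this] show "W.opr (gn (K h)) (b m) = W.opr (cst (qpow t (pairing (wt ?C m) h))) (b m)"
      by (simp only: W.opr_def uk_def usc_def)
  next
    fix m i e k assume "m \<in> S" "i \<in> idx ?R"
    from phi[OF this] show "W.opr (phi_elt t e i (sg e * int k)) (b m)
        = W.opr (cst (fps_nth (lweight_series t e i (expo ?C m)) k)) (b m)"
      by (simp only: W.opr_def uphi_def usc_def)
  next
    fix m i e assume m: "m \<in> S" "i \<in> idx ?R"
    show "W.opr (gn (X e i 0)) (b m) = (case move e i m of None \<Rightarrow> \<zero>\<^bsub>W\<^esub> | Some m' \<Rightarrow> b m')"
      using X[OF m] by (cases e) (simp_all only: W.opr_def ux_def move_def sgn.case)
  qed
  show ?thesis by (rule isomorphic)
qed

end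


theorem theorem4p12:
  fixes t :: complex
  assumes q_not_root_of_unity: "\<And>j::nat. j > 0 \<Longrightarrow> exp t ^ j \<noteq> 1"
  shows
    "(\<forall>(n::nat) (l::nat) (k::int) (s::nat \<Rightarrow> int).
        1 \<le> n \<and> 1 \<le> l \<and> l \<le> n \<and> parity_function (fin_datum n) s \<and>
        Yv l k \<in> els (fin_crystal n s) \<longrightarrow>
        (let U = quantum_alg (fin_datum n) t; S = subcrystal (fin_crystal n s) (Yv l k)
         in \<exists>act. left_module U (crystal_module S act) \<and>
              acts_by_formulas (fin_datum n) t (fin_crystal n s) S act \<and>
              is_fundamental_module n t l k (crystal_module S act) \<and>
              (\<forall>W :: (freealg set, 'w) module. is_fundamental_module n t l k W \<longrightarrow>
                 module_iso U (crystal_module S act) W)))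
     \<and>
     (\<forall>(n::nat) (r::nat) (l::nat) (s::nat \<Rightarrow> int).
        n = 2 * r + 1 \<and> 1 \<le> r \<and> l \<in> {1, r + 1, n} \<and> parity_function (aff_datum n) s \<and>
        loop_monomial n l \<in> els (aff_crystal n s) \<longrightarrow>
        (let U = quantum_alg (aff_datum n) t;
             S = subcrystal (aff_crystal n s) (loop_monomial n l)
         in \<exists>act. left_module U (crystal_module S act) \<and>
              acts_by_formulas (aff_datum n) t (aff_crystal n s) S act \<and>
              is_loop_weight_module n t (aff_crystal n s) S (crystal_module S act) \<and>
              (\<forall>W :: (freealg set, 'w) module.
                 is_loop_weight_module n t (aff_crystal n s) S W \<longrightarrow>
                 module_iso U (crystal_module S act) W)))"
proof -
  interpret generic_parameter t by (rule generic_parameter.intro[OF q_not_root_of_unity])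
  show ?thesis
    unfolding Let_def
  proof (intro conjI allI impI)
    fix n l :: nat and k :: int and s :: "nat \<Rightarrow> int"
    assume "1 \<le> n \<and> 1 \<le> l \<and> l \<le> n \<and> parity_function (fin_datum n) s \<and> Yv l k \<in> els (fin_crystal n s)"
    then interpret F: fundamental_crystal t n l k s by unfold_locales auto
    have "module_iso (quantum_alg (fin_datum n) t) F.V W"
      if "is_fundamental_module n t l k W" for W :: "(freealg set, 'w) module"
      by (rule fundamental_module_unique[OF F.l F.is_fundamental_V that])
    then show "\<exists>act. left_module (quantum_alg (fin_datum n) t) (crystal_module F.S act) \<and>
        acts_by_formulas (fin_datum n) t (fin_crystal n s) F.S act \<and>
        is_fundamental_module n t l k (crystal_module F.S act) \<and>
        (\<forall>W :: (freealg set, 'w) module. is_fundamental_module n t l k W \<longrightarrow>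
           module_iso (quantum_alg (fin_datum n) t) (crystal_module F.S act) W)"
      using F.left_module_quotient_act F.acts_by_formulas F.is_fundamental_V by blast
  next
    fix n r l :: nat and s :: "nat \<Rightarrow> int"
    assume "n = 2 * r + 1 \<and> 1 \<le> r \<and> l \<in> {1, r + 1, n} \<and> parity_function (aff_datum n) s \<and>
      loop_monomial n l \<in> els (aff_crystal n s)"
    then interpret L: loop_crystal t n r l s by unfold_locales auto
    have "module_iso (quantum_alg (aff_datum n) t) L.V W"
      if "is_loop_weight_module n t (aff_crystal n s) L.S W" for W :: "(freealg set, 'w) module"
      by (rule L.loop_weight_module_unique[OF that])
    then show "\<exists>act. left_module (quantum_alg (aff_datum n) t) (crystal_module L.S act) \<and>
        acts_by_formulas (aff_datum n) t (aff_crystal n s) L.S act \<and>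
        is_loop_weight_module n t (aff_crystal n s) L.S (crystal_module L.S act) \<and>
        (\<forall>W :: (freealg set, 'w) module. is_loop_weight_module n t (aff_crystal n s) L.S W \<longrightarrow>
           module_iso (quantum_alg (aff_datum n) t) (crystal_module L.S act) W)"
      using L.left_module_quotient_act L.acts_by_formulas L.is_loop_weight_V by blast
  qed
qed

end
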